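(* Suppose $\beta\mu<1$, $\sigma^2<\infty$ and $\beta>1$. Then, as $n\to\infty$, $|X_n|/n$ converges $\mathbb{P}$-a.s. to $$\nu_\beta=\frac{\mu(\beta-1)(1-\beta\mu)}{\mu(\beta+1)(1-\beta\mu)+2\beta(\sigma^2-\mu(1-\mu))}.$$
   Context: Let $\xi$ be an offspring random variable with $\mathbf{P}(\xi=k)=p_k$, mean $\mu\in(0,1)$ and variance $\sigma^2$, such that $p_k>0$ for some $k\ge2$. The Galton-Watson tree conditioned to survive, $\mathcal{T}^*$ (law $\mathbf{P}$), is the random infinite rooted tree constructed as follows: start with one special vertex $\rho_0=\rho$ (the root); at each generation every normal vertex independently gives birth to normal vertices according to the law of $\xi$, and the special vertex independently gives birth to vertices according to the size-biased law $\mathbf{P}(\xi^*=k)=kp_k/\mu$, one of which is chosen uniformly at random to be special (denoted $\rho_k$ in generation $k$). The $\beta$-biased random walk $(X_n)_{n\ge0}$ on $\mathcal{T}^*$ starts from $X_0=\rho$; at a vertex $x\ne\rho$ with $d_x$ children it moves to the parent of $x$ with probability $\frac{1}{1+\beta d_x}$ and to each child with probability $\frac{\beta}{1+\beta d_x}$; at $\rho$ it moves to each child with probability $1/d_\rho$. $P^{\mathcal{T}^*}$ is the law of the walk for fixed tree and $\mathbb{P}(\cdot)=\int P^{\mathcal{T}^*}(\cdot)\,\mathbf{P}(d\mathcal{T}^* )$ the annealed law. $|x|$ denotes the graph distance from $x$ to $\rho$. *)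

theory Defs
  imports "HOL-Probability.Probability"
begin

text \<open>A rooted ordered tree is encoded by a function \<open>T\<close> giving the number of children of each
  Ulam-Harris label: the root is \<open>[]\<close> and the children of \<open>u\<close> are \<open>u @ [0], \<dots>, u @ [T u - 1]\<close>.
  Only the values of \<open>T\<close> on \<open>tree_vertices T\<close> matter.\<close>

type_synonym tree = "nat list \<Rightarrow> nat"

definition tree_vertices :: "tree \<Rightarrow> nat list set" where
  "tree_vertices T = {u. \<forall>i<length u. u ! i < T (take i u)}"

definition tree_adj :: "tree \<Rightarrow> (nat list \<times> nat list) set" where
  "tree_adj T = {(u, v). u \<in> tree_vertices T \<and> v \<in> tree_vertices T \<and>
                         ((\<exists>i. v = u @ [i]) \<or> (\<exists>i. u = v @ [i]))}"

text \<open>Graph distance; the value is meaningful only for vertices of \<open>T\<close>.\<close>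

definition tree_dist :: "tree \<Rightarrow> nat list \<Rightarrow> nat list \<Rightarrow> nat" where
  "tree_dist T u v = (LEAST n. (u, v) \<in> tree_adj T ^^ n)"

lemma tree_vertices_Nil [simp]: "[] \<in> tree_vertices T"
  by (simp add: tree_vertices_def)

lemma tree_vertices_snoc [simp]:
  "u @ [i] \<in> tree_vertices T \<longleftrightarrow> u \<in> tree_vertices T \<and> i < T u"
  by (auto simp: tree_vertices_def nth_append less_Suc_eq)

lemma tree_dist_root:
  assumes "u \<in> tree_vertices T"
  shows "tree_dist T u [] = length u"
  unfolding tree_dist_def
proof (rule Least_equality)
  show "(u, []) \<in> tree_adj T ^^ length u"
    using assms
  proof (induction u rule: rev_induct)
    case (snoc i u)
    then have "(u @ [i], u) \<in> tree_adj T"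
      by (auto simp: tree_adj_def)
    with snoc show ?case
      by (auto intro: relpow_Suc_I2 simp del: relpow.simps)
  qed auto
next
  fix n assume "(u, []) \<in> tree_adj T ^^ n"
  then show "length u \<le> n"
  proof (induction n arbitrary: u)
    case (Suc n)
    from Suc.prems obtain v where v: "(u, v) \<in> tree_adj T" "(v, []) \<in> tree_adj T ^^ n"
      by (rule relpow_Suc_E2)
    from v(1) have "length u \<le> Suc (length v)"
      by (auto simp: tree_adj_def)
    with Suc.IH[OF v(2)] show ?case
      by simp
  qed auto
qed

definition tree_space :: "tree measure" where
  "tree_space = PiM UNIV (\<lambda>_. count_space UNIV)"

definition offspring_mean :: "nat pmf \<Rightarrow> real" where
  "offspring_mean p = measure_pmf.expectation p real"

definition size_biased :: "nat pmf \<Rightarrow> nat pmf" where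
  "size_biased p = embed_pmf (\<lambda>k. real k * pmf p k / offspring_mean p)"

lemma pmf_size_biased:
  assumes "offspring_mean p > 0"
  shows "pmf (size_biased p) k = real k * pmf p k / offspring_mean p"
  unfolding size_biased_def
proof (rule pmf_embed_pmf)
  have int: "integrable (measure_pmf p) real"
    using assms not_integrable_integral_eq unfolding offspring_mean_def by fastforce
  have "(\<integral>\<^sup>+ k. ennreal (real k * pmf p k / offspring_mean p) \<partial>count_space UNIV) =
        (\<integral>\<^sup>+ k. ennreal (pmf p k) * ennreal (real k / offspring_mean p) \<partial>count_space UNIV)"
    using assms by (intro nn_integral_cong) (simp flip: ennreal_mult add: mult_ac)
  also have "\<dots> = (\<integral>\<^sup>+ k. ennreal (real k / offspring_mean p) \<partial>measure_pmf p)"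
    by (simp add: nn_integral_measure_pmf)
  also have "\<dots> = ennreal (measure_pmf.expectation p (\<lambda>k. real k / offspring_mean p))"
    using assms int by (intro nn_integral_eq_integral) auto
  also have "measure_pmf.expectation p (\<lambda>k. real k / offspring_mean p) = 1"
    using assms int by (simp add: offspring_mean_def)
  finally show "(\<integral>\<^sup>+ k. ennreal (real k * pmf p k / offspring_mean p) \<partial>count_space UNIV) = 1"
    by simp
qed (use assms in auto)

text \<open>Offspring number of a special vertex together with the index of its special child.\<close>

definition special_pmf :: "nat pmf \<Rightarrow> (nat \<times> nat) pmf" where
  "special_pmf p =
     do { k \<leftarrow> size_biased p; i \<leftarrow> pmf_of_set {..<k}; return_pmf (k, i) }"

text \<open>\<open>s k\<close> holds the offspring number of the special vertex of generation \<open>k\<close> and the index of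
  its special child.\<close>

definition spine :: "(nat \<Rightarrow> nat \<times> nat) \<Rightarrow> nat \<Rightarrow> nat list" where
  "spine s k = map (\<lambda>j. snd (s j)) [0..<k]"

definition assemble_tree :: "(nat list \<Rightarrow> nat) \<Rightarrow> (nat \<Rightarrow> nat \<times> nat) \<Rightarrow> tree" where
  "assemble_tree \<xi> s = (\<lambda>u. if u = spine s (length u) then fst (s (length u)) else \<xi> u)"

definition surviving_gw_law :: "nat pmf \<Rightarrow> tree measure" where
  "surviving_gw_law p =
     distr (PiM UNIV (\<lambda>_. measure_pmf p) \<Otimes>\<^sub>M PiM UNIV (\<lambda>_. measure_pmf (special_pmf p)))
       tree_space (\<lambda>(\<xi>, s). assemble_tree \<xi> s)"

lemma measurable_assemble_tree:
  "(\<lambda>(\<xi>, s). assemble_tree \<xi> s) \<in>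
     PiM UNIV (\<lambda>_. measure_pmf p) \<Otimes>\<^sub>M PiM UNIV (\<lambda>_. measure_pmf q) \<rightarrow>\<^sub>M tree_space"
  (is "_ \<in> ?M \<rightarrow>\<^sub>M _")
  unfolding tree_space_def
proof (rule measurable_PiM_single')
  fix u :: "nat list"
  have s: "(\<lambda>\<omega>. snd \<omega> j) \<in> ?M \<rightarrow>\<^sub>M count_space UNIV" for j
    by (rule measurable_compose[OF measurable_snd])
       (use measurable_component_singleton[of j UNIV "\<lambda>_. measure_pmf q"]
        in \<open>simp add: measurable_cong_sets[OF refl sets_measure_pmf_count_space]\<close>)
  have x: "(\<lambda>\<omega>. fst \<omega> u) \<in> ?M \<rightarrow>\<^sub>M count_space UNIV"
    by (rule measurable_compose[OF measurable_fst])
       (use measurable_component_singleton[of u UNIV "\<lambda>_. measure_pmf p"]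
        in \<open>simp add: measurable_cong_sets[OF refl sets_measure_pmf_count_space]\<close>)
  have eq: "u = spine s' (length u) \<longleftrightarrow> (\<forall>j<length u. snd (s' j) = u ! j)" for s'
    unfolding spine_def by (subst list_eq_iff_nth_eq) auto
  have sj: "Measurable.pred ?M (\<lambda>\<omega>. snd (snd \<omega> j) = u ! j)" for j
    by (rule measurable_compose[OF s]) simp
  have P: "Measurable.pred ?M (\<lambda>\<omega>. u = spine (snd \<omega>) (length u))"
    unfolding eq using sj by measurable
  have f: "(\<lambda>\<omega>. fst (snd \<omega> (length u))) \<in> ?M \<rightarrow>\<^sub>M count_space UNIV"
    by (rule measurable_compose[OF s]) simp
  have "(\<lambda>\<omega>. if u = spine (snd \<omega>) (length u) then fst (snd \<omega> (length u)) else fst \<omega> u)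
          \<in> ?M \<rightarrow>\<^sub>M count_space UNIV"
    using measurable_If[OF f x] P by (simp add: pred_def)
  then show "(\<lambda>\<omega>. (case \<omega> of (\<xi>, s) \<Rightarrow> assemble_tree \<xi> s) u) \<in> ?M \<rightarrow>\<^sub>M count_space UNIV"
    by (simp add: assemble_tree_def case_prod_beta)
qed auto

lemma prob_space_surviving_gw_law: "prob_space (surviving_gw_law p)"
proof -
  interpret A: product_prob_space "\<lambda>_::nat list. measure_pmf p" UNIV
    by unfold_locales
  interpret B: product_prob_space "\<lambda>_::nat. measure_pmf (special_pmf p)" UNIV
    by unfold_locales
  interpret AB: pair_prob_space "PiM UNIV (\<lambda>_::nat list. measure_pmf p)"
    "PiM UNIV (\<lambda>_::nat. measure_pmf (special_pmf p))"
    by unfold_locales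
  show ?thesis
    unfolding surviving_gw_law_def
    by (rule AB.prob_space_distr[OF measurable_assemble_tree])
qed

lemma sets_surviving_gw_law [simp, measurable_cong]: "sets (surviving_gw_law p) = sets tree_space"
  by (simp add: surviving_gw_law_def)

text \<open>From a vertex with \<open>d\<close> children that is not the root, the walk moves to the parent with
  probability \<open>1 / (1 + \<beta> d)\<close> and otherwise to a uniformly chosen child; see
  \<open>pmf_walk_step_parent\<close> and \<open>pmf_walk_step_child\<close> for the resulting transition probabilities.
  The step is a junk value at a root without children, which almost surely does not occur here.\<close>

definition walk_step :: "real \<Rightarrow> tree \<Rightarrow> nat list \<Rightarrow> nat list pmf" where
  "walk_step \<beta> T x =
     (let to_child = map_pmf (\<lambda>i. x @ [i]) (pmf_of_set {..<T x})
      in if x = [] then to_child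
         else do { up \<leftarrow> bernoulli_pmf (1 / (1 + \<beta> * T x));
                   if up then return_pmf (butlast x) else to_child })"

lemma pmf_to_child:
  assumes "i < (d::nat)"
  shows "pmf (map_pmf (\<lambda>i. x @ [i]) (pmf_of_set {..<d})) (x @ [i]) = 1 / d"
proof -
  have "inj (\<lambda>i. x @ [i])"
    by (auto simp: inj_def)
  from pmf_map_inj'[OF this, of "pmf_of_set {..<d}" i] show ?thesis
    using assms by (subst (asm) pmf_of_set) auto
qed

lemma pmf_walk_step_root: "i < T [] \<Longrightarrow> pmf (walk_step \<beta> T []) [i] = 1 / T []"
  using pmf_to_child[of i "T []" "[]"] by (simp add: walk_step_def)

lemma pmf_walk_step_child:
  assumes "0 \<le> \<beta>" "x \<noteq> []" "i < T x"
  shows "pmf (walk_step \<beta> T x) (x @ [i]) = \<beta> / (1 + \<beta> * T x)"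
proof -
  have "length (butlast x) \<noteq> length (x @ [i])"
    by simp
  then have *: "butlast x \<noteq> x @ [i]"
    by metis
  have "0 < 1 + \<beta> * T x"
    using assms by (simp add: add_pos_nonneg)
  then show ?thesis
    using assms * pmf_to_child[of i "T x" x]
    by (simp add: walk_step_def pmf_bind field_simps)
qed

lemma pmf_walk_step_parent:
  assumes "0 \<le> \<beta>" "x \<noteq> []"
  shows "pmf (walk_step \<beta> T x) (butlast x) = 1 / (1 + \<beta> * T x)"
proof -
  have "x @ [i] \<noteq> butlast x" for i
  proof
    assume "x @ [i] = butlast x"
    then have "length (x @ [i]) = length (butlast x)"
      by (rule arg_cong)
    then show False
      by simp
  qed
  then have *: "pmf (map_pmf (\<lambda>i. x @ [i]) (pmf_of_set {..<T x})) (butlast x) = 0"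
    by (auto simp: pmf_eq_0_set_pmf) metis
  have "0 < 1 + \<beta> * T x"
    using assms by (simp add: add_pos_nonneg)
  then show ?thesis
    using assms * by (simp add: walk_step_def pmf_bind field_simps)
qed

definition path_space :: "(nat \<Rightarrow> nat list) measure" where
  "path_space = PiM UNIV (\<lambda>_. count_space UNIV)"

text \<open>Conditional law of the \<open>n\<close>-th position given the positions before time \<open>n\<close>; the walk starts
  at the root. The Ionescu-Tulcea theorem yields the law of the whole trajectory, whose
  finite-dimensional distributions are computed in \<open>emeasure_walk_law\<close>.\<close>

definition walk_kernel :: "real \<Rightarrow> tree \<Rightarrow> nat \<Rightarrow> (nat \<Rightarrow> nat list) \<Rightarrow> nat list measure" where
  "walk_kernel \<beta> T n X =
     measure_pmf (case n of 0 \<Rightarrow> return_pmf [] | Suc m \<Rightarrow> walk_step \<beta> T (X m))"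

interpretation walk: Ionescu_Tulcea "walk_kernel \<beta> T" "\<lambda>_. count_space UNIV" for \<beta> T
proof (rule Ionescu_Tulcea.intro)
  fix n
  show "walk_kernel \<beta> T n \<in> PiM {0..<n} (\<lambda>_. count_space UNIV) \<rightarrow>\<^sub>M subprob_algebra (count_space UNIV)"
  proof (cases n)
    case (Suc m)
    have "(\<lambda>X. X m) \<in> PiM {0..<n} (\<lambda>_. count_space UNIV) \<rightarrow>\<^sub>M count_space UNIV"
      using Suc by (intro measurable_component_singleton) auto
    from measurable_compose[OF this measurable_measure_pmf[of "walk_step \<beta> T"]] show ?thesis
      using Suc by (simp add: walk_kernel_def[abs_def])
  next
    case 0
    then show ?thesis
      by (simp add: walk_kernel_def[abs_def] space_subprob_algebra
            measure_pmf.subprob_space_axioms)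
  qed
next
  fix n X
  show "prob_space (walk_kernel \<beta> T n X)"
    by (simp add: walk_kernel_def measure_pmf.prob_space_axioms)
qed

definition walk_law :: "real \<Rightarrow> tree \<Rightarrow> (nat \<Rightarrow> nat list) measure" where
  "walk_law \<beta> T = walk.PF.lim \<beta> T"

text \<open>The annealed law, as the joint law of the tree and the walk on it.\<close>

definition annealed_law :: "real \<Rightarrow> nat pmf \<Rightarrow> (tree \<times> (nat \<Rightarrow> nat list)) measure" where
  "annealed_law \<beta> p =
     do { T \<leftarrow> surviving_gw_law p;
          X \<leftarrow> walk_law \<beta> T;
          return (tree_space \<Otimes>\<^sub>M path_space) (T, X) }"

lemma sets_walk_law [simp, measurable_cong]: "sets (walk_law \<beta> T) = sets path_space"
  by (simp add: walk_law_def path_space_def)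

lemma space_path_space [simp]: "space path_space = UNIV"
  by (simp add: path_space_def space_PiM)

lemma space_tree_space [simp]: "space tree_space = UNIV"
  by (simp add: tree_space_def space_PiM)

lemma emeasure_C_walk:
  "emeasure (walk.C \<beta> T 0 n (\<lambda>_. undefined)) {restrict x {0..<n}} =
     (\<Prod>i<n. emeasure (walk_kernel \<beta> T i x) {x i})"
proof (induction n)
  case 0
  show ?case
    by (simp add: restrict_def sets_PiM_empty)
next
  case (Suc n)
  let ?M = "\<lambda>n. PiM {0..<n} (\<lambda>_. count_space UNIV :: nat list measure)"
  let ?r = "\<lambda>n. restrict x {0..<n}"
  let ?C = "walk.C \<beta> T 0 n (\<lambda>_. undefined)"
  have sing: "{?r n} \<in> sets (?M n)" for n
  proof -
    have "{?r n} = PiE {0..<n} (\<lambda>i. {x i})"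
      by (auto simp: PiE_iff extensional_def fun_eq_iff)
    then show ?thesis
      by (simp add: sets_PiM_I_finite)
  qed
  have und: "(\<lambda>_. undefined) \<in> space (?M 0)"
    by (simp add: space_PiM PiE_iff extensional_def)
  have sC: "sets ?C = sets (?M n)" "space ?C = space (?M n)"
    using walk.sets_C[OF und, of \<beta> T n] walk.space_C[OF und, of \<beta> T n] by simp_all
  have "emeasure (walk.C \<beta> T 0 (Suc n) (\<lambda>_. undefined)) {?r (Suc n)} =
        (\<integral>\<^sup>+ X. emeasure (walk.eP \<beta> T n X) {?r (Suc n)} \<partial>?C)"
    unfolding walk.C.simps
    by (subst emeasure_bind[where N = "?M (Suc n)"])
       (use sing sC walk.measurable_eP[of \<beta> T n] in
         \<open>auto simp: measurable_cong_sets[OF sC(1) refl]\<close>)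
  also have "\<dots> = (\<integral>\<^sup>+ X. emeasure (walk_kernel \<beta> T n x) {x n} * indicator {?r n} X \<partial>?C)"
  proof (rule nn_integral_cong)
    fix X assume "X \<in> space ?C"
    then have X: "X \<in> space (?M n)"
      by (simp add: sC)
    then have ext: "X \<in> extensional {0..<n}"
      by (simp add: space_PiM PiE_iff)
    have "emeasure (walk.eP \<beta> T n X) {?r (Suc n)} =
          emeasure (walk_kernel \<beta> T n X) ((\<lambda>a. X(n := a)) -` {?r (Suc n)})"
      using walk.emeasure_eP[OF X sing] by simp
    also have "(\<lambda>a. X(n := a)) -` {?r (Suc n)} = (if X = ?r n then {x n} else {})"
    proof (cases "X = ?r n")
      case True
      have "X(n := a) = ?r (Suc n) \<longleftrightarrow> a = x n" for a
      proof
        assume "X(n := a) = ?r (Suc n)"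
        from fun_cong[OF this, of n] show "a = x n"
          by simp
      qed (auto simp: True fun_eq_iff restrict_def)
      then show ?thesis
        using True by auto
    next
      case False
      then obtain j where "j < n" "X j \<noteq> x j"
        using ext by (auto simp: fun_eq_iff extensional_def restrict_def split: if_splits)
      then have "(X(n := a)) j \<noteq> ?r (Suc n) j" for a
        by auto
      then have "X(n := a) \<noteq> ?r (Suc n)" for a
        by metis
      then show ?thesis
        using False by auto
    qed
    also have "emeasure (walk_kernel \<beta> T n X) \<dots> =
               emeasure (walk_kernel \<beta> T n x) {x n} * indicator {?r n} X"
      by (auto simp: walk_kernel_def split: nat.split)
    finally show "emeasure (walk.eP \<beta> T n X) {?r (Suc n)} =
               emeasure (walk_kernel \<beta> T n x) {x n} * indicator {?r n} X" .
  qed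
  also have "\<dots> = emeasure (walk_kernel \<beta> T n x) {x n} * emeasure ?C {?r n}"
    by (rule nn_integral_cmult_indicator) (simp add: sC sing)
  finally show ?case
    unfolding Suc.IH prod.lessThan_Suc by (simp only: mult.commute)
qed

lemma emeasure_walk_law_kernel:
  "emeasure (walk_law \<beta> T) {X. \<forall>i<n. X i = x i} = (\<Prod>i<n. emeasure (walk_kernel \<beta> T i x) {x i})"
proof -
  let ?M = "\<lambda>_::nat. count_space (UNIV :: nat list set)"
  let ?E = "{restrict x {0..<n}}"
  have "?E = PiE {0..<n} (\<lambda>i. {x i})"
    by (auto simp: PiE_iff extensional_def fun_eq_iff)
  then have sing: "?E \<in> sets (PiM {0..<n} ?M)"
    by (simp add: sets_PiM_I_finite)
  have eq: "{X. \<forall>i<n. X i = x i} = prod_emb UNIV ?M {0..<n} ?E"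
    by (auto simp: prod_emb_def space_PiM PiE_iff extensional_def restrict_def fun_eq_iff) metis
  have "prod_emb {0..<n} ?M {0..<n} ?E = ?E"
    by (rule prod_emb_id) (auto simp: space_PiM)
  then show ?thesis
    unfolding walk_law_def eq using sing walk.emeasure_CI[of "{0..<n}" n ?E \<beta> T]
    by (simp add: walk.lim emeasure_C_walk)
qed

lemma emeasure_walk_law:
  assumes "x 0 = []"
  shows "emeasure (walk_law \<beta> T) {X. \<forall>i\<le>n. X i = x i} =
           ennreal (\<Prod>i<n. pmf (walk_step \<beta> T (x i)) (x (Suc i)))"
proof -
  have "emeasure (walk_law \<beta> T) {X. \<forall>i\<le>n. X i = x i} =
        (\<Prod>i<Suc n. emeasure (walk_kernel \<beta> T i x) {x i})"
    by (simp add: emeasure_walk_law_kernel[symmetric] less_Suc_eq_le)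
  also have "\<dots> = (\<Prod>i<n. emeasure (walk_kernel \<beta> T (Suc i) x) {x (Suc i)})"
    using assms by (subst prod.lessThan_Suc_shift) (simp add: walk_kernel_def)
  finally show ?thesis
    by (simp add: walk_kernel_def emeasure_pmf_single prod_ennreal)
qed

lemma prob_space_walk_law: "prob_space (walk_law \<beta> T)"
proof
  show "emeasure (walk_law \<beta> T) (space (walk_law \<beta> T)) = 1"
    using emeasure_walk_law_kernel[of \<beta> T 0 undefined]
    by (simp add: sets_eq_imp_space_eq[OF sets_walk_law])
qed

lemma sets_path_space:
  "sets path_space = sigma_sets UNIV (insert {} (range (\<lambda>(n::nat, x). {X. \<forall>i<n. X i = x i})))"
  (is "_ = sigma_sets UNIV ?G")
proof (rule antisym)
  have "{X \<in> space path_space. \<forall>i\<in>{i. i < n}. X i = x i} \<in> sets path_space" for n and x :: "nat \<Rightarrow> nat list"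
    by (rule sets.sets_Collect_finite_All) (simp_all add: path_space_def)
  from this[simplified] have "{X. \<forall>i<n. X i = x i} \<in> sets path_space" for n and x :: "nat \<Rightarrow> nat list"
    .
  then show "sigma_sets UNIV ?G \<subseteq> sets path_space"
    by (intro sets.sigma_sets_subset[where M = path_space, simplified]) auto
next
  let ?S = "sigma UNIV ?G"
  have sS: "sets ?S = sigma_sets UNIV ?G"
    by (rule sets_measure_of) auto
  have cyl: "{X. X n \<in> A} \<in> sets ?S" for n and A :: "nat list set"
  proof -
    have "{X. X n \<in> A} = (\<Union>l\<in>{l. length l = Suc n \<and> l ! n \<in> A}. {X. \<forall>i<Suc n. X i = l ! i})"
      (is "_ = (\<Union>l\<in>?L. ?B l)")
    proof safe
      fix X assume "X n \<in> A"
      then show "X \<in> (\<Union>l\<in>?L. ?B l)"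
        by (intro UN_I[of "map X [0..<Suc n]"]) (auto simp del: upt_Suc)
    qed auto
    also have "\<dots> \<in> sets ?S"
    proof (rule sets.countable_UN')
      have "?B l \<in> sets ?S" for l
        unfolding sS by (rule sigma_sets.Basic) (rule insertI2, rule image_eqI[of _ _ "(Suc n, \<lambda>i. l ! i)"], auto)
      then show "?B ` ?L \<subseteq> sets ?S"
        by blast
    qed auto
    finally show ?thesis .
  qed
  have "(\<lambda>X. X) \<in> ?S \<rightarrow>\<^sub>M path_space"
    unfolding path_space_def
  proof (rule measurable_PiM_single')
    fix n :: nat
    show "(\<lambda>X. X n) \<in> ?S \<rightarrow>\<^sub>M count_space UNIV"
      by (rule measurableI) (use cyl in \<open>auto simp: vimage_def space_measure_of_conv\<close>)
  qed auto
  then show "sets path_space \<subseteq> sigma_sets UNIV ?G"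
    using measurable_sets[of "\<lambda>X. X" ?S path_space] sS by (auto simp: space_measure_of_conv)
qed

lemma measurable_walk_law [measurable]: "walk_law \<beta> \<in> tree_space \<rightarrow>\<^sub>M prob_algebra path_space"
proof (rule measurable_prob_algebra_generated[OF sets_path_space])
  show "Int_stable (insert {} (range (\<lambda>(n::nat, x). {X. \<forall>i<n. X i = (x i :: nat list)})))"
  proof (rule Int_stableI)
    fix A B :: "(nat \<Rightarrow> nat list) set"
    assume A: "A \<in> insert {} (range (\<lambda>(n::nat, x). {X. \<forall>i<n. X i = x i}))"
      and B: "B \<in> insert {} (range (\<lambda>(n::nat, x). {X. \<forall>i<n. X i = x i}))"
    show "A \<inter> B \<in> insert {} (range (\<lambda>(n::nat, x). {X. \<forall>i<n. X i = x i}))"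
    proof (cases "A \<inter> B = {}")
      case False
      then obtain X where X: "X \<in> A" "X \<in> B"
        by auto
      then obtain m n x y where xy: "A = {X. \<forall>i<m. X i = x i}" "B = {X. \<forall>i<n. X i = y i}"
        using A B by auto
      have "A \<inter> B = {Y. \<forall>i<max m n. Y i = X i}"
        using X unfolding xy by (auto simp: less_max_iff_disj)
      then show ?thesis
        by (intro insertI2 image_eqI[of _ _ "(max m n, X)"]) auto
    qed simp
  qed
next
  fix A :: "(nat \<Rightarrow> nat list) set"
  assume "A \<in> insert {} (range (\<lambda>(n::nat, x). {X. \<forall>i<n. X i = x i}))"
  then consider "A = {}" | n x where "A = {X. \<forall>i<n. X i = x i}"
    by auto
  then show "(\<lambda>T. emeasure (walk_law \<beta> T) A) \<in> borel_measurable tree_space"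
  proof cases
    case (2 n x)
    have "(\<lambda>T. emeasure (walk_kernel \<beta> T i x) {x i}) \<in> borel_measurable tree_space" for i
    proof (cases i)
      case (Suc m)
      define g where "g d = emeasure (measure_pmf (walk_step \<beta> (\<lambda>_. d) (x m))) {x i}" for d
      have "(\<lambda>T. T (x m)) \<in> tree_space \<rightarrow>\<^sub>M count_space UNIV"
        unfolding tree_space_def by (rule measurable_component_singleton) simp
      from measurable_compose[OF this, of g borel] show ?thesis
        using Suc by (simp add: g_def walk_kernel_def walk_step_def)
    qed (simp add: walk_kernel_def)
    then show ?thesis
      unfolding 2 emeasure_walk_law_kernel by (rule borel_measurable_prod_ennreal)
  qed simp
qed (auto simp: prob_space_walk_law)

lemma prob_space_annealed_law: "prob_space (annealed_law \<beta> p)"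
  unfolding annealed_law_def
proof (rule prob_space_bind')
  show "surviving_gw_law p \<in> space (prob_algebra tree_space)"
    by (simp add: space_prob_algebra prob_space_surviving_gw_law)
  show "(\<lambda>T. do { X \<leftarrow> walk_law \<beta> T; return (tree_space \<Otimes>\<^sub>M path_space) (T, X) })
          \<in> tree_space \<rightarrow>\<^sub>M prob_algebra (tree_space \<Otimes>\<^sub>M path_space)"
    by measurable
qed

end

theory Submission
  imports Defs
begin

text \<open>For a fixed tree the walk is a reversible nearest-neighbour chain in which the edge between generations
\<open>n\<close> and \<open>n + 1\<close> has conductance \<open>\<beta> ^ n\<close>, and the speed comes from an explicit coordinate with drift one.
Write \<open>S x\<close> for the total weight of the subtree at \<open>x\<close>, a descendant \<open>d\<close> generations below \<open>x\<close> counting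
\<open>\<beta> ^ d\<close>. Off the spine, the expected time to go from \<open>x\<close> to its parent is \<open>2 * S x - 1\<close>. Let \<open>B k\<close> be
the sum of \<open>S\<close> over the normal children of the special vertex of generation \<open>k\<close>; the expected time
\<open>m k\<close> to go from that vertex to the next special vertex satisfies
\<open>m (k + 1) = m k / \<beta> + (1 + \<beta>) / \<beta> + 2 * B (k + 1)\<close>. The function \<open>h\<close> which increases by \<open>m k\<close> along the
spine and decreases by \<open>2 * S x - 1\<close> on entering a normal vertex \<open>x\<close> therefore makes \<open>h (X n) - n\<close> a
martingale under the law of the walk on the fixed tree.

Everything is reduced to two properties of the single sequence \<open>B\<close>: its averages converge to some
\<open>b\<close>, and \<open>(B k)\<^sup>2 / (k + 1)\<^sup>2\<close> is summable. The second property controls the martingale: it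
makes a second explicit function \<open>F\<close> finite, and \<open>F\<close> is a Lyapunov function for the increments,
dominating the sum of \<open>(h (X (n + 1)) - h (X n) - 1)\<^sup>2 / (n + 1)\<^sup>2\<close> in mean. The martingale strong
law then gives \<open>h (X n) / n \<longlonglongrightarrow> 1\<close>. The first property gives \<open>h x \<sim> c * length x\<close>, where
\<open>c = ((\<beta> + 1) + 2 * \<beta> * b) / (\<beta> - 1)\<close> is the limiting average of \<open>m\<close>: an excursion into a bush of weight
\<open>B k = o(k)\<close> changes both sides by \<open>O(B k)\<close>. Hence the speed is \<open>1 / c\<close>;
this is \<open>walk_speed\<close>.

In the random tree the \<open>B k\<close> are independent and identically distributed, because given the
spine they read disjoint sets of labels, with conditional laws that depend only on the independent offspring
choices of the special vertices. Their mean is the mean number of normal siblings of a special child,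
\<open>(\<sigma>2 - \<mu> * (1 - \<mu>)) / \<mu>\<close>, times the mean weight \<open>\<Sum>n. (\<beta> * \<mu>) ^ n\<close> of a normal subtree;
this product is finite because the offspring variance is and \<open>\<beta> * \<mu> < 1\<close>. Truncating at level \<open>k + 1\<close>
and applying the martingale strong law once more yields both properties almost surely.\<close>

section \<open>A strong law for square-integrable martingales\<close>

text \<open>Kronecker's lemma for the weights \<open>(n + 1)\<^sup>2\<close>: the terms up to a fixed index are killed by \<open>1 / N\<^sup>2\<close>,
and the others only grow when \<open>N\<^sup>2\<close> is replaced by the smaller \<open>(n + 1)\<^sup>2\<close>, which leaves a tail of the
convergent series.\<close>

lemma kronecker_square_averages:
  fixes d :: "nat \<Rightarrow> real"
  assumes nonneg: "\<And>n. 0 \<le> d n" and sum: "summable (\<lambda>n. d n / (real (Suc n))\<^sup>2)"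
  shows "(\<lambda>N. (c + (\<Sum>i<N. d i)) / (real N)\<^sup>2) \<longlonglongrightarrow> 0"
proof (rule LIMSEQ_I)
  fix r :: real assume "0 < r"
  define a where "a n = d n / (real (Suc n))\<^sup>2" for n
  have a0: "0 \<le> a n" for n by (simp add: a_def nonneg)
  from sum have sa: "summable a" by (simp add: a_def[abs_def])
  from suminf_exist_split[OF _ sa, of "r/2"] \<open>0 < r\<close> obtain K where
    K: "norm (\<Sum>i. a (i + K)) < r/2" by auto
  have tail: "(\<Sum>i\<in>{K..<N}. a i) < r/2" for N
  proof (cases "K \<le> N")
    case True
    have "(\<Sum>i\<in>{K..<N}. a i) = (\<Sum>i<N-K. a (i + K))"
      using sum.shift_bounds_nat_ivl[of a 0 K "N-K"] True by (simp add: atLeast0LessThan)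
    also have "\<dots> \<le> (\<Sum>i. a (i + K))"
      using sa a0 by (intro sum_le_suminf) (auto simp: summable_iff_shift)
    finally show ?thesis using K by simp
  qed (use \<open>0 < r\<close> in auto)
  define C where "C = \<bar>c\<bar> + (\<Sum>i<K. d i)"
  have "(\<lambda>N. C / (real N)\<^sup>2) \<longlonglongrightarrow> 0"
    by (intro tendsto_divide_0[OF tendsto_const] filterlim_at_top_imp_at_infinity
        filterlim_pow_at_top filterlim_real_sequentially) auto
  then have "\<forall>\<^sub>F N in sequentially. norm (C / (real N)\<^sup>2) < r/2"
    using \<open>0 < r\<close> by (auto dest!: tendstoD[where e = "r/2"] simp: dist_norm)
  then obtain N0 where N0: "\<And>N. N \<ge> N0 \<Longrightarrow> norm (C / (real N)\<^sup>2) < r/2"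
    by (auto simp: eventually_sequentially)
  show "\<exists>no. \<forall>N\<ge>no. norm ((c + (\<Sum>i<N. d i)) / (real N)\<^sup>2 - 0) < r"
  proof (intro exI[of _ "max N0 (Suc K)"] allI impI)
    fix N assume N: "max N0 (Suc K) \<le> N"
    then have NK: "K \<le> N" "0 < N" by auto
    have split: "(\<Sum>i<N. d i) = (\<Sum>i<K. d i) + (\<Sum>i\<in>{K..<N}. d i)"
      using NK by (metis atLeast0LessThan sum.atLeastLessThan_concat zero_le)
    have "(\<Sum>i\<in>{K..<N}. d i) \<le> (\<Sum>i\<in>{K..<N}. a i * (real N)\<^sup>2)"
    proof (rule sum_mono)
      fix i assume "i \<in> {K..<N}"
      then have "(real (Suc i))\<^sup>2 \<le> (real N)\<^sup>2" by (intro power_mono) auto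
      then have "a i * (real (Suc i))\<^sup>2 \<le> a i * (real N)\<^sup>2" by (intro mult_left_mono a0)
      then show "d i \<le> a i * (real N)\<^sup>2" by (simp add: a_def)
    qed
    also have "\<dots> = (\<Sum>i\<in>{K..<N}. a i) * (real N)\<^sup>2" by (simp add: sum_distrib_right)
    finally have "\<bar>c + (\<Sum>i<N. d i)\<bar> \<le> C + (\<Sum>i\<in>{K..<N}. a i) * (real N)\<^sup>2"
      unfolding C_def split using sum_nonneg[of "{..<K}" d] sum_nonneg[of "{K..<N}" d] nonneg by fastforce
    then have "\<bar>c + (\<Sum>i<N. d i)\<bar> / (real N)\<^sup>2 \<le> C / (real N)\<^sup>2 + (\<Sum>i\<in>{K..<N}. a i)"
      using NK by (simp add: field_simps)
    moreover have "C / (real N)\<^sup>2 < r/2" using N0[of N] N abs_ge_self[of "C / (real N)\<^sup>2"] unfolding real_norm_def by linarith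
    ultimately show "norm ((c + (\<Sum>i<N. d i)) / (real N)\<^sup>2 - 0) < r"
      using tail[of N] unfolding diff_zero real_norm_def abs_divide abs_power2 by linarith
  qed
qed

lemma (in prob_space) square_integrable_mult:
  fixes f g :: "'a \<Rightarrow> real"
  assumes [measurable]: "f \<in> borel_measurable M" "g \<in> borel_measurable M"
    and "integrable M (\<lambda>x. (f x)\<^sup>2)" "integrable M (\<lambda>x. (g x)\<^sup>2)"
  shows "integrable M (\<lambda>x. f x * g x)"
proof (rule Bochner_Integration.integrable_bound)
  show "integrable M (\<lambda>x. (f x)\<^sup>2 + (g x)\<^sup>2)" using assms by auto
  have "\<bar>a * b\<bar> \<le> a\<^sup>2 + b\<^sup>2" for a b :: real
    using sum_squares_bound[of "\<bar>a\<bar>" "\<bar>b\<bar>"] mult_nonneg_nonneg[OF abs_ge_zero[of a] abs_ge_zero[of b]]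
    unfolding abs_mult by (simp only: power2_abs mult.assoc)
  then show "AE x in M. norm (f x * g x) \<le> norm ((f x)\<^sup>2 + (g x)\<^sup>2)" by auto
qed auto

text \<open>The martingale property enters only through the events on which \<open>Z\<close> has stayed in the cone
\<open>\<bar>Z i\<bar> < \<epsilon> * i\<close> since time \<open>N\<close>; for \<open>N > n\<close> the condition is plain orthogonality of \<open>Z n\<close> and the next
increment. The proof is the maximal inequality of Hajek and Renyi: the weights
\<open>1 / n\<^sup>2\<close> decrease, so the squared process divided by \<open>n\<^sup>2\<close> and frozen on leaving the cone grows in mean by at
most \<open>d n / (n + 1)\<^sup>2\<close> per step.\<close>

lemma (in prob_space) martingale_strong_law:
  fixes Z :: "nat \<Rightarrow> 'a \<Rightarrow> real"
  assumes [measurable]: "\<And>n. Z n \<in> borel_measurable M"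
    and sq: "\<And>n. integrable M (\<lambda>x. (Z n x)\<^sup>2)"
    and orth: "\<And>n N \<epsilon>. expectation (\<lambda>x. indicator {x \<in> space M. \<forall>i\<in>{N..n}. \<bar>Z i x\<bar> < \<epsilon> * real i} x *
                 (Z n x * (Z (Suc n) x - Z n x))) = 0"
    and summ: "summable (\<lambda>n. expectation (\<lambda>x. (Z (Suc n) x - Z n x)\<^sup>2) / (real (Suc n))\<^sup>2)"
  shows "AE x in M. (\<lambda>n. Z n x / real n) \<longlonglongrightarrow> 0"
proof -
  define D where "D n x = Z (Suc n) x - Z n x" for n x
  have [measurable]: "D n \<in> borel_measurable M" for n by (simp add: D_def[abs_def])
  define d where "d n = expectation (\<lambda>x. (D n x)\<^sup>2)" for n
  have d0: "0 \<le> d n" for n by (simp add: d_def)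
  have ZZ: "integrable M (\<lambda>x. Z i x * Z j x)" for i j
    by (intro square_integrable_mult sq) auto
  have intD2: "integrable M (\<lambda>x. (D n x)\<^sup>2)" for n
  proof -
    have "(\<lambda>x. (D n x)\<^sup>2) = (\<lambda>x. (Z (Suc n) x)\<^sup>2 - 2 * (Z n x * Z (Suc n) x) + (Z n x)\<^sup>2)"
      by (auto simp: D_def power2_eq_square algebra_simps)
    then show ?thesis using sq ZZ by auto
  qed
  have intZD: "integrable M (\<lambda>x. Z n x * D n x)" for n
  proof -
    have "(\<lambda>x. Z n x * D n x) = (\<lambda>x. Z n x * Z (Suc n) x - (Z n x)\<^sup>2)"
      by (auto simp: D_def power2_eq_square algebra_simps)
    then show ?thesis using sq ZZ by auto
  qed
  have ex2: "(Z (Suc n) x)\<^sup>2 = (Z n x)\<^sup>2 + 2 * (Z n x * D n x) + (D n x)\<^sup>2" for n x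
    by (auto simp: D_def power2_eq_square algebra_simps)
  have orth0: "expectation (\<lambda>x. Z n x * D n x) = 0" for n
  proof -
    have "expectation (\<lambda>x. Z n x * D n x) =
        expectation (\<lambda>x. indicator {x \<in> space M. \<forall>i\<in>{Suc n..n}. \<bar>Z i x\<bar> < 1 * real i} x * (Z n x * (Z (Suc n) x - Z n x)))"
      by (intro Bochner_Integration.integral_cong) (auto simp: D_def)
    also have "\<dots> = 0" by (rule orth)
    finally show ?thesis .
  qed
  have EZ: "expectation (\<lambda>x. (Z n x)\<^sup>2) = expectation (\<lambda>x. (Z 0 x)\<^sup>2) + (\<Sum>i<n. d i)" for n
  proof (induction n)
    case (Suc n)
    have "expectation (\<lambda>x. (Z (Suc n) x)\<^sup>2) = expectation (\<lambda>x. (Z n x)\<^sup>2) + 2 * expectation (\<lambda>x. Z n x * D n x) + d n"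
      unfolding ex2 d_def using sq[of n] intZD[of n] intD2[of n] by simp
    then show ?case using Suc orth0[of n] by simp
  qed simp
  have bad: "prob {x\<in>space M. \<forall>N\<ge>1. \<exists>i\<ge>N. \<not> \<bar>Z i x\<bar> < \<epsilon> * real i} = 0" if "\<epsilon> > 0" for \<epsilon>
  proof -
    define G where "G N n = {x \<in> space M. \<forall>i\<in>{N..n}. \<bar>Z i x\<bar> < \<epsilon> * real i}" for N n
    have [measurable]: "G N n \<in> sets M" for N n unfolding G_def by measurable
    \<comment> \<open>The process \<open>(Z n)\<^sup>2 / n\<^sup>2\<close>, replaced by the smaller constant \<open>\<epsilon>\<^sup>2\<close> once the cone has been left.\<close>
    define W where "W N n x = \<epsilon>\<^sup>2 * (1 - indicator (G N n) x) + indicator (G N n) x * ((Z n x)\<^sup>2 / (real n)\<^sup>2)" for N n x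
    have exceed: "\<epsilon>\<^sup>2 \<le> (Z n x)\<^sup>2 / (real n)\<^sup>2" if "\<not> \<bar>Z n x\<bar> < \<epsilon> * real n" "n \<ge> 1" for n x
    proof -
      have "(\<epsilon> * real n)\<^sup>2 \<le> \<bar>Z n x\<bar>\<^sup>2" using that \<open>\<epsilon> > 0\<close> by (intro power_mono) auto
      then show ?thesis using that by (simp add: field_simps power_mult_distrib)
    qed
    have intI: "integrable M (\<lambda>x. indicator (G N n) x * f x)" if "integrable M f" for N n and f :: "'a \<Rightarrow> real"
      using integrable_real_mult_indicator[OF _ that, of "G N n"] by (simp add: mult.commute)
    have intC: "integrable M (\<lambda>x. \<epsilon>\<^sup>2 * (1 - indicator (G N n) x :: real))" for N n
      by (intro integrable_mult_right Bochner_Integration.integrable_diff) (auto simp: emeasure_eq_measure)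
    have intW: "integrable M (W N n)" for N n
      unfolding W_def[abs_def] by (intro Bochner_Integration.integrable_add intC intI) (use sq[of n] in auto)
    have EW: "expectation (W N (N+k)) \<le> (expectation (\<lambda>x. (Z 0 x)\<^sup>2) + (\<Sum>i<N. d i)) / (real N)\<^sup>2 + (\<Sum>i\<in>{N..<N+k}. d i / (real (Suc i))\<^sup>2)"
      if N: "N \<ge> 1" for N k
    proof (induction k)
      case 0
      have "W N N x \<le> (Z N x)\<^sup>2 / (real N)\<^sup>2" if "x \<in> space M" for x
        using exceed[of N x] N that by (auto simp: W_def G_def indicator_def)
      then have "expectation (W N N) \<le> expectation (\<lambda>x. (Z N x)\<^sup>2 / (real N)\<^sup>2)"
        using sq[of N] intW by (intro integral_mono) auto
      also have "\<dots> = expectation (\<lambda>x. (Z N x)\<^sup>2) / (real N)\<^sup>2" by simp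
      finally show ?case using EZ[of N] by simp
    next
      case (Suc k)
      define n where "n = N + k"
      have n1: "n \<ge> 1" "N \<le> n" using N by (auto simp: n_def)
      have sub: "G N (Suc n) \<subseteq> G N n" by (auto simp: G_def)
      have "W N (Suc n) x \<le> W N n x + indicator (G N n) x * (2 * (Z n x * D n x)) / (real (Suc n))\<^sup>2 + (D n x)\<^sup>2 / (real (Suc n))\<^sup>2"
        if x: "x \<in> space M" for x
      proof (cases "x \<in> G N n")
        case False
        then have "x \<notin> G N (Suc n)" using sub by auto
        then show ?thesis using False by (simp add: W_def)
      next
        case True
        have "W N (Suc n) x \<le> (Z (Suc n) x)\<^sup>2 / (real (Suc n))\<^sup>2"
        proof (cases "x \<in> G N (Suc n)")
          case F: False
          with True x have "\<not> \<bar>Z (Suc n) x\<bar> < \<epsilon> * real (Suc n)"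
            by (auto simp: G_def le_Suc_eq)
          from exceed[OF this] F show ?thesis by (simp add: W_def)
        qed (simp add: W_def)
        also have "\<dots> = (Z n x)\<^sup>2 / (real (Suc n))\<^sup>2 + (2 * (Z n x * D n x)) / (real (Suc n))\<^sup>2 + (D n x)\<^sup>2 / (real (Suc n))\<^sup>2"
          unfolding ex2 by (simp add: add_divide_distrib)
        also have "(Z n x)\<^sup>2 / (real (Suc n))\<^sup>2 \<le> (Z n x)\<^sup>2 / (real n)\<^sup>2"
          using n1 by (intro divide_left_mono power_mono) auto
        finally show ?thesis using True by (simp add: W_def)
      qed
      then have "expectation (W N (Suc n)) \<le> expectation (\<lambda>x. W N n x + indicator (G N n) x * (2 * (Z n x * D n x)) / (real (Suc n))\<^sup>2 + (D n x)\<^sup>2 / (real (Suc n))\<^sup>2)"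
        using intW intI[of "\<lambda>x. 2 * (Z n x * D n x)"] intZD[of n] intD2[of n]
        by (intro integral_mono Bochner_Integration.integrable_add integrable_divide) auto
      also have "\<dots> = expectation (W N n) + expectation (\<lambda>x. indicator (G N n) x * (2 * (Z n x * D n x))) / (real (Suc n))\<^sup>2 + d n / (real (Suc n))\<^sup>2"
        using intW[of N n] intI[of "\<lambda>x. 2 * (Z n x * D n x)" N n] intZD[of n] intD2[of n]
        by (simp add: d_def)
      also have "expectation (\<lambda>x. indicator (G N n) x * (2 * (Z n x * D n x))) = 2 * expectation (\<lambda>x. indicator (G N n) x * (Z n x * D n x))"
        by (subst integral_mult_right_zero[symmetric]) (simp add: mult_ac)
      also have "expectation (\<lambda>x. indicator (G N n) x * (Z n x * D n x)) = 0" unfolding G_def D_def by (rule orth)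
      finally show ?case using Suc.IH n1 by (simp add: n_def)
    qed
    \<comment> \<open>The limit of the bounds in \<open>EW\<close> as the number of steps grows; it tends to 0 by Kronecker's lemma.\<close>
    define B where "B N = (expectation (\<lambda>x. (Z 0 x)\<^sup>2) + (\<Sum>i<N. d i)) / (real N)\<^sup>2 + (\<Sum>i. d (i + N) / (real (Suc (i + N)))\<^sup>2)" for N
    have sd: "summable (\<lambda>i. d i / (real (Suc i))\<^sup>2)" using summ by (simp add: d_def D_def)
    have EB: "\<epsilon>\<^sup>2 * prob (space M - G N n) \<le> B N" if "N \<ge> 1" for N n
    proof (cases "N \<le> n")
      case True
      then obtain k where k: "n = N + k" using le_Suc_ex by blast
      have "(\<Sum>i\<in>{N..<N+k}. d i / (real (Suc i))\<^sup>2) = (\<Sum>i<k. d (i+N) / (real (Suc (i + N)))\<^sup>2)"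
        using sum.shift_bounds_nat_ivl[of "\<lambda>i. d i / (real (Suc i))\<^sup>2" 0 N k] by (simp add: atLeast0LessThan add.commute)
      also have "\<dots> \<le> (\<Sum>i. d (i + N) / (real (Suc (i + N)))\<^sup>2)"
        using summable_ignore_initial_segment[OF sd, of N] d0 by (intro sum_le_suminf) auto
      finally have "expectation (W N n) \<le> B N" using EW[OF that, of k] by (simp add: B_def k)
      moreover have "\<epsilon>\<^sup>2 * prob (space M - G N n) = expectation (\<lambda>x. \<epsilon>\<^sup>2 * indicator (space M - G N n) x)"
        by simp
      moreover have "\<dots> \<le> expectation (W N n)"
        by (intro integral_mono intW integrable_mult_right integrable_real_indicator)
           (auto simp: W_def emeasure_eq_measure split: split_indicator)
      ultimately show ?thesis by simp
    next
      case False
      then have "G N n = space M" by (auto simp: G_def)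
      moreover have "0 \<le> B N"
        unfolding B_def using summable_ignore_initial_segment[OF sd, of N] d0 by (intro add_nonneg_nonneg suminf_nonneg divide_nonneg_nonneg sum_nonneg) auto
      ultimately show ?thesis by simp
    qed
    have "B \<longlonglongrightarrow> 0 + 0" unfolding B_def
      using suminf_exist_split2[OF sd]
      by (intro tendsto_add kronecker_square_averages d0 sd)
    then have B0: "B \<longlonglongrightarrow> 0" by simp
    \<comment> \<open>The complement of \<open>G N n\<close> increases to \<open>Bad N\<close> with \<open>n\<close>, so that the bound survives in the limit.\<close>
    define Bad where "Bad N = {x\<in>space M. \<exists>i\<ge>N. \<not> \<bar>Z i x\<bar> < \<epsilon> * real i}" for N
    have [measurable]: "Bad N \<in> sets M" for N unfolding Bad_def by measurable
    have BadB: "\<epsilon>\<^sup>2 * prob (Bad N) \<le> B N" if "N \<ge> 1" for N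
    proof -
      have "(\<lambda>n. prob (space M - G N n)) \<longlonglongrightarrow> prob (\<Union>n. space M - G N n)"
        by (intro finite_Lim_measure_incseq) (auto simp: G_def incseq_def)
      also have "(\<Union>n. space M - G N n) = Bad N"
        by (auto simp: G_def Bad_def) (meson atLeastAtMost_iff order_refl)
      finally have "(\<lambda>n. \<epsilon>\<^sup>2 * prob (space M - G N n)) \<longlonglongrightarrow> \<epsilon>\<^sup>2 * prob (Bad N)" by (intro tendsto_mult_left)
      then show ?thesis by (rule LIMSEQ_le_const2) (use EB[OF that] in auto)
    qed
    have le: "\<epsilon>\<^sup>2 * prob {x\<in>space M. \<forall>N\<ge>1. \<exists>i\<ge>N. \<not> \<bar>Z i x\<bar> < \<epsilon> * real i} \<le> B N" if "N \<ge> 1" for N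
    proof -
      have "prob {x\<in>space M. \<forall>N\<ge>1. \<exists>i\<ge>N. \<not> \<bar>Z i x\<bar> < \<epsilon> * real i} \<le> prob (Bad N)"
        by (intro finite_measure_mono) (use that in \<open>auto simp: Bad_def\<close>)
      then show ?thesis using BadB[OF that] \<open>\<epsilon> > 0\<close>
        by (meson mult_left_mono order_trans zero_le_power2)
    qed
    have "\<epsilon>\<^sup>2 * prob {x\<in>space M. \<forall>N\<ge>1. \<exists>i\<ge>N. \<not> \<bar>Z i x\<bar> < \<epsilon> * real i} \<le> 0"
      by (rule LIMSEQ_le_const[OF B0]) (use le in auto)
    then show ?thesis using \<open>\<epsilon> > 0\<close> by (simp add: mult_le_0_iff measure_le_0_iff)
  qed
  have "AE x in M. \<exists>N\<ge>1. \<forall>i\<ge>N. \<bar>Z i x\<bar> < inverse (Suc m) * real i" for m :: nat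
    by (rule AE_I[of _ _ "{x\<in>space M. \<forall>N\<ge>1. \<exists>i\<ge>N. \<not> \<bar>Z i x\<bar> < inverse (Suc m) * real i}"])
       (use bad[of "inverse (Suc m)"] in \<open>auto simp: emeasure_eq_measure\<close>)
  then have "AE x in M. \<forall>m::nat. \<exists>N\<ge>1. \<forall>i\<ge>N. \<bar>Z i x\<bar> < inverse (Suc m) * real i"
    by (subst AE_all_countable) auto
  then show ?thesis
  proof (rule AE_mp, intro AE_I2 impI LIMSEQ_I)
    fix x and r :: real
    assume *: "\<forall>m::nat. \<exists>N\<ge>1. \<forall>i\<ge>N. \<bar>Z i x\<bar> < inverse (Suc m) * real i" and "0 < r"
    obtain m :: nat where m: "inverse (Suc m) < r" using reals_Archimedean[OF \<open>0 < r\<close>] by auto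
    from * obtain N where N: "N \<ge> 1" "\<And>i. i \<ge> N \<Longrightarrow> \<bar>Z i x\<bar> < inverse (Suc m) * real i" by blast
    have "norm (Z i x / real i - 0) < r" if "i \<ge> N" for i
    proof -
      have "\<bar>Z i x\<bar> / real i < inverse (Suc m)" using N that by (simp add: divide_less_eq)
      then show ?thesis using m by (simp add: abs_divide)
    qed
    then show "\<exists>no. \<forall>n\<ge>no. norm (Z n x / real n - 0) < r" by blast
  qed
qed

section \<open>The strong law for independent, identically distributed nonnegative variables\<close>

lemma cesaro_mean:
  fixes a :: "nat \<Rightarrow> real"
  assumes "a \<longlonglongrightarrow> l"
  shows "(\<lambda>n. (\<Sum>k<n. a k) / real n) \<longlonglongrightarrow> l"
proof (rule LIMSEQ_I)
  fix r :: real assume r: "0 < r"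
  from LIMSEQ_D[OF assms, of "r/2"] r obtain N where N: "\<And>n. n \<ge> N \<Longrightarrow> \<bar>a n - l\<bar> < r/2" by auto
  define C where "C = (\<Sum>k<N. \<bar>a k - l\<bar>)"
  have "(\<lambda>n. C / real n) \<longlonglongrightarrow> 0"
    by (rule lim_const_over_n)
  from LIMSEQ_D[OF this, of "r/2"] r obtain N' where N': "\<And>n. n \<ge> N' \<Longrightarrow> \<bar>C / real n\<bar> < r/2" by auto
  show "\<exists>no. \<forall>n\<ge>no. norm ((\<Sum>k<n. a k) / real n - l) < r"
  proof (intro exI[of _ "max N' (Suc N)"] allI impI)
    fix n assume n: "max N' (Suc N) \<le> n"
    then have n0: "n > 0" "N \<le> n" by auto
    have "(\<Sum>k<n. a k) / real n - l = (\<Sum>k<n. a k - l) / real n"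
      using n0 by (simp add: sum_subtractf field_simps)
    also have "\<bar>\<dots>\<bar> \<le> (\<Sum>k<n. \<bar>a k - l\<bar>) / real n"
      by (simp add: abs_divide divide_right_mono)
    also have "(\<Sum>k<n. \<bar>a k - l\<bar>) = C + (\<Sum>k\<in>{N..<n}. \<bar>a k - l\<bar>)"
      unfolding C_def using n0 by (metis atLeast0LessThan sum.atLeastLessThan_concat zero_le)
    also have "(\<Sum>k\<in>{N..<n}. \<bar>a k - l\<bar>) \<le> (\<Sum>k\<in>{N..<n}. r/2)"
      using N by (intro sum_mono less_imp_le) auto
    also have "(\<Sum>k\<in>{N..<n}. r/2) \<le> real n * (r/2)" using n0 r by (simp add: mult_right_mono)
    finally have "\<bar>(\<Sum>k<n. a k) / real n - l\<bar> \<le> (C + real n * (r/2)) / real n"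
      using n0 by (simp add: divide_right_mono)
    also have "\<dots> = C / real n + r/2" using n0 by (simp add: field_simps)
    finally show "norm ((\<Sum>k<n. a k) / real n - l) < r"
      using N'[of n] n abs_ge_self[of "C / real n"] unfolding real_norm_def by linarith
  qed
qed

text \<open>The comparison \<open>1 / s\<^sup>2 \<le> 2 / s - 2 / (s + 1)\<close>, valid for \<open>s \<ge> 1\<close>, makes the sum telescope.\<close>

lemma truncated_inverse_squares_le:
  fixes x :: real
  assumes x: "0 < x"
  shows "(\<Sum>k<n. if x \<le> real (Suc k) then 1 / (real (Suc k))\<^sup>2 else 0) \<le> 2 / x - 2 / max x (real (Suc n))"
proof (induction n)
  case 0
  then show ?case using x by (simp add: field_simps max_def)
next
  case (Suc n)
  show ?case
  proof (cases "x \<le> real (Suc n)")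
    case True
    have "1 / (real (Suc n))\<^sup>2 \<le> 2 / real (Suc n) - 2 / real (Suc (Suc n))"
    proof -
      define s where "s = real (Suc n)"
      have s: "1 \<le> s" by (simp add: s_def)
      have "1 / s\<^sup>2 = 2 / (2 * s\<^sup>2)" by simp
      also have "\<dots> \<le> 2 / (s * (s + 1))"
      proof (rule divide_left_mono)
        show "s * (s + 1) \<le> 2 * s\<^sup>2"
          using s mult_left_mono[OF s, of s] by (simp add: power2_eq_square algebra_simps)
        show "0 < 2 * s\<^sup>2 * (s * (s + 1))" using s by (intro mult_pos_pos) auto
      qed auto
      also have "\<dots> = 2 / s - 2 / (s + 1)" using s by (simp add: field_simps)
      finally show ?thesis by (simp add: s_def add.commute)
    qed
    then show ?thesis using Suc True x by (simp add: max_def)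
  next
    case False
    have "2 / max x (real (Suc (Suc n))) \<le> 2 / max x (real (Suc n))"
      using x by (intro divide_left_mono) auto
    then show ?thesis using Suc False by simp
  qed
qed

text \<open>Taking expectations here shows that a single finite first moment bounds the normalised second
moments of all truncations at once.\<close>

lemma truncated_second_moment_le:
  fixes x :: real
  assumes x: "0 \<le> x"
  shows "(\<Sum>k<n. (if x \<le> real (Suc k) then x else 0)\<^sup>2 / (real (Suc k))\<^sup>2) \<le> 2 * x"
proof (cases "x = 0")
  case False
  with x have x: "0 < x" by simp
  have "(\<Sum>k<n. (if x \<le> real (Suc k) then x else 0)\<^sup>2 / (real (Suc k))\<^sup>2)
      = x\<^sup>2 * (\<Sum>k<n. if x \<le> real (Suc k) then 1 / (real (Suc k))\<^sup>2 else 0)"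
    by (subst sum_distrib_left) (intro sum.cong, auto)
  also have "\<dots> \<le> x\<^sup>2 * (2 / x)"
  proof (intro mult_left_mono)
    have "0 \<le> 2 / max x (real (Suc n))" by simp
    with truncated_inverse_squares_le[OF x, of n] show "(\<Sum>k<n. if x \<le> real (Suc k) then 1 / (real (Suc k))\<^sup>2 else 0) \<le> 2 / x"
      by linarith
  qed auto
  also have "\<dots> = 2 * x" using x by (simp add: power2_eq_square)
  finally show ?thesis .
qed auto

lemma count_exceedances_le:
  fixes x :: real
  assumes x: "0 \<le> x"
  shows "(\<Sum>k<n. if x \<le> real (Suc k) then 0 else 1) \<le> min x (real n)"
  using x by (induction n) (auto simp: min_def split: if_splits)

text \<open>Let \<open>Y k\<close> be \<open>X k\<close> where this is at most \<open>k + 1\<close>, and 0 elsewhere. Almost surely \<open>Y k = X k\<close> for all large \<open>k\<close> by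
Borel-Cantelli, and \<open>(Y k)\<^sup>2 / (k + 1)\<^sup>2\<close> has summable expectations. The latter gives the summability
claim directly, and it is also what the martingale strong law needs for the partial sums of the
centred \<open>Y k\<close>; their means converge to that of \<open>X 0\<close>.\<close>

lemma (in prob_space) strong_law_iid_nonneg:
  fixes X :: "nat \<Rightarrow> 'a \<Rightarrow> real"
  assumes indep: "indep_vars (\<lambda>_. borel) X UNIV"
    and iid: "\<And>n. distr M borel (X n) = distr M borel (X 0)"
    and nonneg: "\<And>n x. 0 \<le> X n x"
    and int: "integrable M (X 0)"
  shows "AE x in M. (\<lambda>n. (\<Sum>k<n. X k x) / real n) \<longlonglongrightarrow> expectation (X 0)"
    and "AE x in M. summable (\<lambda>n. (X n x)\<^sup>2 / (real (Suc n))\<^sup>2)"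
proof -
  have [measurable]: "X n \<in> borel_measurable M" for n
    using indep by (auto simp: indep_vars_def)
  define t where "t k x = (if x \<le> real (Suc k) then x else 0)" for k and x :: real
  have [measurable]: "t k \<in> borel_measurable borel" for k unfolding t_def by measurable
  have t_bd: "0 \<le> x \<Longrightarrow> 0 \<le> t k x \<and> t k x \<le> Suc k \<and> t k x \<le> x" for k x by (simp add: t_def)
  define Y where "Y k x = t k (X k x)" for k x
  have [measurable]: "Y k \<in> borel_measurable M" for k unfolding Y_def by measurable
  have Ybd: "0 \<le> Y k x" "Y k x \<le> Suc k" for k x using t_bd[OF nonneg] by (auto simp: Y_def)
  have Yabs: "\<bar>Y k x\<bar> \<le> real (Suc k)" for k x using Ybd[of k x] by simp
  have same: "expectation (\<lambda>x. f (X n x)) = expectation (\<lambda>x. f (X 0 x))" if [measurable]: "f \<in> borel_measurable borel" for f :: "real \<Rightarrow> real" and n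
  proof -
    have "expectation (\<lambda>x. f (X n x)) = integral\<^sup>L (distr M borel (X n)) f" by (subst integral_distr) auto
    also have "\<dots> = integral\<^sup>L (distr M borel (X 0)) f" by (simp only: iid[of n])
    also have "\<dots> = expectation (\<lambda>x. f (X 0 x))" by (subst integral_distr) auto
    finally show ?thesis .
  qed
  have bint: "integrable M f" if "f \<in> borel_measurable M" "\<And>x. \<bar>f x\<bar> \<le> B" for f and B :: real
    using that by (intro integrable_const_bound[of _ B]) auto
  have intY: "integrable M (Y k)" for k by (rule bint[of _ "Suc k"]) (use Yabs in auto)
  define m where "m k = expectation (Y k)" for k
  have m_eq: "m k = expectation (\<lambda>x. t k (X 0 x))" for k
    unfolding m_def Y_def using same[of "t k" k] by simp
  have m_lim: "m \<longlonglongrightarrow> expectation (X 0)"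
    unfolding m_eq[abs_def]
  proof (rule integral_dominated_convergence[where w = "X 0"])
    show "AE x in M. (\<lambda>k. t k (X 0 x)) \<longlonglongrightarrow> X 0 x"
    proof (intro AE_I2 tendsto_eventually)
      fix x
      obtain K :: nat where "X 0 x \<le> real K" using real_arch_simple by blast
      then show "\<forall>\<^sub>F k in sequentially. t k (X 0 x) = X 0 x"
        unfolding eventually_sequentially t_def by (intro exI[of _ K]) auto
    qed
    show "AE x in M. norm (t k (X 0 x)) \<le> X 0 x" for k
      using t_bd[OF nonneg] by auto
  qed (use int in auto)
  have same_sq: "expectation (\<lambda>x. (Y k x)\<^sup>2) = expectation (\<lambda>x. (t k (X 0 x))\<^sup>2)" for k
    unfolding Y_def by (rule same) measurable
  have int_sq: "integrable M (\<lambda>x. (t k (X 0 x))\<^sup>2 / (real (Suc k))\<^sup>2)" for k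
    by (rule bint[of _ 1]) (use t_bd[OF nonneg] in \<open>auto simp: divide_le_eq_1 power_mono\<close>)
  have sum_sq: "summable (\<lambda>k. expectation (\<lambda>x. (Y k x)\<^sup>2) / (real (Suc k))\<^sup>2)"
  proof (rule summableI_nonneg_bounded)
    fix n
    have "(\<Sum>k<n. expectation (\<lambda>x. (Y k x)\<^sup>2) / (real (Suc k))\<^sup>2)
      = (\<Sum>k<n. expectation (\<lambda>x. (t k (X 0 x))\<^sup>2 / (real (Suc k))\<^sup>2))"
      by (simp add: same_sq)
    also have "\<dots> = expectation (\<lambda>x. \<Sum>k<n. (t k (X 0 x))\<^sup>2 / (real (Suc k))\<^sup>2)"
      by (rule Bochner_Integration.integral_sum[symmetric]) (rule int_sq)
    also have "\<dots> \<le> expectation (\<lambda>x. 2 * X 0 x)"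
    proof (rule integral_mono)
      show "integrable M (\<lambda>x. \<Sum>k<n. (t k (X 0 x))\<^sup>2 / (real (Suc k))\<^sup>2)"
        by (intro Bochner_Integration.integrable_sum int_sq)
    qed (use int truncated_second_moment_le[OF nonneg] in \<open>auto simp: t_def\<close>)
    finally show "(\<Sum>k<n. expectation (\<lambda>x. (Y k x)\<^sup>2) / (real (Suc k))\<^sup>2) \<le> expectation (\<lambda>x. 2 * X 0 x)" .
  qed auto
  have eq_Y: "AE x in M. \<forall>\<^sub>F k in sequentially. X k x = Y k x"
  proof -
    define A where "A k = {x\<in>space M. \<not> X k x \<le> real (Suc k)}" for k
    have [measurable]: "A k \<in> sets M" for k unfolding A_def by measurable
    have pA: "prob (A k) = expectation (\<lambda>x. if X 0 x \<le> real (Suc k) then 0 else 1)" for k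
    proof -
      have "prob (A k) = expectation (\<lambda>x. if X k x \<le> real (Suc k) then 0 else 1)"
        by (subst Bochner_Integration.integral_cong[OF refl, of _ _ "indicator (A k)"]) (auto simp: A_def indicator_def)
      then show ?thesis using same[of "\<lambda>x. if x \<le> real (Suc k) then 0 else 1" k] by simp
    qed
    have int_ex: "integrable M (\<lambda>x. if X 0 x \<le> real (Suc k) then 0 else 1 :: real)" for k
    proof (rule bint[of _ 1])
      show "(\<lambda>x. if X 0 x \<le> real (Suc k) then 0 else 1 :: real) \<in> borel_measurable M" by measurable
    qed auto
    have "summable (\<lambda>k. prob (A k))"
    proof (rule summableI_nonneg_bounded)
      fix n
      have "(\<Sum>k<n. prob (A k)) = expectation (\<lambda>x. \<Sum>k<n. if X 0 x \<le> real (Suc k) then 0 else 1)"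
        unfolding pA by (rule Bochner_Integration.integral_sum[symmetric]) (rule int_ex)
      also have "\<dots> \<le> expectation (X 0)"
      proof (rule integral_mono[OF _ int])
        show "integrable M (\<lambda>x. \<Sum>k<n. if X 0 x \<le> real (Suc k) then 0 else 1 :: real)"
          by (intro Bochner_Integration.integrable_sum int_ex)
        show "(\<Sum>k<n. if X 0 x \<le> real (Suc k) then 0 else 1) \<le> X 0 x" for x
          using count_exceedances_le[OF nonneg, of 0 x n] by simp
      qed
      finally show "(\<Sum>k<n. prob (A k)) \<le> expectation (X 0)" .
    qed auto
    then have "AE x in M. \<forall>\<^sub>F n in sequentially. x \<in> space M - A n"
      by (intro borel_cantelli_AE1) (auto simp: emeasure_eq_measure)
    then show ?thesis
      by (rule AE_mp) (auto intro!: AE_I2 elim!: eventually_mono simp: A_def Y_def t_def)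
  qed
  show "AE x in M. summable (\<lambda>n. (X n x)\<^sup>2 / (real (Suc n))\<^sup>2)"
  proof -
    have "(\<integral>\<^sup>+x. (\<Sum>k. ennreal ((Y k x)\<^sup>2 / (real (Suc k))\<^sup>2)) \<partial>M) = (\<Sum>k. (\<integral>\<^sup>+x. ennreal ((Y k x)\<^sup>2 / (real (Suc k))\<^sup>2) \<partial>M))"
      by (rule nn_integral_suminf) auto
    also have "\<dots> = (\<Sum>k. ennreal (expectation (\<lambda>x. (Y k x)\<^sup>2) / (real (Suc k))\<^sup>2))"
    proof (rule suminf_cong)
      fix k
      have "integrable M (\<lambda>x. (Y k x)\<^sup>2 / (real (Suc k))\<^sup>2)"
        by (rule bint[of _ 1]) (use Ybd in \<open>auto simp: divide_le_eq_1 power_mono\<close>)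
      then show "(\<integral>\<^sup>+x. ennreal ((Y k x)\<^sup>2 / (real (Suc k))\<^sup>2) \<partial>M) = ennreal (expectation (\<lambda>x. (Y k x)\<^sup>2) / (real (Suc k))\<^sup>2)"
        by (subst nn_integral_eq_integral) auto
    qed
    also have "\<dots> < \<infinity>" using sum_sq by (simp add: suminf_ennreal_eq[OF _ summable_sums])
    finally have "AE x in M. (\<Sum>k. ennreal ((Y k x)\<^sup>2 / (real (Suc k))\<^sup>2)) \<noteq> \<infinity>"
      by (intro nn_integral_PInf_AE) auto
    then have "AE x in M. summable (\<lambda>k. (Y k x)\<^sup>2 / (real (Suc k))\<^sup>2)"
      by (rule AE_mp) (auto intro!: AE_I2 summable_suminf_not_top)
    with eq_Y show ?thesis
    proof eventually_elim
      case (elim x)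
      have "\<forall>\<^sub>F k in sequentially. (X k x)\<^sup>2 / (real (Suc k))\<^sup>2 = (Y k x)\<^sup>2 / (real (Suc k))\<^sup>2"
        using elim(1) by eventually_elim simp
      from summable_cong[OF this] show ?case using elim(2) by simp
    qed
  qed
  define Z where "Z n x = (\<Sum>k<n. Y k x - m k)" for n x
  have [measurable]: "Z n \<in> borel_measurable M" for n unfolding Z_def by measurable
  have ZS: "Z (Suc n) x - Z n x = Y n x - m n" for n x by (simp add: Z_def)
  have Zbd: "\<exists>B. \<forall>x. \<bar>Z n x\<bar> \<le> B" for n
  proof -
    have "\<bar>Z n x\<bar> \<le> (\<Sum>k<n. real (Suc k) + \<bar>m k\<bar>)" for x
      unfolding Z_def using Yabs by (intro order_trans[OF sum_abs] sum_mono order_trans[OF abs_triangle_ineq4] add_mono) auto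
    then show ?thesis by blast
  qed
  have "AE x in M. (\<lambda>n. Z n x / real n) \<longlonglongrightarrow> 0"
  proof (rule martingale_strong_law)
    show "integrable M (\<lambda>x. (Z n x)\<^sup>2)" for n
    proof -
      obtain B where B: "\<And>x. \<bar>Z n x\<bar> \<le> B" using Zbd[of n] by blast
      have "(Z n x)\<^sup>2 \<le> B\<^sup>2" for x using power_mono[OF B[of x], of 2] by simp
      then show ?thesis by (intro bint[of _ "B\<^sup>2"]) auto
    qed
    show "summable (\<lambda>n. expectation (\<lambda>x. (Z (Suc n) x - Z n x)\<^sup>2) / (real (Suc n))\<^sup>2)"
    proof (rule summable_comparison_test'[OF sum_sq])
      fix n :: nat
      have i2: "integrable M (\<lambda>x. (Y n x)\<^sup>2)"
        by (rule bint[of _ "(Suc n)\<^sup>2"]) (use Ybd in \<open>auto simp: power_mono simp del: of_nat_Suc\<close>)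
      have "variance (Y n) \<le> expectation (\<lambda>x. (Y n x)\<^sup>2)"
        by (subst variance_eq[OF intY i2]) simp
      then show "norm (expectation (\<lambda>x. (Z (Suc n) x - Z n x)\<^sup>2) / (real (Suc n))\<^sup>2)
         \<le> expectation (\<lambda>x. (Y n x)\<^sup>2) / (real (Suc n))\<^sup>2"
        unfolding ZS m_def by (simp add: divide_right_mono)
    qed
    show "expectation (\<lambda>x. indicator {x \<in> space M. \<forall>i\<in>{N..n}. \<bar>Z i x\<bar> < \<epsilon> * real i} x *
                 (Z n x * (Z (Suc n) x - Z n x))) = 0" for n N \<epsilon>
    proof -
      define z where "z n \<omega> = (\<Sum>k<n. t k (\<omega> k) - m k)" for n and \<omega> :: "nat \<Rightarrow> real"
      have zm: "z i \<in> borel_measurable (PiM {..<n} (\<lambda>_. borel))" if "i \<le> n" for i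
        unfolding z_def using that
        by (intro borel_measurable_sum borel_measurable_diff borel_measurable_const measurable_compose[OF measurable_component_singleton]) auto
      define f where "f \<omega> = (if \<forall>i\<in>{N..n}. \<bar>z i \<omega>\<bar> < \<epsilon> * real i then z n \<omega> else 0)" for \<omega>
      have Zz: "z i (restrict (\<lambda>i. X i x) {..<n}) = Z i x" if "i \<le> n" for i x
        unfolding z_def Z_def Y_def using that by (intro sum.cong) auto
      have fm: "f \<in> borel_measurable (PiM {..<n} (\<lambda>_. borel))"
      proof -
        have "Measurable.pred (PiM {..<n} (\<lambda>_. borel)) (\<lambda>\<omega>. \<forall>i\<in>{N..n}. \<bar>z i \<omega>\<bar> < \<epsilon> * real i)"
          using zm by (intro pred_intros_finite) (auto intro!: borel_measurable_pred_less borel_measurable_abs)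
        then show ?thesis unfolding f_def using zm[of n] by (intro measurable_If) (auto simp: pred_def)
      qed
      \<comment> \<open>The indicator times \<open>Z n\<close> depends on \<open>X 0, \<dots>, X (n - 1)\<close>, the increment on \<open>X n\<close> alone.\<close>
      have "indep_var borel (f \<circ> (\<lambda>x. restrict (\<lambda>i. X i x) {..<n})) borel ((\<lambda>\<omega>. t n (\<omega> n) - m n) \<circ> (\<lambda>x. restrict (\<lambda>i. X i x) {n}))"
        by (rule indep_var_compose[OF indep_var_restrict[OF indep] fm]) auto
      also have "f \<circ> (\<lambda>x. restrict (\<lambda>i. X i x) {..<n}) = (\<lambda>x. if \<forall>i\<in>{N..n}. \<bar>Z i x\<bar> < \<epsilon> * real i then Z n x else 0)"
        by (auto simp: f_def fun_eq_iff Zz)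
      also have "(\<lambda>\<omega>. t n (\<omega> n) - m n) \<circ> (\<lambda>x. restrict (\<lambda>i. X i x) {n}) = (\<lambda>x. Y n x - m n)"
        by (auto simp: Y_def)
      finally have iv: "indep_var borel (\<lambda>x. if \<forall>i\<in>{N..n}. \<bar>Z i x\<bar> < \<epsilon> * real i then Z n x else 0) borel (\<lambda>x. Y n x - m n)" .
      obtain B where B: "\<And>x. \<bar>Z n x\<bar> \<le> B" using Zbd[of n] by blast
      have "0 \<le> B" using B[of undefined] by simp
      have i1: "integrable M (\<lambda>x. if \<forall>i\<in>{N..n}. \<bar>Z i x\<bar> < \<epsilon> * real i then Z n x else 0)"
        by (rule bint[of _ B]) (use B \<open>0 \<le> B\<close> in auto)
      have "expectation (\<lambda>x. indicator {x \<in> space M. \<forall>i\<in>{N..n}. \<bar>Z i x\<bar> < \<epsilon> * real i} x * (Z n x * (Z (Suc n) x - Z n x)))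
          = expectation (\<lambda>x. (if \<forall>i\<in>{N..n}. \<bar>Z i x\<bar> < \<epsilon> * real i then Z n x else 0) * (Y n x - m n))"
        unfolding ZS by (intro Bochner_Integration.integral_cong) auto
      also have "\<dots> = expectation (\<lambda>x. if \<forall>i\<in>{N..n}. \<bar>Z i x\<bar> < \<epsilon> * real i then Z n x else 0) * expectation (\<lambda>x. Y n x - m n)"
        using i1 intY by (intro indep_var_lebesgue_integral iv) auto
      also have "expectation (\<lambda>x. Y n x - m n) = 0" using intY[of n] by (simp add: m_def prob_space)
      finally show ?thesis by simp
    qed
  qed measurable
  with eq_Y show "AE x in M. (\<lambda>n. (\<Sum>k<n. X k x) / real n) \<longlonglongrightarrow> expectation (X 0)"
  proof eventually_elim
    case (elim x)
    have "(\<lambda>k. X k x - Y k x) \<longlonglongrightarrow> 0"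
      using elim(1) by (intro tendsto_eventually) (auto elim: eventually_mono)
    from cesaro_mean[OF this] cesaro_mean[OF m_lim] elim(2)
    have "(\<lambda>n. (\<Sum>k<n. X k x - Y k x) / real n + (\<Sum>k<n. m k) / real n + Z n x / real n) \<longlonglongrightarrow> 0 + expectation (X 0) + 0"
      by (intro tendsto_add)
    also have "(\<lambda>n. (\<Sum>k<n. X k x - Y k x) / real n + (\<Sum>k<n. m k) / real n + Z n x / real n) = (\<lambda>n. (\<Sum>k<n. X k x) / real n)"
      by (auto simp: Z_def sum_subtractf fun_eq_iff diff_divide_distrib)
    finally show ?case by simp
  qed
qed

section \<open>The walk on a fixed tree\<close>

text \<open>Treated separately because \<open>pmf_of_set {}\<close> is an unspecified distribution: a leaf other than the root
chooses it with probability 0.\<close>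

lemma walk_step_no_children:
  assumes "x \<noteq> []" "T x = 0"
  shows "walk_step \<beta> T x = return_pmf (butlast x)"
proof -
  have "bernoulli_pmf 1 = return_pmf True"
    by (rule pmf_eqI) (auto simp: indicator_def split: bool.split)
  then show ?thesis using assms by (simp add: walk_step_def bind_return_pmf)
qed

lemma set_pmf_walk_step:
  assumes "0 \<le> \<beta>" "x = [] \<longrightarrow> 0 < T x"
  shows "set_pmf (walk_step \<beta> T x) \<subseteq> {butlast x} \<union> (\<lambda>i. x @ [i]) ` {..<T x}"
proof (cases "T x = 0")
  case True
  then have "walk_step \<beta> T x = return_pmf (butlast x)"
    using assms by (intro walk_step_no_children) auto
  then show ?thesis by simp
next
  case False
  then show ?thesis by (auto simp: walk_step_def Let_def set_pmf_of_set lessThan_empty_iff split: if_splits)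
qed

lemma walk_step_vertices:
  assumes "0 \<le> \<beta>" "0 < T []" "x \<in> tree_vertices T" "y \<in> set_pmf (walk_step \<beta> T x)"
  shows "y \<in> tree_vertices T" "length y \<le> Suc (length x)"
proof -
  have "butlast x \<in> tree_vertices T"
    using assms(3) by (cases x rule: rev_cases) auto
  moreover have "y \<in> {butlast x} \<union> (\<lambda>i. x @ [i]) ` {..<T x}"
    using set_pmf_walk_step[of \<beta> x T] assms by auto
  ultimately show "y \<in> tree_vertices T" "length y \<le> Suc (length x)"
    using assms(3) by auto
qed

lemma finite_set_pmf_walk_step:
  assumes "0 \<le> \<beta>" "x = [] \<longrightarrow> 0 < T x"
  shows "finite (set_pmf (walk_step \<beta> T x))"
  by (rule finite_subset[OF set_pmf_walk_step]) (use assms in auto)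

lemma expectation_walk_step_root:
  fixes f :: "nat list \<Rightarrow> real"
  assumes "0 < T []"
  shows "measure_pmf.expectation (walk_step \<beta> T []) f = (\<Sum>i<T []. f [i]) / T []"
  using assms by (auto simp: walk_step_def integral_pmf_of_set lessThan_empty_iff)

lemma expectation_walk_step:
  fixes f :: "nat list \<Rightarrow> real"
  assumes "0 \<le> \<beta>" "x \<noteq> []"
  shows "measure_pmf.expectation (walk_step \<beta> T x) f =
     (f (butlast x) + \<beta> * (\<Sum>i<T x. f (x @ [i]))) / (1 + \<beta> * T x)"
proof (cases "T x = 0")
  case True
  then show ?thesis using assms walk_step_no_children[of x T \<beta>] by simp
next
  case False
  have pos: "0 < 1 + \<beta> * T x" using assms by (simp add: add_pos_nonneg)
  let ?c = "map_pmf (\<lambda>i. x @ [i]) (pmf_of_set {..<T x})"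
  have "measure_pmf.expectation (walk_step \<beta> T x) f =
    (\<Sum>up\<in>UNIV. pmf (bernoulli_pmf (1 / (1 + \<beta> * T x))) up *\<^sub>R
        measure_pmf.expectation (if up then return_pmf (butlast x) else ?c) f)"
    unfolding walk_step_def Let_def using assms False
    by (subst if_not_P, simp, intro pmf_expectation_bind)
       (auto simp: set_pmf_of_set lessThan_empty_iff)
  also have "\<dots> = 1 / (1 + \<beta> * T x) * f (butlast x) + (1 - 1 / (1 + \<beta> * T x)) * ((\<Sum>i<T x. f (x @ [i])) / T x)"
    using assms pos False by (simp add: UNIV_bool integral_pmf_of_set lessThan_empty_iff)
  also have "1 - 1 / (1 + \<beta> * T x) = \<beta> * T x / (1 + \<beta> * T x)"
    using pos by (simp add: field_simps)
  also have "1 / (1 + \<beta> * T x) * f (butlast x) + \<beta> * T x / (1 + \<beta> * T x) * ((\<Sum>i<T x. f (x @ [i])) / T x) =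
      (f (butlast x) + \<beta> * (\<Sum>i<T x. f (x @ [i]))) / (1 + \<beta> * T x)"
    using False by (simp add: add_divide_distrib)
  finally show ?thesis .
qed

text \<open>The law of the first \<open>n + 1\<close> positions of the walk, as a discrete distribution of finite support.
Through it every expectation that involves finitely many steps becomes a finite sum.\<close>

primrec prefix_pmf :: "real \<Rightarrow> tree \<Rightarrow> nat \<Rightarrow> nat list list pmf" where
  "prefix_pmf \<beta> T 0 = return_pmf [[]]"
| "prefix_pmf \<beta> T (Suc n) = bind_pmf (prefix_pmf \<beta> T n) (\<lambda>l. map_pmf (\<lambda>y. l @ [y]) (walk_step \<beta> T (last l)))"

lemma pmf_prefix_pmf:
  "length l = Suc n \<Longrightarrow> ennreal (pmf (prefix_pmf \<beta> T n) l) = (\<Prod>i<Suc n. emeasure (walk_kernel \<beta> T i ((!) l)) {l ! i})"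
proof (induction n arbitrary: l)
  case 0
  then obtain a where "l = [a]" by (cases l) auto
  then show ?case by (auto simp: walk_kernel_def emeasure_pmf_single indicator_def)
next
  case (Suc n)
  then obtain l' y where l: "l = l' @ [y]" "length l' = Suc n" by (metis length_Suc_conv_rev)
  have "pmf (map_pmf (\<lambda>y. a @ [y]) q) l = indicator {l'} a * pmf q y" for a q
  proof (cases "a = l'")
    case True
    have "inj (\<lambda>y. a @ [y])" by (auto simp: inj_def)
    from pmf_map_inj'[OF this, of q y] show ?thesis by (simp add: True l)
  qed (auto simp: l pmf_eq_0_set_pmf)
  then have "pmf (prefix_pmf \<beta> T (Suc n)) l = measure_pmf.expectation (prefix_pmf \<beta> T n) (\<lambda>a. indicator {l'} a * pmf (walk_step \<beta> T (last a)) y)"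
    by (simp add: pmf_bind)
  also have "\<dots> = measure_pmf.expectation (prefix_pmf \<beta> T n) (\<lambda>a. indicator {l'} a * pmf (walk_step \<beta> T (last l')) y)"
    by (intro Bochner_Integration.integral_cong) (auto simp: indicator_def)
  also have "\<dots> = pmf (prefix_pmf \<beta> T n) l' * pmf (walk_step \<beta> T (last l')) y"
    by (simp add: pmf.rep_eq)
  finally have "ennreal (pmf (prefix_pmf \<beta> T (Suc n)) l) = ennreal (pmf (prefix_pmf \<beta> T n) l') * ennreal (pmf (walk_step \<beta> T (last l')) y)"
    by (simp add: ennreal_mult)
  also have "ennreal (pmf (prefix_pmf \<beta> T n) l') = (\<Prod>i<Suc n. emeasure (walk_kernel \<beta> T i ((!) l')) {l' ! i})"
    by (rule Suc.IH[OF l(2)])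
  also have "\<dots> = (\<Prod>i<Suc n. emeasure (walk_kernel \<beta> T i ((!) l)) {l ! i})"
    using l(2) by (intro prod.cong) (auto simp: walk_kernel_def l nth_append split: nat.split)
  also have "ennreal (pmf (walk_step \<beta> T (last l')) y) = emeasure (walk_kernel \<beta> T (Suc n) ((!) l)) {l ! Suc n}"
    using l(2) by (cases l' rule: rev_cases) (auto simp: walk_kernel_def l nth_append emeasure_pmf_single)
  finally show ?case by (simp only: prod.lessThan_Suc[of _ "Suc n"])
qed

lemma length_prefix_pmf: "l \<in> set_pmf (prefix_pmf \<beta> T n) \<Longrightarrow> length l = Suc n"
  by (induction n arbitrary: l) auto

lemma path_prefix_eq_iff: "map X [0..<n] = l \<longleftrightarrow> length l = n \<and> (\<forall>i<n. X i = l ! i)"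
  by (subst list_eq_iff_nth_eq) auto

lemma measurable_path_prefix [measurable]:
  "(\<lambda>X. map X [0..<n]) \<in> path_space \<rightarrow>\<^sub>M count_space UNIV"
proof -
  have "(\<lambda>X. map X [0..<n]) -` {l} \<inter> space path_space \<in> sets path_space" for l
  proof -
    have "(\<lambda>X. map X [0..<n]) -` {l} \<inter> space path_space =
       (if length l = n then {X \<in> space path_space. \<forall>i\<in>{i. i < n}. X i = l ! i} else {})"
      by (auto simp: path_prefix_eq_iff)
    also have "\<dots> \<in> sets path_space"
      by (auto intro!: sets.sets_Collect_finite_All simp: path_space_def)
    finally show ?thesis .
  qed
  then show ?thesis
    by (subst measurable_count_space_eq2_countable) auto
qed

lemma distr_walk_law_prefix:
  "distr (walk_law \<beta> T) (count_space UNIV) (\<lambda>X. map X [0..<Suc n]) = measure_pmf (prefix_pmf \<beta> T n)"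
proof (rule measure_eqI_countable[of _ UNIV])
  fix l :: "nat list list"
  have "emeasure (distr (walk_law \<beta> T) (count_space UNIV) (\<lambda>X. map X [0..<Suc n])) {l} =
     emeasure (walk_law \<beta> T) {X. map X [0..<Suc n] = l}"
    by (subst emeasure_distr) (auto simp: vimage_def sets_eq_imp_space_eq[OF sets_walk_law] simp del: upt_Suc)
  also have "\<dots> = emeasure (measure_pmf (prefix_pmf \<beta> T n)) {l}"
  proof (cases "length l = Suc n")
    case True
    then have "{X. map X [0..<Suc n] = l} = {X. \<forall>i<Suc n. X i = l ! i}"
      using True by (simp only: path_prefix_eq_iff) simp
    then show ?thesis using pmf_prefix_pmf[OF True, of \<beta> T]
      by (simp only: emeasure_walk_law_kernel emeasure_pmf_single)
  next
    case False
    then have e: "{X. map X [0..<Suc n] = l} = {}" by auto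
    have "l \<notin> set_pmf (prefix_pmf \<beta> T n)" using False length_prefix_pmf by blast
    then show ?thesis unfolding e by (simp add: emeasure_pmf_single set_pmf_iff)
  qed
  finally show "emeasure (distr (walk_law \<beta> T) (count_space UNIV) (\<lambda>X. map X [0..<Suc n])) {l} = emeasure (measure_pmf (prefix_pmf \<beta> T n)) {l}" .
qed (simp_all del: upt_Suc)

lemma AE_walk_law_prefix:
  assumes "\<And>l. l \<in> set_pmf (prefix_pmf \<beta> T n) \<Longrightarrow> P l"
  shows "AE X in walk_law \<beta> T. P (map X [0..<Suc n])"
proof -
  have "AE l in distr (walk_law \<beta> T) (count_space UNIV) (\<lambda>X. map X [0..<Suc n]). P l"
    unfolding distr_walk_law_prefix using assms by (simp add: AE_measure_pmf_iff)
  then show ?thesis by (rule AE_distrD[rotated]) (simp del: upt_Suc)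
qed

lemma
  fixes f :: "nat list list \<Rightarrow> real"
  shows integral_walk_law_prefix:
    "(\<integral>X. f (map X [0..<Suc n]) \<partial>walk_law \<beta> T) = measure_pmf.expectation (prefix_pmf \<beta> T n) f"
    and integrable_walk_law_prefix:
    "integrable (walk_law \<beta> T) (\<lambda>X. f (map X [0..<Suc n])) \<longleftrightarrow> integrable (measure_pmf (prefix_pmf \<beta> T n)) f"
  unfolding distr_walk_law_prefix[symmetric]
  by (simp_all add: integral_distr integrable_distr_eq del: upt_Suc)

lemma set_pmf_prefix:
  assumes "0 \<le> \<beta>" "0 < T []"
  shows "l \<in> set_pmf (prefix_pmf \<beta> T n) \<Longrightarrow> last l \<in> tree_vertices T \<and> length (last l) \<le> n"
    and finite_set_pmf_prefix: "finite (set_pmf (prefix_pmf \<beta> T n))"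
proof -
  show *: "l \<in> set_pmf (prefix_pmf \<beta> T n) \<Longrightarrow> last l \<in> tree_vertices T \<and> length (last l) \<le> n" for l n
  proof (induction n arbitrary: l)
    case (Suc n)
    then show ?case using walk_step_vertices[where T = T, OF assms] by fastforce
  qed auto
  show "finite (set_pmf (prefix_pmf \<beta> T n))"
  proof (induction n)
    case (Suc n)
    then show ?case using assms by (auto intro!: finite_set_pmf_walk_step)
  qed auto
qed

lemma expectation_prefix_Suc:
  fixes f :: "nat list list \<Rightarrow> real"
  assumes "0 \<le> \<beta>" "0 < T []"
  shows "measure_pmf.expectation (prefix_pmf \<beta> T (Suc n)) f =
    measure_pmf.expectation (prefix_pmf \<beta> T n) (\<lambda>l. measure_pmf.expectation (walk_step \<beta> T (last l)) (\<lambda>y. f (l @ [y])))"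
proof -
  note fin = finite_set_pmf_prefix(1)[where T = T and n = n, OF assms]
  have "measure_pmf.expectation (prefix_pmf \<beta> T (Suc n)) f =
    (\<Sum>l\<in>set_pmf (prefix_pmf \<beta> T n). pmf (prefix_pmf \<beta> T n) l *\<^sub>R
       measure_pmf.expectation (map_pmf (\<lambda>y. l @ [y]) (walk_step \<beta> T (last l))) f)"
    unfolding prefix_pmf.simps using assms
    by (intro pmf_expectation_bind fin) (auto intro!: finite_set_pmf_walk_step)
  also have "\<dots> = measure_pmf.expectation (prefix_pmf \<beta> T n) (\<lambda>l. measure_pmf.expectation (walk_step \<beta> T (last l)) (\<lambda>y. f (l @ [y])))"
    by (subst integral_measure_pmf[OF fin]) auto
  finally show ?thesis .
qed

text \<open>The Markov property of the walk: conditionally on the path up to time \<open>n\<close>, the next position is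
distributed according to one step from the last position.\<close>

lemma integral_walk_law_step:
  fixes f :: "nat list list \<Rightarrow> nat list \<Rightarrow> real"
  assumes "0 \<le> \<beta>" "0 < T []"
  shows "(\<integral>X. f (map X [0..<Suc n]) (X (Suc n)) \<partial>walk_law \<beta> T) =
    measure_pmf.expectation (prefix_pmf \<beta> T n) (\<lambda>l. measure_pmf.expectation (walk_step \<beta> T (last l)) (f l))"
proof -
  have "(\<integral>X. f (map X [0..<Suc n]) (X (Suc n)) \<partial>walk_law \<beta> T) =
      (\<integral>X. (\<lambda>l. f (butlast l) (last l)) (map X [0..<Suc (Suc n)]) \<partial>walk_law \<beta> T)"
    by (simp add: upt_Suc_append[of 0 "Suc n"] del: upt_Suc)
  also have "\<dots> = measure_pmf.expectation (prefix_pmf \<beta> T (Suc n)) (\<lambda>l. f (butlast l) (last l))"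
    by (rule integral_walk_law_prefix)
  finally show ?thesis
    by (simp only: expectation_prefix_Suc[where T = T, OF assms] butlast_snoc last_snoc)
qed

lemma AE_walk_law_vertices:
  assumes "0 \<le> \<beta>" "0 < T []"
  shows "AE X in walk_law \<beta> T. \<forall>n. X n \<in> tree_vertices T \<and> length (X n) \<le> n"
proof (subst AE_all_countable, intro allI)
  fix n
  have "AE X in walk_law \<beta> T. last (map X [0..<Suc n]) \<in> tree_vertices T \<and> length (last (map X [0..<Suc n])) \<le> n"
    by (rule AE_walk_law_prefix) (use set_pmf_prefix(1)[where T = T, OF assms] in blast)
  then show "AE X in walk_law \<beta> T. X n \<in> tree_vertices T \<and> length (X n) \<le> n"
    by simp
qed

text \<open>By \<open>drift\<close>, \<open>h (X n) - n\<close> is a martingale. As \<open>length (X n) \<le> n\<close>, the factor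
\<open>1 / (length x + 1)\<^sup>2\<close> in \<open>lyap\<close> is at least \<open>1 / (n + 1)\<^sup>2\<close> at time \<open>n\<close>, and telescoping the
expectations of \<open>F (X n)\<close> bounds the series required by the martingale strong law by \<open>F []\<close>.\<close>

lemma walk_law_lyapunov_lln:
  fixes h F :: "nat list \<Rightarrow> real"
  assumes \<beta>: "0 \<le> \<beta>" and root: "0 < T []"
    and drift: "\<And>x. x \<in> tree_vertices T \<Longrightarrow> measure_pmf.expectation (walk_step \<beta> T x) h = h x + 1"
    and lyap: "\<And>x. x \<in> tree_vertices T \<Longrightarrow>
       measure_pmf.expectation (walk_step \<beta> T x) F +
       measure_pmf.expectation (walk_step \<beta> T x) (\<lambda>y. (h y - h x - 1)\<^sup>2) / (real (Suc (length x)))\<^sup>2 \<le> F x"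
    and F_nonneg: "\<And>x. x \<in> tree_vertices T \<Longrightarrow> 0 \<le> F x"
  shows "AE X in walk_law \<beta> T. (\<lambda>n. h (X n) / real n) \<longlonglongrightarrow> 1"
proof -
  interpret prob_space "walk_law \<beta> T" by (rule prob_space_walk_law)
  let ?p = "prefix_pmf \<beta> T"
  note supp = set_pmf_prefix(1)[where T = T, OF \<beta> root] and fin = finite_set_pmf_prefix[where T = T, OF \<beta> root]
  define Z where "Z n X = h (X n) - real n" for n and X :: "nat \<Rightarrow> nat list"
  have meas [measurable]: "(\<lambda>X. f (X n)) \<in> borel_measurable (walk_law \<beta> T)" for n and f :: "nat list \<Rightarrow> real"
    unfolding measurable_cong_sets[OF sets_walk_law refl] path_space_def
    by (rule measurable_compose[OF measurable_component_singleton]) auto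
  have intp: "integrable (measure_pmf (?p n)) g" for n and g :: "nat list list \<Rightarrow> real"
    by (rule integrable_measure_pmf_finite[OF fin])
  have cong: "measure_pmf.expectation (?p n) f = measure_pmf.expectation (?p n) g"
    if "\<And>l. l \<in> set_pmf (?p n) \<Longrightarrow> f l = g l" for n and f g :: "nat list list \<Rightarrow> real"
    using that by (intro integral_cong_AE) (auto simp: AE_measure_pmf_iff)
  define d where "d n = expectation (\<lambda>X. (Z (Suc n) X - Z n X)\<^sup>2)" for n
  define Fn where "Fn n = measure_pmf.expectation (?p n) (\<lambda>l. F (last l))" for n
  have d_eq: "d n = measure_pmf.expectation (?p n) (\<lambda>l. measure_pmf.expectation (walk_step \<beta> T (last l)) (\<lambda>y. (h y - h (last l) - 1)\<^sup>2))" for n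
  proof -
    have "d n = (\<integral>X. (h (X (Suc n)) - h (last (map X [0..<Suc n])) - 1)\<^sup>2 \<partial>walk_law \<beta> T)"
      unfolding d_def Z_def by (intro Bochner_Integration.integral_cong) (auto simp: algebra_simps)
    also have "\<dots> = measure_pmf.expectation (?p n) (\<lambda>l. measure_pmf.expectation (walk_step \<beta> T (last l)) (\<lambda>y. (h y - h (last l) - 1)\<^sup>2))"
      by (rule integral_walk_law_step[where T = T and f = "\<lambda>l y. (h y - h (last l) - 1)\<^sup>2", OF \<beta> root])
    finally show ?thesis .
  qed
  have F_dec: "Fn (Suc n) + d n / (real (Suc n))\<^sup>2 \<le> Fn n" for n
  proof -
    have "Fn (Suc n) = measure_pmf.expectation (?p n) (\<lambda>l. measure_pmf.expectation (walk_step \<beta> T (last l)) F)"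
      unfolding Fn_def by (subst expectation_prefix_Suc[where T = T, OF \<beta> root]) simp
    then have "Fn (Suc n) + d n / (real (Suc n))\<^sup>2 = measure_pmf.expectation (?p n)
      (\<lambda>l. measure_pmf.expectation (walk_step \<beta> T (last l)) F + measure_pmf.expectation (walk_step \<beta> T (last l)) (\<lambda>y. (h y - h (last l) - 1)\<^sup>2) / (real (Suc n))\<^sup>2)"
      unfolding d_eq using intp by (subst Bochner_Integration.integral_add) auto
    also have "\<dots> \<le> Fn n" unfolding Fn_def
    proof (rule integral_mono_AE[OF intp intp], unfold AE_measure_pmf_iff, rule ballI)
      fix l assume l: "l \<in> set_pmf (?p n)"
      let ?E = "measure_pmf.expectation (walk_step \<beta> T (last l)) (\<lambda>y. (h y - h (last l) - 1)\<^sup>2)"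
      have "?E / (real (Suc n))\<^sup>2 \<le> ?E / (real (Suc (length (last l))))\<^sup>2"
        using supp[OF l] by (intro divide_left_mono power_mono) auto
      then show "measure_pmf.expectation (walk_step \<beta> T (last l)) F + ?E / (real (Suc n))\<^sup>2 \<le> F (last l)"
        using lyap[of "last l"] supp[OF l] by linarith
    qed
    finally show ?thesis .
  qed
  have "AE X in walk_law \<beta> T. (\<lambda>n. Z n X / real n) \<longlonglongrightarrow> 0"
  proof (rule martingale_strong_law)
    show "Z n \<in> borel_measurable (walk_law \<beta> T)" for n unfolding Z_def by measurable
    show "integrable (walk_law \<beta> T) (\<lambda>X. (Z n X)\<^sup>2)" for n
      using integrable_walk_law_prefix[of \<beta> T "\<lambda>l. (h (last l) - real n)\<^sup>2" n] intp[of n] by (simp add: Z_def)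
    show "summable (\<lambda>n. expectation (\<lambda>X. (Z (Suc n) X - Z n X)\<^sup>2) / (real (Suc n))\<^sup>2)"
      unfolding d_def[symmetric]
    proof (rule summableI_nonneg_bounded)
      show "0 \<le> d n / (real (Suc n))\<^sup>2" for n by (simp add: d_def)
      show "(\<Sum>k<n. d k / (real (Suc k))\<^sup>2) \<le> Fn 0" for n
      proof -
        have "(\<Sum>k<n. d k / (real (Suc k))\<^sup>2) \<le> Fn 0 - Fn n"
        proof (induction n)
          case (Suc n) then show ?case using F_dec[of n] by simp
        qed simp
        moreover have "0 \<le> Fn n" unfolding Fn_def
          by (rule integral_nonneg_AE) (use supp F_nonneg in \<open>auto simp: AE_measure_pmf_iff\<close>)
        ultimately show ?thesis by simp
      qed
    qed
    show "expectation (\<lambda>x. indicator {x \<in> space (walk_law \<beta> T). \<forall>i\<in>{N..n}. \<bar>Z i x\<bar> < \<epsilon> * real i} x *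
                 (Z n x * (Z (Suc n) x - Z n x))) = 0" for n N \<epsilon>
    proof -
      define c where "c l = (if \<forall>i\<in>{N..n}. \<bar>h (l ! i) - real i\<bar> < \<epsilon> * real i then h (l ! n) - real n else 0)" for l
      have "expectation (\<lambda>x. indicator {x \<in> space (walk_law \<beta> T). \<forall>i\<in>{N..n}. \<bar>Z i x\<bar> < \<epsilon> * real i} x *
                 (Z n x * (Z (Suc n) x - Z n x))) =
         (\<integral>X. c (map X [0..<Suc n]) * (h (X (Suc n)) - h (last (map X [0..<Suc n])) - 1) \<partial>walk_law \<beta> T)"
      proof (rule Bochner_Integration.integral_cong[OF refl])
        fix X :: "nat \<Rightarrow> nat list"
        have "map X [0..<Suc n] ! i = X i" if "i \<le> n" for i using that by (simp del: upt_Suc)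
        then show "indicator {x \<in> space (walk_law \<beta> T). \<forall>i\<in>{N..n}. \<bar>Z i x\<bar> < \<epsilon> * real i} X * (Z n X * (Z (Suc n) X - Z n X)) =
          c (map X [0..<Suc n]) * (h (X (Suc n)) - h (last (map X [0..<Suc n])) - 1)"
          by (auto simp: Z_def c_def sets_eq_imp_space_eq[OF sets_walk_law] simp del: upt_Suc) (auto simp: algebra_simps)
      qed
      also have "\<dots> = measure_pmf.expectation (?p n) (\<lambda>l. measure_pmf.expectation (walk_step \<beta> T (last l))
           (\<lambda>y. c l * (h y - h (last l) - 1)))"
        by (rule integral_walk_law_step[where T = T and f = "\<lambda>l y. c l * (h y - h (last l) - 1)", OF \<beta> root])
      also have "\<dots> = measure_pmf.expectation (?p n) (\<lambda>l. 0)"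
      proof (rule cong)
        fix l assume l: "l \<in> set_pmf (?p n)"
        have lV: "last l \<in> tree_vertices T" using supp[OF l] by simp
        have intw: "integrable (measure_pmf (walk_step \<beta> T (last l))) g" for g :: "nat list \<Rightarrow> real"
          by (rule integrable_measure_pmf_finite, rule finite_set_pmf_walk_step[OF \<beta>]) (use root in auto)
        show "measure_pmf.expectation (walk_step \<beta> T (last l)) (\<lambda>y. c l * (h y - h (last l) - 1)) = 0"
          using drift[OF lV] intw[of h] by simp
      qed
      finally show ?thesis by simp
    qed
  qed
  then show ?thesis
  proof eventually_elim
    case (elim X)
    have "(\<lambda>n. Z n X / real n + 1) \<longlonglongrightarrow> 0 + 1" by (intro tendsto_add elim tendsto_const)
    moreover have "\<forall>\<^sub>F n in sequentially. Z n X / real n + 1 = h (X n) / real n"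
      using eventually_gt_at_top[of 0] by eventually_elim (simp add: Z_def field_simps)
    ultimately show ?case using Lim_transform_eventually by fastforce
  qed
qed

section \<open>The speed on a fixed tree with a spine\<close>

text \<open>Summing the recursion up to \<open>n\<close> bounds \<open>(1 - \<theta>)\<close> times the partial sum of \<open>a\<close>.\<close>

lemma summable_geometric_recursion:
  fixes a c :: "nat \<Rightarrow> real"
  assumes a0: "\<And>k. 0 \<le> a k" and c0: "\<And>k. 0 \<le> c k" and \<theta>: "0 \<le> \<theta>" "\<theta> < 1"
    and rec: "\<And>k. a (Suc k) \<le> \<theta> * a k + c k" and c: "summable c"
  shows "summable a"
proof (rule summableI_nonneg_bounded[OF a0])
  fix n
  have c_le: "(\<Sum>k<n. c k) \<le> suminf c" for n
    using c c0 by (intro sum_le_suminf) auto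
  have "(\<Sum>k<Suc n. a k) \<le> a 0 + \<theta> * (\<Sum>k<n. a k) + (\<Sum>k<n. c k)" for n
  proof -
    have "(\<Sum>k<Suc n. a k) = a 0 + (\<Sum>k<n. a (Suc k))" by (rule sum.lessThan_Suc_shift)
    also have "(\<Sum>k<n. a (Suc k)) \<le> (\<Sum>k<n. \<theta> * a k + c k)" by (intro sum_mono rec)
    finally show ?thesis by (simp add: sum.distrib sum_distrib_left)
  qed
  from this[of n] have "(1 - \<theta>) * (\<Sum>k<n. a k) \<le> a 0 + suminf c"
    using c_le[of n] a0[of n] by (simp add: algebra_simps)
  then show "(\<Sum>k<n. a k) \<le> (a 0 + suminf c) / (1 - \<theta>)"
    using \<theta> by (simp add: field_simps)
qed

lemma sublinear_reindex:
  fixes e a :: "nat \<Rightarrow> real"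
  assumes e: "(\<lambda>k. e k / real (Suc k)) \<longlonglongrightarrow> 0"
    and a: "\<And>n. \<exists>k\<le>n. \<bar>a n\<bar> \<le> e k"
  shows "(\<lambda>n. a n / real n) \<longlonglongrightarrow> 0"
proof (rule LIMSEQ_I)
  fix r :: real assume r: "0 < r"
  from LIMSEQ_D[OF e, of "r/4"] r obtain K where K: "\<And>k. k \<ge> K \<Longrightarrow> \<bar>e k / real (Suc k)\<bar> < r/4"
    by auto
  define C where "C = (\<Sum>k<K. \<bar>e k\<bar>)"
  have e_le: "e k \<le> C + r/4 * real (Suc k)" for k
  proof (cases "k < K")
    case True
    have "\<bar>e k\<bar> \<le> C" unfolding C_def using True by (intro member_le_sum) auto
    moreover have "0 \<le> r/4 * real (Suc k)" using r by simp
    ultimately show ?thesis by linarith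
  next
    case False
    then have "e k / real (Suc k) < r/4" using K[of k] abs_ge_self[of "e k / real (Suc k)"] by linarith
    then have "e k < r/4 * real (Suc k)" by (simp add: divide_less_eq)
    moreover have "0 \<le> C" by (simp add: C_def sum_nonneg)
    ultimately show ?thesis by linarith
  qed
  have "(\<lambda>n. C / real n) \<longlonglongrightarrow> 0" by (rule lim_const_over_n)
  from LIMSEQ_D[OF this, of "r/2"] r obtain N where N: "\<And>n. n \<ge> N \<Longrightarrow> \<bar>C / real n\<bar> < r/2" by auto
  show "\<exists>no. \<forall>n\<ge>no. norm (a n / real n - 0) < r"
  proof (intro exI[of _ "max N 1"] allI impI)
    fix n assume n: "max N 1 \<le> n"
    obtain k where k: "k \<le> n" "\<bar>a n\<bar> \<le> e k" using a by blast
    have "r/4 * real (Suc k) \<le> r/4 * (2 * real n)" using k n r by (intro mult_left_mono) auto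
    then have "\<bar>a n\<bar> \<le> C + r/2 * real n" using k(2) e_le[of k] by simp
    then have "\<bar>a n\<bar> / real n \<le> C / real n + r/2" using n by (simp add: field_simps)
    then show "norm (a n / real n - 0) < r"
      using N[of n] n abs_ge_self[of "C / real n"] unfolding diff_zero real_norm_def abs_divide abs_of_nat by linarith
  qed
qed

lemma sum_power2_le_power2_sum:
  fixes f :: "'a \<Rightarrow> real"
  assumes "finite A" "\<And>i. i \<in> A \<Longrightarrow> 0 \<le> f i"
  shows "(\<Sum>i\<in>A. (f i)\<^sup>2) \<le> (\<Sum>i\<in>A. f i)\<^sup>2"
  using assms
proof (induction A rule: finite_induct)
  case (insert a A)
  have "0 \<le> f a * (\<Sum>i\<in>A. f i)" using insert by (intro mult_nonneg_nonneg sum_nonneg) auto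
  then show ?case using insert by (simp add: power2_sum)
qed simp

text \<open>Convexity of the square at the point \<open>e / (1 - \<theta>)\<close>: \<open>\<theta> * a + e\<close> is its average with \<open>a\<close>.\<close>

lemma convex_square:
  fixes a e \<theta> :: real
  assumes "0 \<le> \<theta>" "\<theta> < 1"
  shows "(\<theta> * a + e)\<^sup>2 \<le> \<theta> * a\<^sup>2 + e\<^sup>2 / (1 - \<theta>)"
proof -
  have "0 \<le> \<theta> * ((1 - \<theta>) * a - e)\<^sup>2" using assms by simp
  then have "(\<theta> * a + e)\<^sup>2 * (1 - \<theta>) \<le> \<theta> * a\<^sup>2 * (1 - \<theta>) + e\<^sup>2"
    by (simp add: power2_eq_square algebra_simps)
  then show ?thesis using assms by (simp add: field_simps)
qed

lemma double_minus_one_square_le: "1 \<le> s \<Longrightarrow> (1 - 2 * s)\<^sup>2 \<le> 4 * s\<^sup>2" for s :: real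
  by (simp add: power2_eq_square algebra_simps)

lemma tendsto_zero_of_square_summable:
  fixes m :: "nat \<Rightarrow> real"
  assumes "summable (\<lambda>k. (m k)\<^sup>2 / (real (Suc k))\<^sup>2)"
  shows "(\<lambda>k. m k / real (Suc k)) \<longlonglongrightarrow> 0"
proof -
  have "(\<lambda>k. (m k / real (Suc k))\<^sup>2) \<longlonglongrightarrow> 0"
    using summable_LIMSEQ_zero[OF assms] by (simp add: power_divide)
  from tendsto_real_sqrt[OF this] show ?thesis
    by (intro tendsto_rabs_zero_cancel[of "\<lambda>k. m k / real (Suc k)"]) (simp only: real_sqrt_abs real_sqrt_zero)
qed

text \<open>A tree with a distinguished ray \<open>r\<close>, the spine, that enters the child number \<open>j k\<close> in generation \<open>k\<close>.
The recursion \<open>S_rec\<close> is that of the weighted subtree sizes, in which a descendant \<open>d\<close> generations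
below \<open>x\<close> counts \<open>\<beta> ^ d\<close>; it is imposed off the spine only, since on the spine these weights are infinite.
\<open>B k\<close> is the weight of everything that hangs off the spine vertex \<open>r k\<close>.\<close>

locale tree_with_spine =
  fixes \<beta> b :: real and T :: tree and j :: "nat \<Rightarrow> nat" and S :: "nat list \<Rightarrow> real" and r B
  defines "r \<equiv> \<lambda>k. map j [0..<k]"
    and "B \<equiv> \<lambda>k. \<Sum>i\<in>{..<T (r k)} - {j k}. S (r k @ [i])"
  assumes \<beta>: "1 < \<beta>"
    and spine_child: "\<And>k. j k < T (r k)"
    and S_rec: "\<And>x. x \<in> tree_vertices T \<Longrightarrow> x \<noteq> r (length x) \<Longrightarrow> S x = 1 + \<beta> * (\<Sum>i<T x. S (x @ [i]))"
    and S_ge_1: "\<And>x. x \<in> tree_vertices T \<Longrightarrow> x \<noteq> r (length x) \<Longrightarrow> 1 \<le> S x"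
    and B_mean: "(\<lambda>n. (\<Sum>k<n. B k) / real n) \<longlonglongrightarrow> b"
    and B_sq: "summable (\<lambda>k. (B k)\<^sup>2 / (real (Suc k))\<^sup>2)"
begin

lemma r_0 [simp]: "r 0 = []" and r_Suc: "r (Suc k) = r k @ [j k]" and length_r [simp]: "length (r k) = k"
  by (simp_all add: r_def)

lemma r_vertex [simp]: "r k \<in> tree_vertices T"
  by (induction k) (auto simp: r_Suc spine_child)

lemma snoc_eq_r: "x @ [i] = r (Suc (length x)) \<longleftrightarrow> x = r (length x) \<and> i = j (length x)"
  by (auto simp: r_Suc)

lemma root_has_child: "0 < T []" using spine_child[of 0] by simp

lemma trap_child: "i < T (r k) \<Longrightarrow> i \<noteq> j k \<Longrightarrow> 1 \<le> S (r k @ [i])"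
  using snoc_eq_r[of "r k" i] by (intro S_ge_1) auto

lemma B_nonneg: "0 \<le> B k"
  unfolding B_def by (intro sum_nonneg order_trans[OF _ trap_child]) auto

text \<open>The expected passage time from \<open>r k\<close> to \<open>r (Suc k)\<close>. A first-step analysis at \<open>r (Suc k)\<close> gives the
recursion, since an excursion into the normal child \<open>y\<close> takes expected time \<open>1 + (2 * S y - 1)\<close>.\<close>

primrec m :: "nat \<Rightarrow> real" where
  "m 0 = 1 + 2 * B 0"
| "m (Suc k) = m k / \<beta> + (1 + \<beta>) / \<beta> + 2 * B (Suc k)"

definition w :: "nat \<Rightarrow> real" where "w n = 1 / (real (Suc n))\<^sup>2"

lemma w_nonneg: "0 \<le> w n" and w_mono: "w (Suc n) \<le> w n"
  by (auto simp: w_def intro!: divide_left_mono power_mono)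

text \<open>The solution of \<open>(C + 4) / \<beta> + 4 = C\<close>. Off the spine \<open>F\<close> rises by \<open>C * (S y)\<^sup>2\<close>, up to the factor \<open>w\<close>,
on the way down to a child \<open>y\<close>, and the squared increment of \<open>h\<close> across an edge is at most four times the squared
weight below it. The children of \<open>x\<close> together cost at most \<open>(C + 4) / \<beta> * (S x)\<^sup>2\<close> and the edge above \<open>x\<close> costs
\<open>4 * (S x)\<^sup>2\<close>; the fall of \<open>F\<close> across that edge, \<open>C * (S x)\<^sup>2\<close>, pays for both.\<close>

definition C :: real where "C = 4 * (\<beta> + 1) / (\<beta> - 1)"

lemma C_nonneg: "0 \<le> C" and C_eq: "(C + 4) / \<beta> + 4 = C"
  using \<beta> by (auto simp: C_def field_simps)

text \<open>The amount by which \<open>F\<close> decreases from \<open>r k\<close> to \<open>r (Suc k)\<close>. The recursion is the one that makes the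
Lyapunov inequality at \<open>r (Suc k)\<close> hold after \<open>(B (Suc k))\<^sup>2\<close> has replaced the sum of the squares of \<open>S\<close>
over the normal children.\<close>

primrec g :: "nat \<Rightarrow> real" where
  "g 0 = w 0 * ((m 0)\<^sup>2 + (C + 4) * (B 0)\<^sup>2)"
| "g (Suc k) = g k / \<beta> + w (Suc k) * ((m k)\<^sup>2 / \<beta> + (m (Suc k))\<^sup>2 + (C + 4) * (B (Suc k))\<^sup>2)"

lemma g_nonneg: "0 \<le> g k"
  using \<beta> w_nonneg C_nonneg by (induction k) auto

lemma summable_w: "summable w"
proof -
  have "summable (\<lambda>n. inverse ((real n)\<^sup>2))" by (rule inverse_power_summable) simp
  then have "summable (\<lambda>n. inverse ((real (Suc n))\<^sup>2))" by (subst summable_Suc_iff)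
  then show ?thesis by (simp add: w_def[abs_def] inverse_eq_divide)
qed

lemma summable_w_B: "summable (\<lambda>k. w k * (B k)\<^sup>2)"
  using B_sq by (simp add: w_def)

text \<open>\<open>m\<close> is an exponentially weighted moving average of \<open>B\<close>, so the summability of \<open>w k * (B k)\<^sup>2\<close> is inherited.\<close>

lemma summable_w_m: "summable (\<lambda>k. w k * (m k)\<^sup>2)"
proof (rule summable_geometric_recursion[where \<theta> = "1 / \<beta>"])
  let ?K = "1 - 1 / \<beta>"
  define e where "e k = (1 + \<beta>) / \<beta> + 2 * B (Suc k)" for k
  have K: "0 < ?K" using \<beta> by simp
  show "w (Suc k) * (m (Suc k))\<^sup>2 \<le> 1 / \<beta> * (w k * (m k)\<^sup>2) + w (Suc k) * ((e k)\<^sup>2 / ?K)" for k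
  proof -
    have "(m (Suc k))\<^sup>2 \<le> 1 / \<beta> * (m k)\<^sup>2 + (e k)\<^sup>2 / ?K"
      using convex_square[of "1/\<beta>" "m k" "e k"] \<beta> by (simp add: e_def add.assoc)
    from mult_left_mono[OF this w_nonneg]
    have "w (Suc k) * (m (Suc k))\<^sup>2 \<le> w (Suc k) * (1 / \<beta> * (m k)\<^sup>2) + w (Suc k) * ((e k)\<^sup>2 / ?K)"
      by (simp only: distrib_left)
    also have "w (Suc k) * (1 / \<beta> * (m k)\<^sup>2) \<le> w k * (1 / \<beta> * (m k)\<^sup>2)"
      using \<beta> by (intro mult_right_mono w_mono) auto
    finally show ?thesis by (simp add: mult_ac)
  qed
  have "summable (\<lambda>k. w (Suc k) * (2 * ((1 + \<beta>) / \<beta>)\<^sup>2 + 8 * (B (Suc k))\<^sup>2) / ?K)"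
  proof -
    have "summable (\<lambda>k. (2 * ((1 + \<beta>) / \<beta>)\<^sup>2) * w (Suc k) + 8 * (w (Suc k) * (B (Suc k))\<^sup>2))"
      using summable_w summable_w_B by (intro summable_add summable_mult) (simp_all only: summable_Suc_iff summable_Suc_iff[of "\<lambda>k. w k * (B k)\<^sup>2"])
    from summable_divide[OF this, of ?K] show ?thesis by (simp add: algebra_simps)
  qed
  then show "summable (\<lambda>k. w (Suc k) * ((e k)\<^sup>2 / ?K))"
  proof (rule summable_comparison_test')
    fix k :: nat
    have "(a + 2 * d)\<^sup>2 \<le> 2 * a\<^sup>2 + 8 * d\<^sup>2" for a d :: real
      using zero_le_power2[of "a - 2 * d"] by (simp add: power2_eq_square algebra_simps)
    then have "(e k)\<^sup>2 \<le> 2 * ((1 + \<beta>) / \<beta>)\<^sup>2 + 8 * (B (Suc k))\<^sup>2"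
      unfolding e_def .
    then have "w (Suc k) * (e k)\<^sup>2 / ?K \<le> w (Suc k) * (2 * ((1 + \<beta>) / \<beta>)\<^sup>2 + 8 * (B (Suc k))\<^sup>2) / ?K"
      using K w_nonneg by (intro divide_right_mono mult_left_mono) auto
    then show "norm (w (Suc k) * ((e k)\<^sup>2 / ?K)) \<le> w (Suc k) * (2 * ((1 + \<beta>) / \<beta>)\<^sup>2 + 8 * (B (Suc k))\<^sup>2) / ?K"
      using w_nonneg[of "Suc k"] K by (simp add: abs_mult)
  qed
qed (use \<beta> w_nonneg in auto)

lemma summable_g: "summable g"
proof (rule summable_geometric_recursion[where \<theta> = "1 / \<beta>" and c =
      "\<lambda>k. w k * (m k)\<^sup>2 / \<beta> + w (Suc k) * (m (Suc k))\<^sup>2 + (C + 4) * (w (Suc k) * (B (Suc k))\<^sup>2)"])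
  show "summable (\<lambda>k. w k * (m k)\<^sup>2 / \<beta> + w (Suc k) * (m (Suc k))\<^sup>2 + (C + 4) * (w (Suc k) * (B (Suc k))\<^sup>2))"
    using summable_w_m summable_w_B
    by (intro summable_add summable_divide summable_mult)
       (simp_all only: summable_Suc_iff[of "\<lambda>k. w k * (m k)\<^sup>2"] summable_Suc_iff[of "\<lambda>k. w k * (B k)\<^sup>2"])
  show "g (Suc k) \<le> 1 / \<beta> * g k + (w k * (m k)\<^sup>2 / \<beta> + w (Suc k) * (m (Suc k))\<^sup>2 + (C + 4) * (w (Suc k) * (B (Suc k))\<^sup>2))" for k
  proof -
    have "w (Suc k) * ((m k)\<^sup>2 / \<beta>) \<le> w k * ((m k)\<^sup>2 / \<beta>)"
      using \<beta> by (intro mult_right_mono w_mono) auto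
    then show ?thesis by (simp add: distrib_left mult_ac)
  qed
qed (use \<beta> w_nonneg g_nonneg C_nonneg in auto)

text \<open>Functions on the tree are specified by their increments along edges, the edge above \<open>y\<close> being
identified with \<open>y\<close>.\<close>

definition path_sum :: "(nat list \<Rightarrow> real) \<Rightarrow> nat list \<Rightarrow> real" where
  "path_sum f x = (\<Sum>n<length x. f (take (Suc n) x))"

lemma path_sum_Nil [simp]: "path_sum f [] = 0" by (simp add: path_sum_def)

lemma path_sum_snoc [simp]: "path_sum f (x @ [i]) = path_sum f x + f (x @ [i])"
  by (simp add: path_sum_def)

lemma path_sum_butlast: "x \<noteq> [] \<Longrightarrow> path_sum f (butlast x) = path_sum f x - f x"
  by (cases x rule: rev_cases) auto

text \<open>\<open>h\<close> is the coordinate with drift one: on the spine it is the expected time to arrive from the root, and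
elsewhere the remaining expected time to return to the spine is subtracted.\<close>

definition dh :: "nat list \<Rightarrow> real" where
  "dh y = (if y = r (length y) then m (length y - 1) else 1 - 2 * S y)"

definition h :: "nat list \<Rightarrow> real" where "h = path_sum dh"

text \<open>The starting value \<open>suminf g\<close> is just large enough to keep \<open>F\<close> nonnegative along the spine, and \<open>F\<close>
increases when a bush is entered.\<close>

definition dF :: "nat list \<Rightarrow> real" where
  "dF y = (if y = r (length y) then - g (length y - 1) else C * w (length y) * (S y)\<^sup>2)"

definition F :: "nat list \<Rightarrow> real" where "F x = suminf g + path_sum dF x"

lemma sum_spine_children:
  "(\<Sum>i<T (r k). f (r k @ [i])) = f (r (Suc k)) + (\<Sum>i\<in>{..<T (r k)} - {j k}. f (r k @ [i]))"
  for f :: "nat list \<Rightarrow> real"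
  using spine_child[of k] by (subst sum.remove[of _ "j k"]) (auto simp: r_Suc)

lemma sum_dh_spine: "(\<Sum>i<T (r k). dh (r k @ [i])) = m k + real (T (r k)) - 1 - 2 * B k"
proof -
  have "(\<Sum>i\<in>{..<T (r k)} - {j k}. dh (r k @ [i])) = (\<Sum>i\<in>{..<T (r k)} - {j k}. 1 - 2 * S (r k @ [i]))"
    using snoc_eq_r[of "r k"] by (intro sum.cong) (auto simp: dh_def)
  also have "\<dots> = real (T (r k)) - 1 - 2 * B k"
    using spine_child[of k] by (simp add: sum_subtractf B_def sum_distrib_left of_nat_diff)
  finally show ?thesis
    unfolding sum_spine_children by (simp add: dh_def)
qed

lemma sum_dh_trap:
  assumes "x \<in> tree_vertices T" "x \<noteq> r (length x)"
  shows "\<beta> * (\<Sum>i<T x. dh (x @ [i])) = \<beta> * real (T x) - 2 * (S x - 1)"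
proof -
  have "(\<Sum>i<T x. dh (x @ [i])) = (\<Sum>i<T x. 1 - 2 * S (x @ [i]))"
    using assms(2) snoc_eq_r[of x] by (intro sum.cong) (auto simp: dh_def)
  also have "\<beta> * \<dots> = \<beta> * real (T x) - 2 * (\<beta> * (\<Sum>i<T x. S (x @ [i])))"
    by (simp add: sum_subtractf sum_distrib_left[symmetric] algebra_simps)
  finally show ?thesis using S_rec[OF assms] by simp
qed

text \<open>In terms of increments the claim is \<open>\<beta> * (\<Sum>i<T x. dh (x @ [i])) - dh x = 1 + \<beta> * T x\<close>, which is the
recursion of \<open>m\<close> on the spine and that of \<open>S\<close> off the spine.\<close>

lemma h_drift:
  assumes x: "x \<in> tree_vertices T"
  shows "measure_pmf.expectation (walk_step \<beta> T x) h = h x + 1"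
proof (cases "x = []")
  case True
  have "(\<Sum>i<T []. h [i]) = real (T [])"
    using sum_dh_spine[of 0] path_sum_snoc[of dh "[]"] by (simp add: h_def)
  then show ?thesis using root_has_child True
    by (simp add: expectation_walk_step_root h_def)
next
  case False
  have pos: "0 < 1 + \<beta> * T x" using \<beta> by (simp add: add_pos_nonneg)
  have key: "\<beta> * (\<Sum>i<T x. dh (x @ [i])) - dh x = 1 + \<beta> * T x"
  proof (cases "x = r (length x)")
    case True
    obtain k where k: "length x = Suc k" using False by (cases "length x") auto
    have "\<beta> * m (Suc k) = m k + (1 + \<beta>) + 2 * \<beta> * B (Suc k)"
      using \<beta> by (simp add: field_simps)
    moreover have "dh x = m k" using True k by (simp add: dh_def)
    moreover have "(\<Sum>i<T x. dh (x @ [i])) = m (Suc k) + real (T x) - 1 - 2 * B (Suc k)"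
      using sum_dh_spine[of "Suc k"] True k by simp
    ultimately show ?thesis by (simp only:) (simp add: algebra_simps del: m.simps)
  next
    case F: False
    then have "dh x = 1 - 2 * S x" by (simp add: dh_def)
    then show ?thesis using sum_dh_trap[OF x F] by simp
  qed
  have "measure_pmf.expectation (walk_step \<beta> T x) h =
      (h x - dh x + \<beta> * (real (T x) * h x + (\<Sum>i<T x. dh (x @ [i])))) / (1 + \<beta> * T x)"
    using \<beta> False by (subst expectation_walk_step) (auto simp: h_def path_sum_butlast sum.distrib)
  also have "\<dots> = (h x * (1 + \<beta> * T x) + (1 + \<beta> * T x)) / (1 + \<beta> * T x)"
    using key by (simp add: algebra_simps)
  also have "\<dots> = h x + 1" using pos by (simp add: add_divide_distrib)
  finally show ?thesis .
qed

text \<open>What the edge to a child contributes to the Lyapunov inequality at \<open>x\<close>: the change of \<open>F\<close> and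
the squared increment of \<open>h\<close>. The weight \<open>w\<close> decreases with the generation, so it can be taken at \<open>x\<close>.\<close>

lemma child_cost_trap:
  assumes "x \<in> tree_vertices T" "x \<noteq> r (length x)" "i < T x"
  shows "dF (x @ [i]) + w (length x) * (dh (x @ [i]))\<^sup>2 \<le> w (length x) * ((C + 4) * (S (x @ [i]))\<^sup>2)"
    and "1 \<le> S (x @ [i])"
proof -
  have ns: "x @ [i] \<noteq> r (length (x @ [i]))" using snoc_eq_r[of x i] assms by simp
  show S1: "1 \<le> S (x @ [i])" using assms ns by (intro S_ge_1) auto
  have "C * w (Suc (length x)) * (S (x @ [i]))\<^sup>2 \<le> C * w (length x) * (S (x @ [i]))\<^sup>2"
    using C_nonneg by (intro mult_right_mono mult_left_mono w_mono) auto
  moreover have "w (length x) * (1 - 2 * S (x @ [i]))\<^sup>2 \<le> w (length x) * (4 * (S (x @ [i]))\<^sup>2)"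
    by (intro mult_left_mono double_minus_one_square_le S1 w_nonneg)
  ultimately show "dF (x @ [i]) + w (length x) * (dh (x @ [i]))\<^sup>2 \<le> w (length x) * ((C + 4) * (S (x @ [i]))\<^sup>2)"
    using ns by (simp add: dF_def dh_def algebra_simps)
qed

lemma child_cost_spine:
  "(\<Sum>i<T (r k). dF (r k @ [i]) + w k * (dh (r k @ [i]))\<^sup>2) \<le> - g k + w k * ((m k)\<^sup>2 + (C + 4) * (B k)\<^sup>2)"
proof -
  let ?A = "{..<T (r k)} - {j k}"
  have "(\<Sum>i\<in>?A. dF (r k @ [i]) + w k * (dh (r k @ [i]))\<^sup>2) \<le> (\<Sum>i\<in>?A. w k * ((C + 4) * (S (r k @ [i]))\<^sup>2))"
  proof (rule sum_mono)
    fix i assume i: "i \<in> ?A"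
    have ns: "r k @ [i] \<noteq> r (Suc k)" using snoc_eq_r[of "r k" i] i by simp
    have S1: "1 \<le> S (r k @ [i])" using i by (intro trap_child) auto
    have "C * w (Suc k) * (S (r k @ [i]))\<^sup>2 \<le> C * w k * (S (r k @ [i]))\<^sup>2"
      using C_nonneg by (intro mult_right_mono mult_left_mono w_mono) auto
    moreover have "w k * (1 - 2 * S (r k @ [i]))\<^sup>2 \<le> w k * (4 * (S (r k @ [i]))\<^sup>2)"
      by (intro mult_left_mono double_minus_one_square_le S1 w_nonneg)
    ultimately show "dF (r k @ [i]) + w k * (dh (r k @ [i]))\<^sup>2 \<le> w k * ((C + 4) * (S (r k @ [i]))\<^sup>2)"
      using ns by (simp add: dF_def dh_def algebra_simps)
  qed
  also have "\<dots> = w k * ((C + 4) * (\<Sum>i\<in>?A. (S (r k @ [i]))\<^sup>2))"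
    by (simp add: sum_distrib_left)
  also have "\<dots> \<le> w k * ((C + 4) * (B k)\<^sup>2)"
    unfolding B_def using w_nonneg C_nonneg
    by (intro mult_left_mono sum_power2_le_power2_sum order_trans[OF _ trap_child]) auto
  finally show ?thesis
    unfolding sum_spine_children[of "\<lambda>y. dF y + w k * (dh y)\<^sup>2"] by (simp add: dF_def dh_def algebra_simps)
qed

text \<open>Multiplied by \<open>1 + \<beta> * T x\<close>, the claim becomes an inequality between edge contributions (\<open>key\<close>). Off the
spine it follows from \<open>\<beta> * (\<Sum>i<T x. (S (x @ [i]))\<^sup>2) \<le> (S x)\<^sup>2 / \<beta>\<close> and the choice of \<open>C\<close>; on the spine it is
the recursion of \<open>g\<close>.\<close>

lemma F_drift:
  assumes x: "x \<in> tree_vertices T"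
  shows "measure_pmf.expectation (walk_step \<beta> T x) F +
      w (length x) * measure_pmf.expectation (walk_step \<beta> T x) (\<lambda>y. (h y - h x)\<^sup>2) \<le> F x"
proof (cases "x = []")
  case True
  have "(\<Sum>i<T []. dF [i] + w 0 * (dh [i])\<^sup>2) \<le> 0"
    using child_cost_spine[of 0] by simp
  then have "(\<Sum>i<T []. F [i]) + w 0 * (\<Sum>i<T []. (h [i])\<^sup>2) \<le> real (T []) * F []"
    using path_sum_snoc[of dF "[]"] path_sum_snoc[of dh "[]"]
    by (simp add: F_def h_def sum.distrib sum_distrib_left)
  then have "((\<Sum>i<T []. F [i]) + w 0 * (\<Sum>i<T []. (h [i])\<^sup>2)) / T [] \<le> F []"
    using root_has_child by (simp add: field_simps)
  then show ?thesis using root_has_child True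
    by (simp add: expectation_walk_step_root add_divide_distrib h_def)
next
  case False
  let ?w = "w (length x)"
  have pos: "0 < 1 + \<beta> * T x" using \<beta> by (simp add: add_pos_nonneg)
  have key: "\<beta> * (\<Sum>i<T x. dF (x @ [i]) + ?w * (dh (x @ [i]))\<^sup>2) + ?w * (dh x)\<^sup>2 \<le> dF x"
  proof (cases "x = r (length x)")
    case True
    obtain k where k: "length x = Suc k" using False by (cases "length x") auto
    have "dF x = - g k" "dh x = m k" using True k by (simp_all add: dF_def dh_def)
    have "\<beta> * (\<Sum>i<T x. dF (x @ [i]) + ?w * (dh (x @ [i]))\<^sup>2)
       \<le> \<beta> * (- g (Suc k) + w (Suc k) * ((m (Suc k))\<^sup>2 + (C + 4) * (B (Suc k))\<^sup>2))"
      using child_cost_spine[of "Suc k"] True k \<beta> by (intro mult_left_mono) auto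
    also have "\<dots> = - g k - w (Suc k) * (m k)\<^sup>2"
      using \<beta> by (simp add: field_simps del: m.simps)
    finally show ?thesis unfolding \<open>dF x = - g k\<close> \<open>dh x = m k\<close> using k by simp
  next
    case F: False
    have S1: "1 \<le> S x" by (rule S_ge_1[OF x F])
    have sq: "\<beta> * (\<Sum>i<T x. (S (x @ [i]))\<^sup>2) \<le> (S x)\<^sup>2 / \<beta>"
    proof -
      have "(\<Sum>i<T x. (S (x @ [i]))\<^sup>2) \<le> (\<Sum>i<T x. S (x @ [i]))\<^sup>2"
        by (intro sum_power2_le_power2_sum order_trans[OF _ child_cost_trap(2)[OF x F]]) auto
      also have "(\<Sum>i<T x. S (x @ [i])) = (S x - 1) / \<beta>"
        using S_rec[OF x F] \<beta> by (simp add: field_simps)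
      also have "((S x - 1) / \<beta>)\<^sup>2 \<le> (S x / \<beta>)\<^sup>2"
        using S1 \<beta> by (intro power_mono divide_right_mono) auto
      finally have "\<beta> * (\<Sum>i<T x. (S (x @ [i]))\<^sup>2) \<le> \<beta> * (S x / \<beta>)\<^sup>2"
        using \<beta> by (intro mult_left_mono) auto
      also have "\<dots> = (S x)\<^sup>2 / \<beta>" using \<beta> by (simp add: power2_eq_square)
      finally show ?thesis .
    qed
    have "\<beta> * (\<Sum>i<T x. dF (x @ [i]) + ?w * (dh (x @ [i]))\<^sup>2) \<le> \<beta> * (\<Sum>i<T x. ?w * ((C + 4) * (S (x @ [i]))\<^sup>2))"
      using \<beta> child_cost_trap(1)[OF x F] by (intro mult_left_mono sum_mono) auto
    also have "\<dots> = ?w * (C + 4) * (\<beta> * (\<Sum>i<T x. (S (x @ [i]))\<^sup>2))"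
      by (simp add: sum_distrib_left mult_ac)
    also have "\<dots> \<le> ?w * (C + 4) * ((S x)\<^sup>2 / \<beta>)"
      using sq w_nonneg C_nonneg by (intro mult_left_mono) auto
    finally have "\<beta> * (\<Sum>i<T x. dF (x @ [i]) + ?w * (dh (x @ [i]))\<^sup>2) \<le> ?w * (C + 4) * ((S x)\<^sup>2 / \<beta>)" .
    moreover have "?w * (dh x)\<^sup>2 \<le> ?w * (4 * (S x)\<^sup>2)"
      using F double_minus_one_square_le[OF S1] w_nonneg by (intro mult_left_mono) (auto simp: dh_def)
    moreover have "?w * (C + 4) * ((S x)\<^sup>2 / \<beta>) + ?w * (4 * (S x)\<^sup>2) = ?w * (S x)\<^sup>2 * ((C + 4) / \<beta> + 4)"
      by (simp add: distrib_left add_divide_distrib mult_ac)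
    ultimately show ?thesis using F unfolding C_eq by (simp add: dF_def mult_ac)
  qed
  have "measure_pmf.expectation (walk_step \<beta> T x) F + ?w * measure_pmf.expectation (walk_step \<beta> T x) (\<lambda>y. (h y - h x)\<^sup>2)
     = (F x * (1 + \<beta> * T x) - dF x + (\<beta> * (\<Sum>i<T x. dF (x @ [i]) + ?w * (dh (x @ [i]))\<^sup>2) + ?w * (dh x)\<^sup>2)) / (1 + \<beta> * T x)"
  proof -
    have "measure_pmf.expectation (walk_step \<beta> T x) F = (F x - dF x + \<beta> * (real (T x) * F x + (\<Sum>i<T x. dF (x @ [i])))) / (1 + \<beta> * T x)"
      using \<beta> False by (subst expectation_walk_step) (auto simp: F_def path_sum_butlast sum.distrib algebra_simps)
    moreover have "measure_pmf.expectation (walk_step \<beta> T x) (\<lambda>y. (h y - h x)\<^sup>2) = ((dh x)\<^sup>2 + \<beta> * (\<Sum>i<T x. (dh (x @ [i]))\<^sup>2)) / (1 + \<beta> * T x)"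
      using \<beta> False by (subst expectation_walk_step) (auto simp: h_def path_sum_butlast)
    moreover have "(\<Sum>i<T x. dF (x @ [i]) + ?w * (dh (x @ [i]))\<^sup>2) = (\<Sum>i<T x. dF (x @ [i])) + ?w * (\<Sum>i<T x. (dh (x @ [i]))\<^sup>2)"
      by (simp add: sum.distrib sum_distrib_left)
    ultimately show ?thesis
      by (simp only: times_divide_eq_right add_divide_distrib[symmetric]) (simp add: algebra_simps)
  qed
  also have "\<dots> \<le> (F x * (1 + \<beta> * T x)) / (1 + \<beta> * T x)"
    using key pos by (intro divide_right_mono) auto
  also have "\<dots> = F x" using pos by simp
  finally show ?thesis .
qed

text \<open>Centring the increment of \<open>h\<close> at its mean 1 only decreases its second moment.\<close>

lemma F_lyapunov:
  assumes x: "x \<in> tree_vertices T"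
  shows "measure_pmf.expectation (walk_step \<beta> T x) F +
      measure_pmf.expectation (walk_step \<beta> T x) (\<lambda>y. (h y - h x - 1)\<^sup>2) / (real (Suc (length x)))\<^sup>2 \<le> F x"
proof -
  have int: "integrable (measure_pmf (walk_step \<beta> T x)) f" for f :: "nat list \<Rightarrow> real"
    by (rule integrable_measure_pmf_finite, rule finite_set_pmf_walk_step) (use root_has_child \<beta> in auto)
  have "measure_pmf.expectation (walk_step \<beta> T x) (\<lambda>y. (h y - h x - 1)\<^sup>2)
     = measure_pmf.expectation (walk_step \<beta> T x) (\<lambda>y. (h y - h x)\<^sup>2 - 2 * (h y - h x) + 1)"
    by (intro Bochner_Integration.integral_cong) (auto simp: power2_eq_square algebra_simps)
  also have "\<dots> = measure_pmf.expectation (walk_step \<beta> T x) (\<lambda>y. (h y - h x)\<^sup>2) - 1"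
    using int h_drift[OF x] by simp
  finally have "measure_pmf.expectation (walk_step \<beta> T x) (\<lambda>y. (h y - h x - 1)\<^sup>2) / (real (Suc (length x)))\<^sup>2
     \<le> w (length x) * measure_pmf.expectation (walk_step \<beta> T x) (\<lambda>y. (h y - h x)\<^sup>2)"
    by (simp add: w_def divide_right_mono)
  then show ?thesis using F_drift[OF x] by linarith
qed

lemma F_nonneg: "0 \<le> F x"
proof -
  have dF: "- g (length y - 1) \<le> dF y" for y
    using g_nonneg[of "length y - 1"] C_nonneg w_nonneg by (auto simp: dF_def intro: order_trans[of _ 0])
  have "(\<Sum>n<length x. - g n) \<le> path_sum dF x"
    unfolding path_sum_def
  proof (rule sum_mono)
    fix n assume "n \<in> {..<length x}"
    then show "- g n \<le> dF (take (Suc n) x)" using dF[of "take (Suc n) x"] by simp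
  qed
  moreover have "(\<Sum>n<length x. g n) \<le> suminf g"
    using summable_g g_nonneg by (intro sum_le_suminf) auto
  ultimately show ?thesis by (simp add: F_def sum_negf)
qed

lemma h_lln: "AE X in walk_law \<beta> T. (\<lambda>n. h (X n) / real n) \<longlonglongrightarrow> 1"
  using \<beta> root_has_child h_drift F_lyapunov F_nonneg
  by (intro walk_law_lyapunov_lln[where F = F]) auto

definition H :: "nat \<Rightarrow> real" where "H k = (\<Sum>n<k. m n)"

lemma h_r: "h (r k) = H k"
proof (induction k)
  case (Suc k)
  have "h (r (Suc k)) = h (r k) + dh (r (Suc k))" by (simp only: h_def r_Suc path_sum_snoc)
  then show ?case using Suc by (simp add: H_def dh_def)
qed (simp add: h_def H_def)

text \<open>The average of \<open>m\<close> over a long stretch of the spine, hence the reciprocal of the speed.\<close>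

definition c :: real where "c = ((\<beta> + 1) + 2 * \<beta> * b) / (\<beta> - 1)"

lemma b_nonneg: "0 \<le> b"
  by (rule LIMSEQ_le_const[OF B_mean]) (auto intro!: divide_nonneg_nonneg sum_nonneg B_nonneg)

lemma c_pos: "0 < c" using \<beta> b_nonneg by (auto simp: c_def intro!: divide_pos_pos add_pos_nonneg)

text \<open>The recursion of \<open>m\<close>, summed. Since \<open>m n = o(n)\<close>, it determines the growth of \<open>H\<close> without solving the
recursion.\<close>

lemma H_identity: "(\<beta> - 1) * H n + \<beta> * m n = real n * (1 + \<beta>) + \<beta> + 2 * \<beta> * (\<Sum>k<Suc n. B k)"
proof (induction n)
  case (Suc n)
  have "\<beta> * m (Suc n) = m n + (1 + \<beta>) + 2 * \<beta> * B (Suc n)"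
    using \<beta> by (simp add: field_simps)
  then show ?case using Suc by (simp add: H_def algebra_simps del: m.simps)
qed (simp add: H_def algebra_simps)

lemma m_sublinear: "(\<lambda>k. m k / real (Suc k)) \<longlonglongrightarrow> 0"
  using summable_w_m by (intro tendsto_zero_of_square_summable) (simp add: w_def)

lemma H_lim: "(\<lambda>n. (H n - c * real n) / real (Suc n)) \<longlonglongrightarrow> 0"
proof -
  have "(\<lambda>n. (\<Sum>k<Suc n. B k) / real (Suc n)) \<longlonglongrightarrow> b"
    using B_mean by (rule LIMSEQ_Suc)
  moreover have "(\<lambda>n. 1 / real (Suc n)) \<longlonglongrightarrow> 0" by (rule LIMSEQ_Suc[OF lim_1_over_n])
  ultimately have "(\<lambda>n. (2 * \<beta> * ((\<Sum>k<Suc n. B k) / real (Suc n) - b) - \<beta> * (m n / real (Suc n)) + (\<beta> + 2 * \<beta> * b) * (1 / real (Suc n))) / (\<beta> - 1))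
      \<longlonglongrightarrow> (2 * \<beta> * (b - b) - \<beta> * 0 + (\<beta> + 2 * \<beta> * b) * 0) / (\<beta> - 1)"
    using m_sublinear \<beta> by (intro tendsto_intros) auto
  moreover have "(2 * \<beta> * ((\<Sum>k<Suc n. B k) / real (Suc n) - b) - \<beta> * (m n / real (Suc n)) + (\<beta> + 2 * \<beta> * b) * (1 / real (Suc n))) / (\<beta> - 1)
     = (H n - c * real n) / real (Suc n)" for n
  proof -
    let ?s = "real (Suc n)" and ?B = "\<Sum>k<Suc n. B k"
    have alg: "2 * \<beta> * (u / s - b) - \<beta> * (v / s) + d * (1 / s) = (2 * \<beta> * u - 2 * \<beta> * b * s - \<beta> * v + d) / s"
      if "s \<noteq> 0" for u v d s :: real using that by (simp add: field_simps)
    have "2 * \<beta> * (?B / ?s - b) - \<beta> * (m n / ?s) + (\<beta> + 2 * \<beta> * b) * (1 / ?s)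
      = (2 * \<beta> * ?B - 2 * \<beta> * b * ?s - \<beta> * m n + (\<beta> + 2 * \<beta> * b)) / ?s"
      by (rule alg) simp
    also have "2 * \<beta> * ?B - 2 * \<beta> * b * ?s - \<beta> * m n + (\<beta> + 2 * \<beta> * b) = (\<beta> - 1) * (H n - c * real n)"
    proof -
      have "(\<beta> - 1) * c = (\<beta> + 1) + 2 * \<beta> * b" using \<beta> by (simp add: c_def)
      then have "(\<beta> - 1) * (c * real n) = ((\<beta> + 1) + 2 * \<beta> * b) * real n" by (simp add: mult.assoc[symmetric])
      then show ?thesis using H_identity[of n] by (simp add: algebra_simps)
    qed
    finally show ?thesis using \<beta> by (simp del: of_nat_Suc sum.lessThan_Suc)
  qed
  ultimately show ?thesis by simp
qed

text \<open>If the path from the root to \<open>x\<close> leaves the spine at \<open>r k\<close>, then \<open>S\<close> decreases at least by the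
factor \<open>\<beta>\<close> with each further generation. The sum of \<open>S\<close> along the path below \<open>r k\<close> is thus at most
\<open>\<beta> / (\<beta> - 1) * B k\<close>, and it bounds both the change of \<open>h\<close> (up to the factor 2) and the number of generations,
because \<open>S \<ge> 1\<close>.\<close>

lemma trap_excursion_bound:
  assumes "x \<in> tree_vertices T"
  shows "\<exists>k\<le>length x. \<bar>h x - H k\<bar> + (real (length x) - real k) \<le> 3 * \<beta> / (\<beta> - 1) * B k"
proof -
  \<comment> \<open>The term \<open>3 * S x / (\<beta> - 1)\<close> is a reserve that pays for all generations below \<open>x\<close>.\<close>
  have "x = r (length x) \<or> (\<exists>k\<le>length x. \<bar>h x - H k\<bar> + (real (length x) - real k) + 3 * S x / (\<beta> - 1) \<le> 3 * \<beta> / (\<beta> - 1) * B k)"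
    using assms
  proof (induction x rule: rev_induct)
    case (snoc i x)
    then have x: "x \<in> tree_vertices T" and i: "i < T x" by auto
    let ?y = "x @ [i]"
    show ?case
    proof (cases "?y = r (length ?y)")
      case False
      have Sy: "1 \<le> S ?y" using S_ge_1[OF snoc.prems False] .
      have dh: "\<bar>dh ?y\<bar> \<le> 2 * S ?y - 1" using False Sy by (simp add: dh_def)
      have hy: "h ?y = h x + dh ?y" by (simp add: h_def)
      have eq: "3 * S ?y + 3 * S ?y / (\<beta> - 1) = 3 * \<beta> / (\<beta> - 1) * S ?y"
        using \<beta> by (simp add: field_simps)
      have "\<exists>k\<le>length ?y. \<bar>h ?y - H k\<bar> + (real (length ?y) - real k) + 3 * S ?y / (\<beta> - 1) \<le> 3 * \<beta> / (\<beta> - 1) * B k"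
      proof (cases "x = r (length x)")
        case True
        let ?k = "length x"
        have "S ?y \<le> B ?k" unfolding B_def
        proof -
          have "S (r ?k @ [i]) \<le> (\<Sum>i\<in>{..<T (r ?k)} - {j ?k}. S (r ?k @ [i]))"
            using i True False snoc_eq_r[of x i]
            by (intro member_le_sum[of i _ "\<lambda>i. S (r ?k @ [i])"] order_trans[OF _ trap_child]) auto
          then show "S ?y \<le> (\<Sum>i\<in>{..<T (r ?k)} - {j ?k}. S (r ?k @ [i]))" using True by simp
        qed
        then have "3 * \<beta> / (\<beta> - 1) * S ?y \<le> 3 * \<beta> / (\<beta> - 1) * B ?k"
          using \<beta> by (intro mult_left_mono) auto
        moreover have "h x = H ?k" using h_r[of ?k] True by simp
        ultimately show ?thesis using dh eq hy Sy by (intro exI[of _ ?k]) auto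
      next
        case F: False
        then obtain k where k: "k \<le> length x"
          "\<bar>h x - H k\<bar> + (real (length x) - real k) + 3 * S x / (\<beta> - 1) \<le> 3 * \<beta> / (\<beta> - 1) * B k"
          using snoc.IH[OF x] by auto
        have "S ?y \<le> (\<Sum>i<T x. S (x @ [i]))"
          using i by (intro member_le_sum[of i _ "\<lambda>i. S (x @ [i])"] order_trans[OF _ child_cost_trap(2)[OF x F]]) auto
        then have "\<beta> * S ?y \<le> S x" using S_rec[OF x F] mult_left_mono[of "S ?y" "\<Sum>i<T x. S (x @ [i])" \<beta>] \<beta> by linarith
        then have "3 * (\<beta> * S ?y) / (\<beta> - 1) \<le> 3 * S x / (\<beta> - 1)" using \<beta> by (intro divide_right_mono) auto
        then have "3 * S ?y + 3 * S ?y / (\<beta> - 1) \<le> 3 * S x / (\<beta> - 1)" unfolding eq by (simp add: mult.assoc)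
        then show ?thesis using k dh hy Sy by (intro exI[of _ k]) auto
      qed
      then show ?thesis by blast
    qed simp
  qed simp
  then show ?thesis
  proof
    assume x: "x = r (length x)"
    then have "h x = H (length x)" using h_r[of "length x"] by simp
    then show ?thesis using \<beta> B_nonneg by (intro exI[of _ "length x"]) auto
  next
    assume "\<exists>k\<le>length x. \<bar>h x - H k\<bar> + (real (length x) - real k) + 3 * S x / (\<beta> - 1) \<le> 3 * \<beta> / (\<beta> - 1) * B k"
    then obtain k where k: "k \<le> length x" "\<bar>h x - H k\<bar> + (real (length x) - real k) + 3 * S x / (\<beta> - 1) \<le> 3 * \<beta> / (\<beta> - 1) * B k"
      by blast
    show ?thesis
    proof (cases "x = r (length x)")
      case True
      then have "h x = H (length x)" using h_r[of "length x"] by simp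
      then show ?thesis using \<beta> B_nonneg by (intro exI[of _ "length x"]) auto
    next
      case False
      then have "0 \<le> 3 * S x / (\<beta> - 1)" using S_ge_1[OF assms] \<beta> by auto
      then show ?thesis using k by (intro exI[of _ k]) auto
    qed
  qed
qed

lemma h_approx:
  assumes "x \<in> tree_vertices T"
  shows "\<exists>k\<le>length x. \<bar>h x - c * real (length x)\<bar> \<le> \<bar>H k - c * real k\<bar> + (1 + c) * (3 * \<beta> / (\<beta> - 1) * B k)"
proof -
  obtain k where k: "k \<le> length x" and le: "\<bar>h x - H k\<bar> + (real (length x) - real k) \<le> 3 * \<beta> / (\<beta> - 1) * B k"
    using trap_excursion_bound[OF assms] by blast
  have "c * (real (length x) - real k) \<le> c * (3 * \<beta> / (\<beta> - 1) * B k)"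
    using le c_pos abs_ge_zero[of "h x - H k"] by (intro mult_left_mono) linarith+
  moreover have "\<bar>h x - c * real (length x)\<bar> \<le> \<bar>h x - H k\<bar> + \<bar>H k - c * real k\<bar> + c * (real (length x) - real k)"
  proof -
    have "0 \<le> c * (real (length x) - real k)" using k c_pos by simp
    then show ?thesis by (simp add: right_diff_distrib)
  qed
  moreover have "(1 + c) * (3 * \<beta> / (\<beta> - 1) * B k) = 3 * \<beta> / (\<beta> - 1) * B k + c * (3 * \<beta> / (\<beta> - 1) * B k)"
    by (simp only: distrib_right mult_1)
  moreover have "\<bar>h x - H k\<bar> \<le> 3 * \<beta> / (\<beta> - 1) * B k" using k le by linarith
  ultimately have "\<bar>h x - c * real (length x)\<bar> \<le> \<bar>H k - c * real k\<bar> + (1 + c) * (3 * \<beta> / (\<beta> - 1) * B k)"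
    by linarith
  then show ?thesis using k by blast
qed

text \<open>Up to an error \<open>e k\<close> with \<open>e k = o(k)\<close> and \<open>k \<le> length (X n) \<le> n\<close>, \<open>h (X n)\<close> is \<open>c * length (X n)\<close>; and \<open>h (X n) \<sim> n\<close>.\<close>

theorem walk_speed: "AE X in walk_law \<beta> T. (\<lambda>n. real (length (X n)) / real n) \<longlonglongrightarrow> 1 / c"
proof -
  have "AE X in walk_law \<beta> T. \<forall>n. X n \<in> tree_vertices T \<and> length (X n) \<le> n"
    using \<beta> root_has_child by (intro AE_walk_law_vertices) auto
  with h_lln show ?thesis
  proof eventually_elim
    case (elim X)
    define e where "e k = \<bar>H k - c * real k\<bar> + (1 + c) * (3 * \<beta> / (\<beta> - 1) * B k)" for k
    have "(\<lambda>k. \<bar>(H k - c * real k) / real (Suc k)\<bar> + (1 + c) * (3 * \<beta> / (\<beta> - 1)) * (B k / real (Suc k))) \<longlonglongrightarrow> \<bar>0\<bar> + (1 + c) * (3 * \<beta> / (\<beta> - 1)) * 0"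
      using H_lim tendsto_zero_of_square_summable[OF B_sq] by (intro tendsto_intros)
    moreover have "\<bar>(H k - c * real k) / real (Suc k)\<bar> + (1 + c) * (3 * \<beta> / (\<beta> - 1)) * (B k / real (Suc k)) = e k / real (Suc k)" for k
      by (simp add: e_def add_divide_distrib abs_divide mult.assoc del: of_nat_Suc)
    ultimately have e: "(\<lambda>k. e k / real (Suc k)) \<longlonglongrightarrow> 0" by simp
    have "(\<lambda>n. (h (X n) - c * real (length (X n))) / real n) \<longlonglongrightarrow> 0"
    proof (rule sublinear_reindex[OF e])
      fix n
      show "\<exists>k\<le>n. \<bar>h (X n) - c * real (length (X n))\<bar> \<le> e k"
        unfolding e_def using h_approx[of "X n"] elim(2) by (meson order_trans)
    qed
    with elim(1) have "(\<lambda>n. (h (X n) / real n - (h (X n) - c * real (length (X n))) / real n) / c) \<longlonglongrightarrow> (1 - 0) / c"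
      using c_pos by (intro tendsto_intros) auto
    then show ?case using c_pos by (simp add: diff_divide_distrib)
  qed
qed

end

section \<open>Total weight of a subcritical Galton-Watson tree\<close>

abbreviation iid_law :: "'v pmf \<Rightarrow> ('i \<Rightarrow> 'v) measure" where
  "iid_law q \<equiv> PiM UNIV (\<lambda>_. measure_pmf q)"

lemma prob_space_iid_law: "prob_space (iid_law q)"
  by (intro prob_space_PiM measure_pmf.prob_space_axioms)

lemma space_iid_law [simp]: "space (iid_law q) = UNIV"
  by (simp add: space_PiM)

lemma measurable_iid_component [measurable]: "(\<lambda>x. x i) \<in> iid_law q \<rightarrow>\<^sub>M count_space UNIV"
  using measurable_component_singleton[of i UNIV "\<lambda>_. measure_pmf q"]
  by (simp add: measurable_cong_sets[OF refl sets_measure_pmf_count_space])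

lemma nn_integral_iid_component:
  "(\<integral>\<^sup>+x. g (x i) \<partial>iid_law q) = (\<integral>\<^sup>+a. g a \<partial>measure_pmf q)"
proof -
  have "distr (iid_law q) (measure_pmf q) (\<lambda>x. x i) = measure_pmf q"
    by (rule distr_PiM_component) (auto simp: measure_pmf.prob_space_axioms)
  then have "(\<integral>\<^sup>+a. g a \<partial>measure_pmf q) = (\<integral>\<^sup>+a. g a \<partial>distr (iid_law q) (measure_pmf q) (\<lambda>x. x i))"
    by simp
  also have "\<dots> = (\<integral>\<^sup>+x. g (x i) \<partial>iid_law q)"
    by (subst nn_integral_distr) auto
  finally show ?thesis by simp
qed

lemma nn_integral_iid_reindex:
  fixes f :: "'j \<Rightarrow> 'i" and g :: "('j \<Rightarrow> 'v) \<Rightarrow> ennreal"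
  assumes f: "inj f" and g: "g \<in> borel_measurable (iid_law q)"
  shows "(\<integral>\<^sup>+x. g (\<lambda>i. x (f i)) \<partial>iid_law q) = (\<integral>\<^sup>+x. g x \<partial>iid_law q)"
proof -
  have "distr (iid_law q :: ('i \<Rightarrow> 'v) measure) (iid_law q) (\<lambda>x. \<lambda>i\<in>UNIV. x (f i)) = iid_law q"
    using distr_PiM_reindex[of UNIV "\<lambda>_. measure_pmf q" f UNIV] f
    by (auto simp: measure_pmf.prob_space_axioms)
  then have "(\<integral>\<^sup>+x. g x \<partial>iid_law q) = (\<integral>\<^sup>+x. g x \<partial>distr (iid_law q :: ('i \<Rightarrow> 'v) measure) (iid_law q) (\<lambda>x i. x (f i)))"
    by (simp add: restrict_def)
  also have "\<dots> = (\<integral>\<^sup>+x. g (\<lambda>i. x (f i)) \<partial>iid_law q)"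
  proof (subst nn_integral_distr)
    show "(\<lambda>x i. x (f i)) \<in> (iid_law q :: ('i \<Rightarrow> 'v) measure) \<rightarrow>\<^sub>M iid_law q"
      by (rule measurable_PiM_single') auto
  qed (use g in simp_all)
  finally show ?thesis by simp
qed

text \<open>Functionals of an independent family that read disjoint sets of coordinates are independent.
Locality is expressed on the full product space: the value is unchanged when coordinates outside \<open>K k\<close>
are altered.\<close>

lemma indep_vars_iid_local:
  fixes q :: "'v pmf" and f :: "'k \<Rightarrow> ('i \<Rightarrow> 'v) \<Rightarrow> ennreal"
  assumes meas: "\<And>k. k \<in> L \<Longrightarrow> f k \<in> borel_measurable (iid_law q)"
    and local: "\<And>k x y. k \<in> L \<Longrightarrow> (\<And>i. i \<in> K k \<Longrightarrow> x i = y i) \<Longrightarrow> f k x = f k y"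
    and disj: "disjoint_family_on K L"
  shows "prob_space.indep_vars (iid_law q) (\<lambda>_. borel) f L"
proof -
  interpret prob_space "iid_law q :: ('i \<Rightarrow> 'v) measure" by (rule prob_space_iid_law)
  have comp: "(\<lambda>x. x i) \<in> iid_law q \<rightarrow>\<^sub>M measure_pmf q" for i by measurable
  have "indep_vars (\<lambda>_. measure_pmf q) (\<lambda>i x. x i) UNIV"
  proof (subst indep_vars_iff_distr_eq_PiM')
    have "distr (iid_law q) (iid_law q) (\<lambda>x. restrict (\<lambda>i. x i) UNIV) = iid_law q"
      by (simp add: restrict_def distr_id)
    also have "\<dots> = PiM UNIV (\<lambda>i. distr (iid_law q) (measure_pmf q) (\<lambda>x. x i))"
      by (intro PiM_cong refl distr_PiM_component[symmetric]) (auto simp: measure_pmf.prob_space_axioms)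
    finally show "distr (iid_law q) (iid_law q) (\<lambda>x. restrict (\<lambda>i. x i) UNIV) = PiM UNIV (\<lambda>i. distr (iid_law q) (measure_pmf q) (\<lambda>x. x i))" .
  qed (use comp in auto)
  then have "indep_vars (\<lambda>k. PiM (K k) (\<lambda>_. measure_pmf q)) (\<lambda>k x. restrict (\<lambda>i. x i) (K k)) L"
    using disj by (intro indep_vars_restrict) auto
  then have "indep_vars (\<lambda>_. borel) (\<lambda>k x. f k (\<lambda>i. if i \<in> K k then restrict (\<lambda>i. x i) (K k) i else undefined)) L"
  proof (rule indep_vars_compose2[where Y = "\<lambda>k \<omega>. f k (\<lambda>i. if i \<in> K k then \<omega> i else undefined)"])
    fix k assume "k \<in> L"
    have "(\<lambda>\<omega>. (\<lambda>i. if i \<in> K k then \<omega> i else undefined)) \<in> PiM (K k) (\<lambda>_. measure_pmf q) \<rightarrow>\<^sub>M iid_law q"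
    proof (rule measurable_PiM_single')
      fix i :: 'i
      show "(\<lambda>\<omega>. if i \<in> K k then \<omega> i else undefined) \<in> PiM (K k) (\<lambda>_. measure_pmf q) \<rightarrow>\<^sub>M measure_pmf q"
        using measurable_component_singleton[of i "K k" "\<lambda>_. measure_pmf q"] by (cases "i \<in> K k") auto
    qed auto
    from measurable_compose[OF this meas[OF \<open>k \<in> L\<close>]]
    show "(\<lambda>\<omega>. f k (\<lambda>i. if i \<in> K k then \<omega> i else undefined)) \<in> borel_measurable (PiM (K k) (\<lambda>_. measure_pmf q))" .
  qed
  also have "?this \<longleftrightarrow> indep_vars (\<lambda>_. borel) f L"
    by (intro indep_vars_cong refl ext local) auto
  finally show ?thesis .
qed

lemma nn_integral_iid_prod_local:
  fixes q :: "'v pmf" and f :: "'k \<Rightarrow> ('i \<Rightarrow> 'v) \<Rightarrow> ennreal"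
  assumes "finite L" "\<And>k. k \<in> L \<Longrightarrow> f k \<in> borel_measurable (iid_law q)"
    and "\<And>k x y. k \<in> L \<Longrightarrow> (\<And>i. i \<in> K k \<Longrightarrow> x i = y i) \<Longrightarrow> f k x = f k y"
    and "disjoint_family_on K L"
  shows "(\<integral>\<^sup>+x. (\<Prod>k\<in>L. f k x) \<partial>iid_law q) = (\<Prod>k\<in>L. \<integral>\<^sup>+x. f k x \<partial>iid_law q)"
  by (intro prob_space.indep_vars_nn_integral prob_space_iid_law indep_vars_iid_local[where K = K] assms) auto

text \<open>The weight of the descendants of \<open>u\<close> up to \<open>N\<close> generations below it. Extended nonnegative values make
the limit \<open>subtree_weight\<close> and its expectation meaningful before finiteness is known.\<close>

primrec truncated_weight :: "real \<Rightarrow> nat \<Rightarrow> tree \<Rightarrow> nat list \<Rightarrow> ennreal" where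
  "truncated_weight \<beta> 0 T u = 1"
| "truncated_weight \<beta> (Suc N) T u = 1 + ennreal \<beta> * (\<Sum>i<T u. truncated_weight \<beta> N T (u @ [i]))"

definition subtree_weight :: "real \<Rightarrow> tree \<Rightarrow> nat list \<Rightarrow> ennreal" where
  "subtree_weight \<beta> T u = (SUP N. truncated_weight \<beta> N T u)"

lemma incseq_truncated_weight: "incseq (\<lambda>N. truncated_weight \<beta> N T u)"
proof (rule incseq_SucI)
  show "truncated_weight \<beta> N T u \<le> truncated_weight \<beta> (Suc N) T u" for N
  proof (induction N arbitrary: u)
    case (Suc N)
    show ?case
      unfolding truncated_weight.simps(2)[of \<beta> "Suc N" T u] truncated_weight.simps(2)[of \<beta> N T u]
      by (intro add_left_mono mult_left_mono sum_mono Suc.IH) simp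
  qed simp
qed

lemma subtree_weight_rec:
  "subtree_weight \<beta> T u = 1 + ennreal \<beta> * (\<Sum>i<T u. subtree_weight \<beta> T (u @ [i]))"
proof -
  have lim: "(\<lambda>N. truncated_weight \<beta> N T u) \<longlonglongrightarrow> subtree_weight \<beta> T u" for u
    unfolding subtree_weight_def by (rule LIMSEQ_SUP[OF incseq_truncated_weight])
  have "(\<lambda>N. 1 + ennreal \<beta> * (\<Sum>i<T u. truncated_weight \<beta> N T (u @ [i]))) \<longlonglongrightarrow> 1 + ennreal \<beta> * (\<Sum>i<T u. subtree_weight \<beta> T (u @ [i]))"
    by (intro tendsto_add tendsto_const ennreal_tendsto_cmult tendsto_sum lim) auto
  moreover have "(\<lambda>N. 1 + ennreal \<beta> * (\<Sum>i<T u. truncated_weight \<beta> N T (u @ [i]))) \<longlonglongrightarrow> subtree_weight \<beta> T u"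
    using LIMSEQ_Suc[OF lim[of u]] by simp
  ultimately show ?thesis by (rule LIMSEQ_unique[symmetric])
qed

text \<open>The weight reads only the labels at and below the vertex, and it is invariant under relabelling
of the root of the subtree. Both uses matter: the first gives independence, the second equality of laws.\<close>

lemma truncated_weight_cong:
  "(\<And>v. T (u @ v) = T' (u' @ v)) \<Longrightarrow> truncated_weight \<beta> N T u = truncated_weight \<beta> N T' u'"
proof (induction N arbitrary: u u')
  case (Suc N)
  have "truncated_weight \<beta> N T (u @ [i]) = truncated_weight \<beta> N T' (u' @ [i])" for i
    using Suc.prems by (intro Suc.IH) simp
  then show ?case using Suc.prems[of "[]"] by simp
qed simp

lemma subtree_weight_cong:
  "(\<And>v. T (u @ v) = T' (u' @ v)) \<Longrightarrow> subtree_weight \<beta> T u = subtree_weight \<beta> T' u'"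
  unfolding subtree_weight_def by (intro SUP_cong refl truncated_weight_cong)

lemma measurable_truncated_weight [measurable]:
  "(\<lambda>\<xi>. truncated_weight \<beta> N \<xi> u) \<in> borel_measurable (iid_law p)"
proof (induction N arbitrary: u)
  case (Suc N)
  have "(\<lambda>\<xi>. \<Sum>i<\<xi> u. truncated_weight \<beta> N \<xi> (u @ [i])) \<in> borel_measurable (iid_law p)"
    by (rule measurable_compose_countable[where f = "\<lambda>d \<xi>. \<Sum>i<d. truncated_weight \<beta> N \<xi> (u @ [i])"])
       (use Suc in measurable)
  then show ?case by simp
qed simp

lemma measurable_subtree_weight [measurable]:
  "(\<lambda>\<xi>. subtree_weight \<beta> \<xi> u) \<in> borel_measurable (iid_law p)"
  unfolding subtree_weight_def by measurable

text \<open>Wald's identity for the children of \<open>u\<close>: \<open>f i\<close> reads only labels strictly below \<open>u\<close>, hence is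
independent of the number of children of \<open>u\<close>.\<close>

lemma nn_integral_random_sum:
  assumes f: "\<And>i. f i \<in> borel_measurable (iid_law p)"
    and local: "\<And>i x y. (\<And>v. x (u @ i # v) = y (u @ i # v)) \<Longrightarrow> f i x = f i y"
    and e: "\<And>i. (\<integral>\<^sup>+\<xi>. f i \<xi> \<partial>iid_law p) = e"
    and int: "integrable (measure_pmf p) real"
  shows "(\<integral>\<^sup>+\<xi>. (\<Sum>i<\<xi> u. f i \<xi>) \<partial>iid_law p) = ennreal (offspring_mean p) * e"
proof -
  have ind: "(\<lambda>\<xi>. indicator {i<..} (\<xi> u) :: ennreal) \<in> borel_measurable (iid_law p)" for i
    by (rule measurable_compose[OF measurable_iid_component]) simp
  have "(\<integral>\<^sup>+\<xi>. (\<Sum>i<\<xi> u. f i \<xi>) \<partial>iid_law p) = (\<integral>\<^sup>+\<xi>. (\<Sum>i. indicator {i<..} (\<xi> u) * f i \<xi>) \<partial>iid_law p)"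
  proof (intro nn_integral_cong)
    fix \<xi> :: "nat list \<Rightarrow> nat"
    have "(\<Sum>i. indicator {i<..} (\<xi> u) * f i \<xi>) = (\<Sum>i<\<xi> u. indicator {i<..} (\<xi> u) * f i \<xi>)"
      by (rule suminf_finite) auto
    also have "\<dots> = (\<Sum>i<\<xi> u. f i \<xi>)" by (intro sum.cong) auto
    finally show "(\<Sum>i<\<xi> u. f i \<xi>) = (\<Sum>i. indicator {i<..} (\<xi> u) * f i \<xi>)" by simp
  qed
  also have "\<dots> = (\<Sum>i. \<integral>\<^sup>+\<xi>. indicator {i<..} (\<xi> u) * f i \<xi> \<partial>iid_law p)"
    by (intro nn_integral_suminf borel_measurable_times_ennreal ind f)
  also have "\<dots> = (\<Sum>i. (\<integral>\<^sup>+k. indicator {i<..} k \<partial>measure_pmf p) * e)"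
  proof (rule suminf_cong)
    fix i
    let ?f = "\<lambda>b \<xi>. if b then indicator {i<..} (\<xi> u) else f i \<xi>"
    let ?K = "\<lambda>b. if b then {u} else range (\<lambda>v. u @ i # v)"
    have "(\<integral>\<^sup>+\<xi>. (\<Prod>b\<in>UNIV. ?f b \<xi>) \<partial>iid_law p) = (\<Prod>b\<in>UNIV. \<integral>\<^sup>+\<xi>. ?f b \<xi> \<partial>iid_law p)"
    proof (rule nn_integral_iid_prod_local[where K = ?K])
      fix b
      show "?f b \<in> borel_measurable (iid_law p)" using f ind by (cases b) auto
      fix x y :: "nat list \<Rightarrow> nat" assume "\<And>v. v \<in> ?K b \<Longrightarrow> x v = y v"
      then show "?f b x = ?f b y" by (cases b) (auto intro!: local)
    qed (auto simp: disjoint_family_on_def)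
    then show "(\<integral>\<^sup>+\<xi>. indicator {i<..} (\<xi> u) * f i \<xi> \<partial>iid_law p) = (\<integral>\<^sup>+k. indicator {i<..} k \<partial>measure_pmf p) * e"
      by (simp add: UNIV_bool e nn_integral_iid_component[where g = "indicator {i<..}"] mult.commute)
  qed
  also have "\<dots> = (\<integral>\<^sup>+k. (\<Sum>i. indicator {i<..} k) \<partial>measure_pmf p) * e"
    by (subst nn_integral_suminf) auto
  also have "(\<integral>\<^sup>+k. (\<Sum>i. indicator {i<..} k) \<partial>measure_pmf p) = (\<integral>\<^sup>+k. ennreal (real k) \<partial>measure_pmf p)"
  proof (intro nn_integral_cong)
    fix k :: nat
    have "(\<Sum>i. indicator {i<..} k :: ennreal) = (\<Sum>i<k. indicator {i<..} k)"
      by (rule suminf_finite) auto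
    also have "\<dots> = (\<Sum>i<k. 1)" by (intro sum.cong) auto
    finally show "(\<Sum>i. indicator {i<..} k) = ennreal (real k)" by (simp add: ennreal_of_nat_eq_real_of_nat)
  qed
  also have "\<dots> = ennreal (offspring_mean p)"
    unfolding offspring_mean_def using int by (intro nn_integral_eq_integral) auto
  finally show ?thesis .
qed

lemma nn_integral_truncated_weight:
  assumes "0 \<le> \<beta>" and int: "integrable (measure_pmf p) real"
  shows "(\<integral>\<^sup>+\<xi>. truncated_weight \<beta> N \<xi> u \<partial>iid_law p) = ennreal (\<Sum>n\<le>N. (\<beta> * offspring_mean p) ^ n)"
proof (induction N arbitrary: u)
  case 0
  interpret prob_space "iid_law p :: (nat list \<Rightarrow> nat) measure" by (rule prob_space_iid_law)
  show ?case using emeasure_space_1 by simp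
next
  case (Suc N)
  interpret prob_space "iid_law p :: (nat list \<Rightarrow> nat) measure" by (rule prob_space_iid_law)
  define a where "a = (\<Sum>n\<le>N. (\<beta> * offspring_mean p) ^ n)"
  have mu0: "0 \<le> offspring_mean p" by (simp add: offspring_mean_def)
  have a0: "0 \<le> a" unfolding a_def using assms mu0 by (intro sum_nonneg) auto
  have [measurable]: "(\<lambda>\<xi>. \<Sum>i<\<xi> u. truncated_weight \<beta> N \<xi> (u @ [i])) \<in> borel_measurable (iid_law p)"
    by (rule measurable_compose_countable[where f = "\<lambda>d \<xi>. \<Sum>i<d. truncated_weight \<beta> N \<xi> (u @ [i])"]) measurable
  have "(\<integral>\<^sup>+\<xi>. (\<Sum>i<\<xi> u. truncated_weight \<beta> N \<xi> (u @ [i])) \<partial>iid_law p) = ennreal (offspring_mean p) * ennreal a"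
    unfolding a_def by (rule nn_integral_random_sum[OF _ _ Suc.IH int]) (auto intro: truncated_weight_cong)
  then have "(\<integral>\<^sup>+\<xi>. truncated_weight \<beta> (Suc N) \<xi> u \<partial>iid_law p) = 1 + ennreal \<beta> * (ennreal (offspring_mean p) * ennreal a)"
    using emeasure_space_1 by (simp add: nn_integral_add nn_integral_cmult)
  also have "\<dots> = ennreal (1 + \<beta> * (offspring_mean p * a))"
    using assms(1) mu0 a0 by (simp add: ennreal_mult)
  also have "1 + \<beta> * (offspring_mean p * a) = (\<Sum>n\<le>Suc N. (\<beta> * offspring_mean p) ^ n)"
    unfolding a_def by (subst sum.atMost_Suc_shift) (simp add: sum_distrib_left mult_ac)
  finally show ?case .
qed

lemma nn_integral_subtree_weight:
  assumes "0 \<le> \<beta>" and int: "integrable (measure_pmf p) real" and lt: "\<beta> * offspring_mean p < 1"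
  shows "(\<integral>\<^sup>+\<xi>. subtree_weight \<beta> \<xi> u \<partial>iid_law p) = ennreal (1 / (1 - \<beta> * offspring_mean p))"
proof -
  have mu0: "0 \<le> \<beta> * offspring_mean p" using assms by (simp add: offspring_mean_def)
  have "(\<integral>\<^sup>+\<xi>. subtree_weight \<beta> \<xi> u \<partial>iid_law p) = (SUP N. \<integral>\<^sup>+\<xi>. truncated_weight \<beta> N \<xi> u \<partial>iid_law p)"
    unfolding subtree_weight_def
    by (rule nn_integral_monotone_convergence_SUP) (use incseq_truncated_weight in \<open>auto simp: incseq_def le_fun_def\<close>)
  also have "\<dots> = (SUP N. ennreal (\<Sum>n\<le>N. (\<beta> * offspring_mean p) ^ n))"
    by (simp only: nn_integral_truncated_weight[OF assms(1,2)])
  also have "\<dots> = ennreal (1 / (1 - \<beta> * offspring_mean p))"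
  proof (rule LIMSEQ_unique[OF LIMSEQ_SUP])
    show "incseq (\<lambda>N. ennreal (\<Sum>n\<le>N. (\<beta> * offspring_mean p) ^ n))"
      using mu0 by (intro incseq_SucI ennreal_leI) simp
    have "(\<lambda>n. (\<beta> * offspring_mean p) ^ n) sums (1 / (1 - \<beta> * offspring_mean p))"
      using mu0 lt by (intro geometric_sums) auto
    then show "(\<lambda>N. ennreal (\<Sum>n\<le>N. (\<beta> * offspring_mean p) ^ n)) \<longlonglongrightarrow> ennreal (1 / (1 - \<beta> * offspring_mean p))"
      by (intro tendsto_ennrealI) (simp add: sums_def_le)
  qed
  finally show ?thesis .
qed

section \<open>Independence and averages along the spine\<close>

text \<open>For \<open>t = (d, i)\<close>, the total weight of the subtrees at those of the first \<open>d\<close> children of \<open>u\<close> that are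
different from the child \<open>i\<close>.\<close>

definition side_weight :: "real \<Rightarrow> nat \<times> nat \<Rightarrow> tree \<Rightarrow> nat list \<Rightarrow> ennreal" where
  "side_weight \<beta> t T u = (\<Sum>i\<in>{..<fst t} - {snd t}. subtree_weight \<beta> T (u @ [i]))"

abbreviation gw_input :: "nat pmf \<Rightarrow> ((nat list \<Rightarrow> nat) \<times> (nat \<Rightarrow> nat \<times> nat)) measure" where
  "gw_input p \<equiv> iid_law p \<Otimes>\<^sub>M iid_law (special_pmf p)"

text \<open>The weight hanging off the special vertex of generation \<open>k\<close>, as a function of the randomness from which
the tree is assembled. It is computed from the normal labels, which agree with the assembled tree off the spine.\<close>

definition bush :: "real \<Rightarrow> nat \<Rightarrow> (nat list \<Rightarrow> nat) \<times> (nat \<Rightarrow> nat \<times> nat) \<Rightarrow> ennreal" where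
  "bush \<beta> k \<omega> = side_weight \<beta> (snd \<omega> k) (fst \<omega>) (spine (snd \<omega>) k)"

lemma length_spine [simp]: "length (spine s k) = k" by (simp add: spine_def)

lemma nth_spine [simp]: "i < k \<Longrightarrow> spine s k ! i = snd (s i)" by (simp add: spine_def)

lemma measurable_side_weight [measurable]:
  "(\<lambda>\<xi>. side_weight \<beta> t \<xi> u) \<in> borel_measurable (iid_law p)"
  unfolding side_weight_def by measurable

lemma side_weight_local:
  assumes "\<And>v. v \<in> {u @ i # w | i w. i \<noteq> snd t} \<Longrightarrow> x v = y v"
  shows "side_weight \<beta> t x u = side_weight \<beta> t y u"
  unfolding side_weight_def using assms by (intro sum.cong refl subtree_weight_cong) auto

lemma side_weight_shift: "side_weight \<beta> t x u = side_weight \<beta> t (\<lambda>v. x (u @ v)) []"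
  unfolding side_weight_def by (intro sum.cong refl subtree_weight_cong) auto

lemma nn_integral_side_weight_shift:
  assumes [measurable]: "g \<in> borel_measurable borel"
  shows "(\<integral>\<^sup>+\<xi>. g (side_weight \<beta> t \<xi> u) \<partial>iid_law p) = (\<integral>\<^sup>+\<xi>. g (side_weight \<beta> t \<xi> []) \<partial>iid_law p)"
  unfolding side_weight_shift[of \<beta> t _ u]
  by (rule nn_integral_iid_reindex[where g = "\<lambda>\<xi>. g (side_weight \<beta> t \<xi> [])"]) (auto simp: inj_def)

text \<open>The bush of generation \<open>k\<close> consists of labels whose entry at position \<open>k\<close> differs from the spine, whereas
all labels in later bushes agree with the spine there.\<close>

lemma disjoint_side_labels:
  "disjoint_family_on (\<lambda>k. {spine s k @ i # w | i w. i \<noteq> snd (s k)}) J"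
proof -
  have "spine s k @ i # w \<noteq> spine s k' @ i' # w'" if "k < k'" "i \<noteq> snd (s k)" for k k' i i' w w'
  proof
    assume "spine s k @ i # w = spine s k' @ i' # w'"
    then have "(spine s k @ i # w) ! k = (spine s k' @ i' # w') ! k" by simp
    with that show False by (simp add: nth_append)
  qed
  then have "spine s k @ i # w \<noteq> spine s k' @ i' # w'" if "k \<noteq> k'" "i \<noteq> snd (s k)" "i' \<noteq> snd (s k')" for k k' i i' w w'
    using that by (cases k k' rule: linorder_cases) (metis, simp, metis)
  then show ?thesis unfolding disjoint_family_on_def by blast
qed

lemma measurable_spine [measurable]: "(\<lambda>s. spine s k) \<in> iid_law q \<rightarrow>\<^sub>M count_space UNIV"
proof -
  have "(\<lambda>s. spine s k) -` {l} \<inter> space (iid_law q) \<in> sets (iid_law q)" for l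
  proof -
    have "(\<lambda>s. spine s k) -` {l} \<inter> space (iid_law q) =
      (if length l = k then {s \<in> space (iid_law q). \<forall>i\<in>{i. i < k}. snd (s i) = l ! i} else {})"
      by (auto simp: spine_def path_prefix_eq_iff)
    moreover
    have "{s \<in> space (iid_law q). snd (s i) = a} \<in> sets (iid_law q)" for i a
    proof -
      have "(\<lambda>s. s i) -` {t. snd t = a} \<inter> space (iid_law q) \<in> sets (iid_law q)"
        by (rule measurable_sets[OF measurable_iid_component]) simp
      then show ?thesis by (simp add: vimage_def)
    qed
    then have "{s \<in> space (iid_law q). \<forall>i\<in>{i. i < k}. snd (s i) = l ! i} \<in> sets (iid_law q)"
      by (intro sets.sets_Collect_finite_All) auto
    ultimately show ?thesis by simp
  qed
  then show ?thesis by (subst measurable_count_space_eq2_countable) auto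
qed

lemma measurable_bush [measurable]: "bush \<beta> k \<in> borel_measurable (gw_input p)"
  unfolding bush_def
proof (rule measurable_compose_countable[where f = "\<lambda>l \<omega>. side_weight \<beta> (snd \<omega> k) (fst \<omega>) l"])
  show "(\<lambda>\<omega>. spine (snd \<omega>) k) \<in> gw_input p \<rightarrow>\<^sub>M count_space UNIV"
    by (rule measurable_compose[OF measurable_snd measurable_spine])
  show "(\<lambda>\<omega>. side_weight \<beta> (snd \<omega> k) (fst \<omega>) l) \<in> borel_measurable (gw_input p)" for l
  proof (rule measurable_compose_countable[where f = "\<lambda>t \<omega>. side_weight \<beta> t (fst \<omega>) l"])
    show "(\<lambda>\<omega>. snd \<omega> k) \<in> gw_input p \<rightarrow>\<^sub>M count_space UNIV"
      by (rule measurable_compose[OF measurable_snd measurable_iid_component])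
    show "(\<lambda>\<omega>. side_weight \<beta> t (fst \<omega>) l) \<in> borel_measurable (gw_input p)" for t
      by (rule measurable_compose[OF measurable_fst measurable_side_weight])
  qed
qed

text \<open>For a fixed spine \<open>s\<close> the bushes are independent, and by shift invariance the law of the bush of
generation \<open>j\<close> depends on \<open>s\<close> through \<open>s j\<close> alone. The \<open>s j\<close> are themselves independent, so the product
form survives integration over \<open>s\<close>. This single identity yields both independence and equality in law.\<close>

lemma nn_integral_bush_prod:
  assumes J: "finite J" and g [measurable]: "\<And>j. g j \<in> borel_measurable borel"
  shows "(\<integral>\<^sup>+\<omega>. (\<Prod>j\<in>J. g j (bush \<beta> j \<omega>)) \<partial>gw_input p) =
    (\<Prod>j\<in>J. \<integral>\<^sup>+t. (\<integral>\<^sup>+\<xi>. g j (side_weight \<beta> t \<xi> []) \<partial>iid_law p) \<partial>measure_pmf (special_pmf p))"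
proof -
  interpret A: prob_space "iid_law p :: (nat list \<Rightarrow> nat) measure" by (rule prob_space_iid_law)
  interpret B: prob_space "iid_law (special_pmf p) :: (nat \<Rightarrow> nat \<times> nat) measure" by (rule prob_space_iid_law)
  interpret pair_sigma_finite "iid_law p :: (nat list \<Rightarrow> nat) measure" "iid_law (special_pmf p) :: (nat \<Rightarrow> nat \<times> nat) measure" ..
  define G where "G j t = (\<integral>\<^sup>+\<xi>. g j (side_weight \<beta> t \<xi> []) \<partial>iid_law p)" for j t
  have "(\<integral>\<^sup>+\<omega>. (\<Prod>j\<in>J. g j (bush \<beta> j \<omega>)) \<partial>gw_input p) =
     (\<integral>\<^sup>+s. (\<integral>\<^sup>+\<xi>. (\<Prod>j\<in>J. g j (bush \<beta> j (\<xi>, s))) \<partial>iid_law p) \<partial>iid_law (special_pmf p))"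
    by (rule nn_integral_snd[symmetric]) measurable
  also have "\<dots> = (\<integral>\<^sup>+s. (\<Prod>j\<in>J. G j (s j)) \<partial>iid_law (special_pmf p))"
  proof (rule nn_integral_cong)
    fix s :: "nat \<Rightarrow> nat \<times> nat"
    have "(\<integral>\<^sup>+\<xi>. (\<Prod>j\<in>J. g j (side_weight \<beta> (s j) \<xi> (spine s j))) \<partial>iid_law p) =
        (\<Prod>j\<in>J. \<integral>\<^sup>+\<xi>. g j (side_weight \<beta> (s j) \<xi> (spine s j)) \<partial>iid_law p)"
      by (rule nn_integral_iid_prod_local[where K = "\<lambda>k. {spine s k @ i # w | i w. i \<noteq> snd (s k)}", OF J _ _ disjoint_side_labels])
         (measurable, rule arg_cong[where f = "g _"], rule side_weight_local, blast)
    also have "\<dots> = (\<Prod>j\<in>J. G j (s j))"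
      unfolding G_def by (intro prod.cong refl nn_integral_side_weight_shift g)
    finally show "(\<integral>\<^sup>+\<xi>. (\<Prod>j\<in>J. g j (bush \<beta> j (\<xi>, s))) \<partial>iid_law p) = (\<Prod>j\<in>J. G j (s j))"
      by (simp add: bush_def)
  qed
  also have "\<dots> = (\<Prod>j\<in>J. \<integral>\<^sup>+s. G j (s j) \<partial>iid_law (special_pmf p))"
  proof (rule nn_integral_iid_prod_local[where K = "\<lambda>j. {j}", OF J])
    show "(\<lambda>s. G j (s j)) \<in> borel_measurable (iid_law (special_pmf p))" for j
      by (rule measurable_compose[OF measurable_iid_component]) simp
  qed (auto simp: disjoint_family_on_def)
  also have "\<dots> = (\<Prod>j\<in>J. \<integral>\<^sup>+t. G j t \<partial>measure_pmf (special_pmf p))"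
    by (simp add: nn_integral_iid_component)
  finally show ?thesis by (simp add: G_def)
qed

lemma nn_integral_bush:
  assumes "g \<in> borel_measurable borel"
  shows "(\<integral>\<^sup>+\<omega>. g (bush \<beta> k \<omega>) \<partial>gw_input p) =
    (\<integral>\<^sup>+t. (\<integral>\<^sup>+\<xi>. g (side_weight \<beta> t \<xi> []) \<partial>iid_law p) \<partial>measure_pmf (special_pmf p))"
  using nn_integral_bush_prod[where J = "{k}" and g = "\<lambda>_. g" and \<beta> = \<beta> and p = p] assms by simp

lemma prob_space_gw_input: "prob_space (gw_input p)"
proof -
  interpret A: prob_space "iid_law p :: (nat list \<Rightarrow> nat) measure" by (rule prob_space_iid_law)
  interpret B: prob_space "iid_law (special_pmf p) :: (nat \<Rightarrow> nat \<times> nat) measure" by (rule prob_space_iid_law)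
  interpret pair_prob_space "iid_law p :: (nat list \<Rightarrow> nat) measure" "iid_law (special_pmf p) :: (nat \<Rightarrow> nat \<times> nat) measure" ..
  show ?thesis by unfold_locales
qed

lemma indep_vars_bush: "prob_space.indep_vars (gw_input p) (\<lambda>_. borel) (bush \<beta>) UNIV"
proof -
  interpret prob_space "gw_input p" by (rule prob_space_gw_input)
  show ?thesis
    unfolding indep_vars_def2
  proof (intro conjI ballI indep_setsI)
    fix A J
    assume J: "J \<noteq> {}" "J \<subseteq> (UNIV :: nat set)" "finite J"
      and "\<forall>j\<in>J. A j \<in> {bush \<beta> j -` B \<inter> space (gw_input p) |B. B \<in> sets borel}"
    then have "\<forall>j\<in>J. \<exists>B. B \<in> sets borel \<and> A j = bush \<beta> j -` B \<inter> space (gw_input p)" by blast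
    then obtain B where B: "\<And>j. j \<in> J \<Longrightarrow> B j \<in> sets borel" "\<And>j. j \<in> J \<Longrightarrow> A j = bush \<beta> j -` B j \<inter> space (gw_input p)"
      by metis
    define g :: "nat \<Rightarrow> ennreal \<Rightarrow> ennreal" where "g j = (if j \<in> J then indicator (B j) else (\<lambda>_. 0))" for j
    have g: "g j \<in> borel_measurable borel" for j using B by (auto simp: g_def)
    have A: "A j \<in> sets (gw_input p)" if "j \<in> J" for j
      unfolding B(2)[OF that] by (rule measurable_sets[OF measurable_bush B(1)[OF that]])
    have eA: "emeasure (gw_input p) (A j) = (\<integral>\<^sup>+\<omega>. g j (bush \<beta> j \<omega>) \<partial>gw_input p)" if "j \<in> J" for j
      unfolding nn_integral_indicator[OF A[OF that], symmetric]
      using B(2)[OF that] that by (intro nn_integral_cong) (auto simp: g_def indicator_def)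
    have "emeasure (gw_input p) (\<Inter>j\<in>J. A j) = (\<integral>\<^sup>+\<omega>. (\<Prod>j\<in>J. g j (bush \<beta> j \<omega>)) \<partial>gw_input p)"
    proof -
      have "(\<Inter>j\<in>J. A j) \<in> sets (gw_input p)" using A J by (intro sets.finite_INT) auto
      then have "emeasure (gw_input p) (\<Inter>j\<in>J. A j) = (\<integral>\<^sup>+\<omega>. indicator (\<Inter>j\<in>J. A j) \<omega> \<partial>gw_input p)" by simp
      also have "\<dots> = (\<integral>\<^sup>+\<omega>. (\<Prod>j\<in>J. g j (bush \<beta> j \<omega>)) \<partial>gw_input p)"
      proof (rule nn_integral_cong)
        fix \<omega> assume \<omega>: "\<omega> \<in> space (gw_input p)"
        have "(\<Prod>j\<in>J. g j (bush \<beta> j \<omega>)) = (\<Prod>j\<in>J. indicator (A j) \<omega>)"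
          using B(2) \<omega> by (intro prod.cong) (auto simp: g_def indicator_def)
        also have "\<dots> = indicator (\<Inter>j\<in>J. A j) \<omega>"
          using J(3) by (induction rule: finite_induct) (auto simp: indicator_def)
        finally show "indicator (\<Inter>j\<in>J. A j) \<omega> = (\<Prod>j\<in>J. g j (bush \<beta> j \<omega>))" by simp
      qed
      finally show ?thesis .
    qed
    also have "\<dots> = (\<Prod>j\<in>J. emeasure (gw_input p) (A j))"
      unfolding nn_integral_bush_prod[OF J(3) g] by (intro prod.cong refl) (simp add: eA nn_integral_bush[OF g])
    finally show "prob (\<Inter>j\<in>J. A j) = (\<Prod>j\<in>J. prob (A j))"
      by (simp add: emeasure_eq_measure prod_ennreal prod_nonneg)
  qed auto
qed

lemma map_fst_special_pmf: "map_pmf fst (special_pmf p) = size_biased p"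
  by (simp add: special_pmf_def map_bind_pmf bind_return_pmf')

lemma set_special_pmf:
  assumes "offspring_mean p > 0" "t \<in> set_pmf (special_pmf p)"
  shows "snd t < fst t"
proof -
  obtain k i where t: "t = (k, i)" by (cases t)
  then have k: "k \<in> set_pmf (size_biased p)" and i: "i \<in> set_pmf (pmf_of_set {..<k})"
    using assms(2) by (auto simp: special_pmf_def)
  have "k \<noteq> 0" using k pmf_size_biased[OF assms(1), of k] by (auto simp: set_pmf_iff)
  then have "set_pmf (pmf_of_set {..<k}) = {..<k}" by (intro set_pmf_of_set) auto
  then show ?thesis using i t by auto
qed

text \<open>Size biasing turns the mean of \<open>k - 1\<close> into \<open>E (k * (k - 1)) / \<mu>\<close>, and \<open>E (k\<^sup>2) = \<sigma>2 + \<mu>\<^sup>2\<close>.\<close>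

lemma nn_integral_special_siblings:
  assumes \<mu>: "offspring_mean p > 0" and sq: "integrable (measure_pmf p) (\<lambda>k. (real k)\<^sup>2)"
    and int: "integrable (measure_pmf p) real"
  shows "(\<integral>\<^sup>+t. of_nat (card ({..<fst t} - {snd t})) \<partial>measure_pmf (special_pmf p)) =
    ennreal ((measure_pmf.variance p real - offspring_mean p * (1 - offspring_mean p)) / offspring_mean p)"
proof -
  have "(\<integral>\<^sup>+t. of_nat (card ({..<fst t} - {snd t})) \<partial>measure_pmf (special_pmf p)) =
     (\<integral>\<^sup>+t. of_nat (fst t - 1) \<partial>measure_pmf (special_pmf p))"
    by (intro nn_integral_cong_AE) (use set_special_pmf[OF \<mu>] in \<open>auto simp: AE_measure_pmf_iff\<close>)
  also have "\<dots> = (\<integral>\<^sup>+k. of_nat (k - 1) \<partial>measure_pmf (size_biased p))"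
    by (simp add: map_fst_special_pmf[symmetric])
  also have "\<dots> = (\<integral>\<^sup>+k. ennreal (pmf p k) * ennreal (real k * real (k - 1) / offspring_mean p) \<partial>count_space UNIV)"
    unfolding nn_integral_measure_pmf pmf_size_biased[OF \<mu>] using \<mu>
    by (intro nn_integral_cong) (simp add: ennreal_of_nat_eq_real_of_nat ennreal_mult[symmetric] mult_ac)
  also have "\<dots> = (\<integral>\<^sup>+k. ennreal (((real k)\<^sup>2 - real k) / offspring_mean p) \<partial>measure_pmf p)"
  proof -
    have "real k * real (k - 1) = (real k)\<^sup>2 - real k" for k
      by (cases k) (auto simp: power2_eq_square algebra_simps)
    then show ?thesis unfolding nn_integral_measure_pmf by simp
  qed
  also have "\<dots> = ennreal (measure_pmf.expectation p (\<lambda>k. ((real k)\<^sup>2 - real k) / offspring_mean p))"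
  proof (rule nn_integral_eq_integral)
    have "0 \<le> ((real k)\<^sup>2 - real k) / offspring_mean p" for k
      using \<mu> by (cases k) (auto simp: power2_eq_square algebra_simps)
    then show "AE k in measure_pmf p. 0 \<le> ((real k)\<^sup>2 - real k) / offspring_mean p" by simp
  qed (use sq int in auto)
  also have "measure_pmf.expectation p (\<lambda>k. ((real k)\<^sup>2 - real k) / offspring_mean p) =
     (measure_pmf.expectation p (\<lambda>k. (real k)\<^sup>2) - offspring_mean p) / offspring_mean p"
    using sq int by (simp add: offspring_mean_def)
  also have "measure_pmf.expectation p (\<lambda>k. (real k)\<^sup>2) - offspring_mean p = measure_pmf.variance p real - offspring_mean p * (1 - offspring_mean p)"
    using measure_pmf.variance_eq[OF int sq] by (simp add: offspring_mean_def power2_eq_square algebra_simps)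
  finally show ?thesis .
qed

lemma AE_environment:
  fixes \<beta> :: real
  assumes \<beta>: "0 \<le> \<beta>" and \<mu>: "offspring_mean p > 0" and sq: "integrable (measure_pmf p) (\<lambda>k. (real k)\<^sup>2)"
    and lt: "\<beta> * offspring_mean p < 1"
  defines "b \<equiv> (measure_pmf.variance p real - offspring_mean p * (1 - offspring_mean p)) / (offspring_mean p * (1 - \<beta> * offspring_mean p))"
  shows "AE \<omega> in gw_input p. (\<forall>k. bush \<beta> k \<omega> < \<infinity>) \<and> (\<forall>k. snd (snd \<omega> k) < fst (snd \<omega> k)) \<and>
     (\<lambda>n. (\<Sum>k<n. enn2real (bush \<beta> k \<omega>)) / real n) \<longlonglongrightarrow> b \<and>
     summable (\<lambda>n. (enn2real (bush \<beta> n \<omega>))\<^sup>2 / (real (Suc n))\<^sup>2)"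
proof -
  interpret A: prob_space "iid_law p :: (nat list \<Rightarrow> nat) measure" by (rule prob_space_iid_law)
  interpret B: prob_space "iid_law (special_pmf p) :: (nat \<Rightarrow> nat \<times> nat) measure" by (rule prob_space_iid_law)
  interpret pair_prob_space "iid_law p :: (nat list \<Rightarrow> nat) measure" "iid_law (special_pmf p) :: (nat \<Rightarrow> nat \<times> nat) measure" ..
  interpret prob_space "gw_input p" by (rule prob_space_gw_input)
  have int: "integrable (measure_pmf p) real"
    using \<mu> not_integrable_integral_eq unfolding offspring_mean_def by fastforce
  let ?v = "measure_pmf.variance p real - offspring_mean p * (1 - offspring_mean p)"
  have bush_mean: "(\<integral>\<^sup>+\<omega>. bush \<beta> k \<omega> \<partial>gw_input p) = ennreal b" for k
  proof -
    have "(\<integral>\<^sup>+\<omega>. bush \<beta> k \<omega> \<partial>gw_input p) =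
      (\<integral>\<^sup>+t. (\<integral>\<^sup>+\<xi>. side_weight \<beta> t \<xi> [] \<partial>iid_law p) \<partial>measure_pmf (special_pmf p))"
      using nn_integral_bush[where g = "\<lambda>x. x" and \<beta> = \<beta> and k = k and p = p] by simp
    also have "\<dots> = (\<integral>\<^sup>+t. of_nat (card ({..<fst t} - {snd t})) * ennreal (1 / (1 - \<beta> * offspring_mean p)) \<partial>measure_pmf (special_pmf p))"
      unfolding side_weight_def
      by (simp add: nn_integral_sum nn_integral_subtree_weight[OF \<beta> int lt])
    also have "\<dots> = ennreal (?v / offspring_mean p) * ennreal (1 / (1 - \<beta> * offspring_mean p))"
      by (simp add: nn_integral_multc nn_integral_special_siblings[OF \<mu> sq int])
    also have "\<dots> = ennreal b"
      using lt by (simp add: b_def ennreal_mult''[symmetric])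
    finally show ?thesis .
  qed
  have fin: "AE \<omega> in gw_input p. \<forall>k. bush \<beta> k \<omega> < \<infinity>"
  proof (subst AE_all_countable, intro allI)
    fix k
    have "AE \<omega> in gw_input p. bush \<beta> k \<omega> \<noteq> \<infinity>"
      by (rule nn_integral_PInf_AE) (simp_all add: bush_mean)
    then show "AE \<omega> in gw_input p. bush \<beta> k \<omega> < \<infinity>" by (simp add: less_top)
  qed
  have child: "AE \<omega> in gw_input p. \<forall>k. snd (snd \<omega> k) < fst (snd \<omega> k)"
  proof (subst AE_all_countable, intro allI)
    fix k
    have "AE s in (iid_law (special_pmf p) :: (nat \<Rightarrow> nat \<times> nat) measure). snd (s k) < fst (s k)"
      by (rule AE_PiM_component[where P = "\<lambda>t. snd t < fst t"])
         (auto simp: measure_pmf.prob_space_axioms AE_measure_pmf_iff set_special_pmf[OF \<mu>])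
    moreover have "(\<lambda>\<omega>. snd \<omega> k) \<in> gw_input p \<rightarrow>\<^sub>M count_space UNIV"
      by (rule measurable_compose[OF measurable_snd measurable_iid_component])
    from measurable_sets[OF this, of "{t. snd t < fst t}"]
    have "{\<omega> \<in> space (gw_input p). snd (snd \<omega> k) < fst (snd \<omega> k)} \<in> sets (gw_input p)"
      by (simp add: vimage_def Int_def conj_commute)
    ultimately show "AE \<omega> in gw_input p. snd (snd \<omega> k) < fst (snd \<omega> k)"
      by (intro AE_pair_measure) auto
  qed
  define X where "X k \<omega> = enn2real (bush \<beta> k \<omega>)" for k \<omega>
  have [measurable]: "X k \<in> borel_measurable (gw_input p)" for k unfolding X_def by measurable
  have indep: "indep_vars (\<lambda>_. borel) X UNIV"
    unfolding X_def by (rule indep_vars_compose2[OF indep_vars_bush]) simp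
  have iid: "distr (gw_input p) borel (X n) = distr (gw_input p) borel (X 0)" for n
  proof (rule measure_eqI)
    fix S assume "S \<in> sets (distr (gw_input p) borel (X n))"
    then have S [measurable]: "S \<in> sets borel" by simp
    have "emeasure (distr (gw_input p) borel (X k)) S = (\<integral>\<^sup>+\<omega>. indicator S (enn2real (bush \<beta> k \<omega>)) \<partial>gw_input p)" for k
    proof -
      have "emeasure (distr (gw_input p) borel (X k)) S = (\<integral>\<^sup>+x. indicator S x \<partial>distr (gw_input p) borel (X k))" by simp
      also have "\<dots> = (\<integral>\<^sup>+\<omega>. indicator S (X k \<omega>) \<partial>gw_input p)" by (rule nn_integral_distr) auto
      finally show ?thesis by (simp add: X_def)
    qed
    then show "emeasure (distr (gw_input p) borel (X n)) S = emeasure (distr (gw_input p) borel (X 0)) S"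
      using nn_integral_bush[where g = "\<lambda>x. indicator S (enn2real x)" and \<beta> = \<beta> and p = p] by simp
  qed simp
  have nnX: "(\<integral>\<^sup>+\<omega>. ennreal (X 0 \<omega>) \<partial>gw_input p) = ennreal b"
  proof -
    have "(\<integral>\<^sup>+\<omega>. ennreal (X 0 \<omega>) \<partial>gw_input p) = (\<integral>\<^sup>+\<omega>. bush \<beta> 0 \<omega> \<partial>gw_input p)"
      using fin by (intro nn_integral_cong_AE) (auto simp: X_def less_top elim!: eventually_mono)
    then show ?thesis by (simp add: bush_mean)
  qed
  have X0: "0 \<le> X k \<omega>" for k \<omega> by (simp add: X_def)
  have b0: "0 \<le> b"
  proof -
    have "((real k)\<^sup>2 - real k) \<ge> 0" for k by (cases k) (auto simp: power2_eq_square algebra_simps)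
    then have "0 \<le> measure_pmf.expectation p (\<lambda>k. (real k)\<^sup>2 - real k)" by simp
    also have "\<dots> = ?v"
      using measure_pmf.variance_eq[OF int sq] int sq by (simp add: offspring_mean_def power2_eq_square algebra_simps)
    finally show ?thesis using \<mu> lt by (simp add: b_def)
  qed
  have intX: "integrable (gw_input p) (X 0)"
    by (rule integrableI_nonneg) (use nnX X0 in auto)
  have EX: "expectation (X 0) = b"
    using nn_integral_eq_integral[OF intX] X0 nnX b0 by simp
  note slln = strong_law_iid_nonneg[OF indep iid X0 intX, unfolded EX]
  from slln fin child show ?thesis
    unfolding X_def by eventually_elim auto
qed

lemma assemble_tree_spine: "assemble_tree \<xi> s (spine s k) = fst (s k)"
  by (simp add: assemble_tree_def)

lemma assemble_tree_off_spine:
  assumes "u \<noteq> spine s (length u)"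
  shows "assemble_tree \<xi> s (u @ v) = \<xi> (u @ v)"
proof -
  have "u @ v \<noteq> spine s (length (u @ v))"
  proof
    assume e: "u @ v = spine s (length (u @ v))"
    have "take (length u) (spine s (length (u @ v))) = spine s (length u)"
      by (simp add: spine_def take_map)
    moreover have "take (length u) (u @ v) = u" by simp
    ultimately show False using assms e by metis
  qed
  then show ?thesis by (simp add: assemble_tree_def)
qed

text \<open>A finite bush forces the weight of every vertex off the spine to be finite (\<open>W_fin\<close>), because a parent
carries at least \<open>\<beta>\<close> times the weight of its child; the recursion then passes from extended to real values.\<close>

lemma AE_walk_speed_assemble:
  fixes \<beta> b :: real
  assumes \<beta>: "1 < \<beta>"
    and fin: "\<And>k. bush \<beta> k (\<xi>, s) < \<infinity>"
    and child: "\<And>k. snd (s k) < fst (s k)"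
    and avg: "(\<lambda>n. (\<Sum>k<n. enn2real (bush \<beta> k (\<xi>, s))) / real n) \<longlonglongrightarrow> b"
    and sq: "summable (\<lambda>n. (enn2real (bush \<beta> n (\<xi>, s)))\<^sup>2 / (real (Suc n))\<^sup>2)"
  shows "AE X in walk_law \<beta> (assemble_tree \<xi> s).
    (\<lambda>n. real (length (X n)) / real n) \<longlonglongrightarrow> (\<beta> - 1) / ((\<beta> + 1) + 2 * \<beta> * b)"
proof -
  let ?T = "assemble_tree \<xi> s"
  let ?W = "subtree_weight \<beta> ?T"
  have T_spine: "?T (spine s k) = fst (s k)" for k by (rule assemble_tree_spine)
  have spine_Suc: "spine s (Suc k) = spine s k @ [snd (s k)]" for k by (simp add: spine_def)
  have off: "spine s k @ [i] \<noteq> spine s (length (spine s k @ [i]))" if "i \<noteq> snd (s k)" for k i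
    using that by (simp add: spine_Suc)
  have side: "bush \<beta> k (\<xi>, s) = (\<Sum>i\<in>{..<fst (s k)} - {snd (s k)}. ?W (spine s k @ [i]))" for k
    unfolding bush_def side_weight_def fst_conv snd_conv
    by (intro sum.cong refl subtree_weight_cong assemble_tree_off_spine[symmetric] off) auto
  have W_fin: "?W x < \<infinity>" if "x \<in> tree_vertices ?T" "x \<noteq> spine s (length x)" for x
    using that
  proof (induction x rule: rev_induct)
    case (snoc i y)
    then have y: "y \<in> tree_vertices ?T" and i: "i < ?T y" by auto
    show ?case
    proof (cases "y = spine s (length y)")
      case True
      then have "i < fst (s (length y))" using i T_spine[of "length y"] by simp
      moreover have "i \<noteq> snd (s (length y))" using True snoc.prems(2) by (auto simp: spine_Suc)
      ultimately have "?W (spine s (length y) @ [i]) \<le> bush \<beta> (length y) (\<xi>, s)"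
        unfolding side by (intro member_le_sum[where f = "\<lambda>i. ?W (spine s (length y) @ [i])"]) auto
      then show ?thesis using fin[of "length y"] True by (simp add: order.strict_trans1)
    next
      case False
      have "(\<Sum>i<?T y. ?W (y @ [i])) < \<infinity>"
      proof -
        have "1 + ennreal \<beta> * (\<Sum>i<?T y. ?W (y @ [i])) < \<infinity>"
          using snoc.IH[OF y False] subtree_weight_rec[of \<beta> ?T y] by simp
        then show ?thesis using \<beta> by (auto simp: ennreal_mult_less_top)
      qed
      moreover have "?W (y @ [i]) \<le> (\<Sum>i<?T y. ?W (y @ [i]))"
        using i by (intro member_le_sum[where f = "\<lambda>i. ?W (y @ [i])"]) auto
      ultimately show ?thesis by (simp add: order.strict_trans1)
    qed
  qed (simp add: spine_def)
  define S where "S x = enn2real (?W x)" for x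
  have B: "(\<Sum>i\<in>{..<?T (spine s k)} - {snd (s k)}. S (spine s k @ [i])) = enn2real (bush \<beta> k (\<xi>, s))" for k
    unfolding side S_def T_spine
  proof -
    have "?W (spine s k @ [i]) < top" if "i \<in> {..<fst (s k)} - {snd (s k)}" for i
      using fin[of k] that unfolding side by simp
    then show "(\<Sum>i\<in>{..<fst (s k)} - {snd (s k)}. enn2real (?W (spine s k @ [i]))) =
        enn2real (\<Sum>i\<in>{..<fst (s k)} - {snd (s k)}. ?W (spine s k @ [i]))"
      by (subst enn2real_sum) (auto simp: comp_def)
  qed
  have spine_map: "map (\<lambda>k. snd (s k)) [0..<k] = spine s k" for k by (simp add: spine_def)
  interpret tree_with_spine \<beta> b ?T "\<lambda>k. snd (s k)" S "\<lambda>k. map (\<lambda>k. snd (s k)) [0..<k]"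
    "\<lambda>k. \<Sum>i\<in>{..<?T (map (\<lambda>k. snd (s k)) [0..<k])} - {snd (s k)}. S (map (\<lambda>k. snd (s k)) [0..<k] @ [i])"
  proof (unfold_locales, unfold spine_map B)
    show "1 < \<beta>" by fact
    show "snd (s k) < ?T (spine s k)" for k using child by (simp add: T_spine)
    fix x assume x: "x \<in> tree_vertices ?T" "x \<noteq> spine s (length x)"
    have Sx: "?W x = ennreal (S x)" using W_fin[OF x] by (simp add: S_def)
    have "?W (x @ [i]) = ennreal (S (x @ [i]))" if "i < ?T x" for i
    proof -
      have "x @ [i] \<noteq> spine s (length (x @ [i]))" using x(2) by (auto simp: spine_Suc)
      then have "?W (x @ [i]) < \<infinity>" using x(1) that by (intro W_fin) auto
      then show ?thesis by (simp add: S_def)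
    qed
    then have "ennreal (S x) = 1 + ennreal \<beta> * (\<Sum>i<?T x. ennreal (S (x @ [i])))"
      using subtree_weight_rec[of \<beta> ?T x] Sx by simp
    also have "\<dots> = ennreal (1 + \<beta> * (\<Sum>i<?T x. S (x @ [i])))"
      using \<beta> by (simp add: S_def ennreal_mult sum_nonneg)
    finally show rec: "S x = 1 + \<beta> * (\<Sum>i<?T x. S (x @ [i]))"
      using \<beta> by (subst (asm) ennreal_inj) (auto simp: S_def intro!: add_nonneg_nonneg mult_nonneg_nonneg sum_nonneg)
    show "1 \<le> S x" unfolding rec using \<beta> by (auto simp: S_def intro!: mult_nonneg_nonneg sum_nonneg)
  qed (use avg sq in auto)
  show ?thesis using walk_speed by (simp add: c_def)
qed

section \<open>The annealed speed\<close>

theorem corollary4p5: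
  fixes p :: "nat pmf" and \<beta> \<mu> \<sigma>2 :: real
  assumes mean: "\<mu> = offspring_mean p" and subcritical: "0 < \<mu>" "\<mu> < 1"
    and nondegenerate: "\<exists>k\<ge>2. pmf p k > 0"
    and finite_variance: "integrable (measure_pmf p) (\<lambda>k. (real k)\<^sup>2)"
    and variance: "\<sigma>2 = measure_pmf.variance p real"
    and bias: "\<beta> * \<mu> < 1" "\<beta> > 1"
  shows "AE (T, X) in annealed_law \<beta> p.
           (\<lambda>n. real (tree_dist T (X n) []) / real n) \<longlonglongrightarrow>
             \<mu> * (\<beta> - 1) * (1 - \<beta> * \<mu>) /
             (\<mu> * (\<beta> + 1) * (1 - \<beta> * \<mu>) + 2 * \<beta> * (\<sigma>2 - \<mu> * (1 - \<mu>)))"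
proof -
  define \<nu> where "\<nu> = \<mu> * (\<beta> - 1) * (1 - \<beta> * \<mu>) /
             (\<mu> * (\<beta> + 1) * (1 - \<beta> * \<mu>) + 2 * \<beta> * (\<sigma>2 - \<mu> * (1 - \<mu>)))"
  define b where "b = (\<sigma>2 - \<mu> * (1 - \<mu>)) / (\<mu> * (1 - \<beta> * \<mu>))"
  have \<nu>: "(\<beta> - 1) / ((\<beta> + 1) + 2 * \<beta> * b) = \<nu>"
  proof -
    \<comment> \<open>Clearing the denominator of \<open>b\<close>.\<close>
    define m where "m = \<mu> * (1 - \<beta> * \<mu>)"
    have m: "m > 0" using subcritical bias by (simp add: m_def)
    have "(\<beta> - 1) / ((\<beta> + 1) + 2 * \<beta> * b) = (m * (\<beta> - 1)) / (m * ((\<beta> + 1) + 2 * \<beta> * b))"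
      using m by simp
    also have "m * ((\<beta> + 1) + 2 * \<beta> * b) = m * (\<beta> + 1) + 2 * \<beta> * (m * b)"
      by (simp add: algebra_simps)
    also have "m * b = \<sigma>2 - \<mu> * (1 - \<mu>)"
    proof -
      have "b = (\<sigma>2 - \<mu> * (1 - \<mu>)) / m" by (simp add: b_def m_def)
      then show ?thesis using m by simp
    qed
    finally show ?thesis by (simp add: \<nu>_def m_def mult_ac)
  qed
  \<comment> \<open>The distance from the root is not visibly a measurable function of the tree and the path. The event
    \<open>good\<close> is measurable, and it implies the claim because the distance of a vertex is its length.\<close>
  define good where "good = (\<lambda>(T, X). (\<forall>n. X n \<in> tree_vertices T) \<and> (\<lambda>n. real (length (X n)) / real n) \<longlonglongrightarrow> \<nu>)"
  have X_meas [measurable]: "(\<lambda>TX. snd TX n) \<in> tree_space \<Otimes>\<^sub>M path_space \<rightarrow>\<^sub>M count_space UNIV" for n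
    unfolding path_space_def by (rule measurable_compose[OF measurable_snd measurable_component_singleton]) auto
  have T_meas [measurable]: "(\<lambda>TX. fst TX u) \<in> tree_space \<Otimes>\<^sub>M path_space \<rightarrow>\<^sub>M count_space UNIV" for u
    unfolding tree_space_def by (rule measurable_compose[OF measurable_fst measurable_component_singleton]) auto
  have good_meas: "Measurable.pred (tree_space \<Otimes>\<^sub>M path_space) good"
  proof -
    have "Measurable.pred (tree_space \<Otimes>\<^sub>M path_space) (\<lambda>TX. snd TX n \<in> tree_vertices (fst TX))" for n
    proof (rule measurable_compose_countable[where f = "\<lambda>u TX. u \<in> tree_vertices (fst TX)" and g = "\<lambda>TX. snd TX n", OF _ X_meas])
      show "Measurable.pred (tree_space \<Otimes>\<^sub>M path_space) (\<lambda>TX. u \<in> tree_vertices (fst TX))" for u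
        unfolding tree_vertices_def mem_Collect_eq by measurable
    qed
    moreover have "(\<lambda>TX. real (length (snd TX n)) / real n) \<in> borel_measurable (tree_space \<Otimes>\<^sub>M path_space)" for n
      by (rule measurable_compose[OF X_meas]) simp
    ultimately show ?thesis
      unfolding good_def case_prod_beta by measurable
  qed
  let ?K = "\<lambda>T. walk_law \<beta> T \<bind> (\<lambda>X. return (tree_space \<Otimes>\<^sub>M path_space) (T, X))"
  have K_meas: "?K \<in> tree_space \<rightarrow>\<^sub>M subprob_algebra (tree_space \<Otimes>\<^sub>M path_space)"
    by (rule measurable_prob_algebraD) measurable
  have asm: "(\<lambda>\<omega>. assemble_tree (fst \<omega>) (snd \<omega>)) \<in> gw_input p \<rightarrow>\<^sub>M tree_space"
    using measurable_assemble_tree[of p "special_pmf p"] by (simp add: case_prod_beta')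
  have annealed: "annealed_law \<beta> p = gw_input p \<bind> (\<lambda>\<omega>. ?K (assemble_tree (fst \<omega>) (snd \<omega>)))"
    unfolding annealed_law_def surviving_gw_law_def case_prod_beta'
    by (rule bind_distr[OF asm K_meas]) (simp add: space_pair_measure)
  note env = AE_environment[of \<beta> p, folded mean variance, folded b_def]
  have "AE \<omega> in gw_input p. AE TX in ?K (assemble_tree (fst \<omega>) (snd \<omega>)). good TX"
  proof (rule AE_mp[OF env], goal_cases)
    case 5
    show ?case
    proof (rule AE_I2, rule impI, goal_cases)
    case elim: (1 \<omega>)
    let ?T = "assemble_tree (fst \<omega>) (snd \<omega>)"
    have env: "\<And>k. bush \<beta> k (fst \<omega>, snd \<omega>) < \<infinity>" "\<And>k. snd (snd \<omega> k) < fst (snd \<omega> k)"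
      "(\<lambda>n. (\<Sum>k<n. enn2real (bush \<beta> k (fst \<omega>, snd \<omega>))) / real n) \<longlonglongrightarrow> b"
      "summable (\<lambda>n. (enn2real (bush \<beta> n (fst \<omega>, snd \<omega>)))\<^sup>2 / (real (Suc n))\<^sup>2)"
      using elim by auto
    have root: "0 < ?T []" using assemble_tree_spine[of "fst \<omega>" "snd \<omega>" 0] env(2)[of 0] by (simp add: spine_def)
    have "AE X in walk_law \<beta> ?T. good (?T, X)"
      using AE_walk_speed_assemble[OF bias(2) env] AE_walk_law_vertices[where T = ?T and \<beta> = \<beta>, OF _ root] bias(2) unfolding \<nu>
      by (auto simp: good_def elim: eventually_elim2)
    moreover have "(\<lambda>X. return (tree_space \<Otimes>\<^sub>M path_space) (?T, X)) \<in> walk_law \<beta> ?T \<rightarrow>\<^sub>M subprob_algebra (tree_space \<Otimes>\<^sub>M path_space)"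
      by measurable
    ultimately show ?case
      using good_meas by (subst AE_bind[where B = "tree_space \<Otimes>\<^sub>M path_space"]) (auto simp: AE_return space_pair_measure)
    qed
  qed (use bias subcritical finite_variance in auto)
  then have "AE TX in annealed_law \<beta> p. good TX"
    unfolding annealed by (subst AE_bind[OF measurable_compose[OF asm K_meas] good_meas])
  then show ?thesis
    unfolding \<nu>_def[symmetric] by eventually_elim (auto simp: good_def tree_dist_root)
qed

end
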